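(* Let $\omega$ be a radial weight. Then the following statements are equivalent: (i) $P_\omega:L^\infty\to\mathcal{B}$ is bounded; (ii) there exists $C=C(\omega)>0$ such that for each $L\in(A^1_\omega)^\star$ there is a unique $g\in\mathcal{B}$ such that $L(f)=\langle f,g\rangle_{A^2_\omega}$ for all $f\in A^1_\omega$, and $\|g\|_{\mathcal{B}}\le C\|L\|$ (that is, $(A^1_\omega)^\star\subset\mathcal{B}$ via the $A^2_\omega$-pairing); (iii) there exists $C=C(\omega)>0$ such that for each $L\in\mathcal{B}_0^\star$ there is a unique $g\in A^1_\omega$ such that $L(f)=\langle f,g\rangle_{A^2_\omega}$ for all $f\in\mathcal{B}_0$, and $\|g\|_{A^1_\omega}\le C\|L\|$ (that is, $\mathcal{B}_0^\star\subset A^1_\omega$ via the $A^2_\omega$-pairing); (iv) $\omega\in\widehat{\mathcal{D}}$.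
   Context: $\mathbb{D}$ is the open unit disc of $\mathbb{C}$, $\mathcal{H}(\mathbb{D})$ the space of analytic functions in $\mathbb{D}$, and $dA(z)=\frac{dx\,dy}{\pi}$. A radial weight is a nonnegative function $\omega\in L^1([0,1))$ extended to $\mathbb{D}$ by $\omega(z)=\omega(|z|)$; it is assumed throughout that $\widehat{\omega}(z)=\int_{|z|}^1\omega(s)\,ds>0$ for all $z\in\mathbb{D}$. For $0<p<\infty$, $L^p_\omega$ is the space of measurable $f$ on $\mathbb{D}$ with $\|f\|_{L^p_\omega}^p=\int_{\mathbb{D}}|f(z)|^p\omega(z)\,dA(z)<\infty$, and $A^p_\omega=L^p_\omega\cap\mathcal{H}(\mathbb{D})$. Write $\omega_x=\int_0^1r^x\omega(r)\,dr$ for $x\ge0$. The reproducing kernel of $A^2_\omega$ is $B^\omega_z(\zeta)=\sum_{n=0}^\infty\frac{(\overline{z}\zeta)^n}{2\omega_{2n+1}}$, and the Bergman projection is $P_\omega(f)(z)=\int_{\mathbb{D}}f(\zeta)\overline{B^\omega_z(\zeta)}\,\omega(\zeta)\,dA(\zeta)$. $L^\infty$ is the space of (essentially) bounded measurable functions on $\mathbb{D}$. The Bloch space $\mathcal{B}$ consists of $f\in\mathcal{H}(\mathbb{D})$ with $\|f\|_{\mathcal{B}}=\sup_{z\in\mathbb{D}}|f'(z)|(1-|z|^2)+|f(0)|<\infty$; the little Bloch space $\mathcal{B}_0$ (with the norm of $\mathcal{B}$) consists of $f\in\mathcal{H}(\mathbb{D})$ with $f'(z)(1-|z|^2)\to0$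 as $|z|\to1^-$. $X^\star$ is the dual of $X$. The $A^2_\omega$-pairing is $\langle f,g\rangle_{A^2_\omega}=\lim_{r\to1^-}\int_{\mathbb{D}}f_r(z)\overline{g(z)}\,\omega(z)\,dA(z)$, where $f_r(z)=f(rz)$. $\omega\in\widehat{\mathcal{D}}$ means that there is $C=C(\omega)\ge1$ with $\widehat{\omega}(r)\le C\widehat{\omega}\left(\frac{1+r}{2}\right)$ for all $0\le r<1$. *)

theory Defs
  imports "HOL-Complex_Analysis.Complex_Analysis" "HOL-Probability.Essential_Supremum"
begin

abbreviation unit_disc :: "complex set" ("\<bbbD>")
  where "\<bbbD> \<equiv> ball 0 1"

definition dA :: "complex measure"
  where "dA = density (lebesgue_on \<bbbD>) (\<lambda>_. ennreal (1 / pi))"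

text \<open>A radial weight is given by its profile on \<open>[0,1)\<close>; its value at \<open>z\<close> in the disc is
  \<open>\<omega> (norm z)\<close>.  Values of \<open>\<omega>\<close> outside \<open>[0,1)\<close> are never used.\<close>

definition weight_tail :: "(real \<Rightarrow> real) \<Rightarrow> real \<Rightarrow> real"
  where "weight_tail \<omega> r = (LINT s:{r..<1}|lebesgue. \<omega> s)"

definition radial_weight :: "(real \<Rightarrow> real) \<Rightarrow> bool"
  where "radial_weight \<omega> \<longleftrightarrow>
    (\<forall>r\<in>{0..<1}. 0 \<le> \<omega> r) \<and> set_integrable lebesgue {0..<1} \<omega> \<and>
    (\<forall>r\<in>{0..<1}. 0 < weight_tail \<omega> r)"

definition moment :: "(real \<Rightarrow> real) \<Rightarrow> real \<Rightarrow> real"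
  where "moment \<omega> x = (LINT r:{0..<1}|lebesgue. r powr x * \<omega> r)"

definition D_hat :: "(real \<Rightarrow> real) set"
  where "D_hat = {\<omega>. \<exists>C\<ge>1. \<forall>r. 0 \<le> r \<and> r < 1 \<longrightarrow>
    weight_tail \<omega> r \<le> C * weight_tail \<omega> ((1 + r) / 2)}"

text \<open>Analytic functions on the disc are represented by total functions that vanish off the
  disc, so that equality of functions is equality on the disc.\<close>

definition hol_disc :: "(complex \<Rightarrow> complex) set"
  where "hol_disc = {f. f holomorphic_on \<bbbD> \<and> (\<forall>z. z \<notin> \<bbbD> \<longrightarrow> f z = 0)}"

definition Lp_weight :: "real \<Rightarrow> (real \<Rightarrow> real) \<Rightarrow> (complex \<Rightarrow> complex) set"
  where "Lp_weight p \<omega> = {f \<in> borel_measurable dA.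
    integrable dA (\<lambda>z. norm (f z) powr p * \<omega> (norm z))}"

definition Lp_weight_norm :: "real \<Rightarrow> (real \<Rightarrow> real) \<Rightarrow> (complex \<Rightarrow> complex) \<Rightarrow> real"
  where "Lp_weight_norm p \<omega> f = (LINT z|dA. norm (f z) powr p * \<omega> (norm z)) powr (1 / p)"

definition bergman_space :: "real \<Rightarrow> (real \<Rightarrow> real) \<Rightarrow> (complex \<Rightarrow> complex) set"
  where "bergman_space p \<omega> = Lp_weight p \<omega> \<inter> hol_disc"

definition Linf :: "(complex \<Rightarrow> complex) set"
  where "Linf = {f \<in> borel_measurable dA. esssup dA (\<lambda>z. ereal (norm (f z))) < \<infinity>}"

definition Linf_norm :: "(complex \<Rightarrow> complex) \<Rightarrow> real"
  where "Linf_norm f = real_of_ereal (esssup dA (\<lambda>z. ereal (norm (f z))))"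

definition bloch :: "(complex \<Rightarrow> complex) set"
  where "bloch = {f \<in> hol_disc. bdd_above ((\<lambda>z. norm (deriv f z) * (1 - (norm z)\<^sup>2)) ` \<bbbD>)}"

definition bloch_norm :: "(complex \<Rightarrow> complex) \<Rightarrow> real"
  where "bloch_norm f = (SUP z\<in>\<bbbD>. norm (deriv f z) * (1 - (norm z)\<^sup>2)) + norm (f 0)"

definition little_bloch :: "(complex \<Rightarrow> complex) set"
  where "little_bloch = {f \<in> hol_disc.
    ((\<lambda>z. deriv f z * of_real (1 - (norm z)\<^sup>2)) \<longlongrightarrow> 0) (filtercomap norm (at_left 1))}"

definition bergman_kernel :: "(real \<Rightarrow> real) \<Rightarrow> complex \<Rightarrow> complex \<Rightarrow> complex"
  where "bergman_kernel \<omega> z \<zeta> =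
    (\<Sum>n. (cnj z * \<zeta>) ^ n / of_real (2 * moment \<omega> (real (2 * n + 1))))"

definition bergman_proj :: "(real \<Rightarrow> real) \<Rightarrow> (complex \<Rightarrow> complex) \<Rightarrow> complex \<Rightarrow> complex"
  where "bergman_proj \<omega> f z =
    (if z \<in> \<bbbD> then LINT \<zeta>|dA. f \<zeta> * cnj (bergman_kernel \<omega> z \<zeta>) * of_real (\<omega> (norm \<zeta>)) else 0)"

text \<open>The dual of a space \<open>X\<close> of functions with norm \<open>N\<close>: complex-linear functionals that are
  bounded on \<open>X\<close>; the values of \<open>L\<close> outside \<open>X\<close> are irrelevant.\<close>

definition dual_space ::
    "(complex \<Rightarrow> complex) set \<Rightarrow> ((complex \<Rightarrow> complex) \<Rightarrow> real) \<Rightarrow> ((complex \<Rightarrow> complex) \<Rightarrow> complex) set"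
  where "dual_space X N = {L.
    (\<forall>f\<in>X. \<forall>g\<in>X. \<forall>a b. L (\<lambda>z. a * f z + b * g z) = a * L f + b * L g) \<and>
    (\<exists>K. \<forall>f\<in>X. norm (L f) \<le> K * N f)}"

definition dual_norm ::
    "(complex \<Rightarrow> complex) set \<Rightarrow> ((complex \<Rightarrow> complex) \<Rightarrow> real) \<Rightarrow> ((complex \<Rightarrow> complex) \<Rightarrow> complex) \<Rightarrow> real"
  where "dual_norm X N L = (SUP f\<in>{f\<in>X. N f \<le> 1}. norm (L f))"

text \<open>\<open>has_pairing \<omega> f g l\<close>: the \<open>A\<^sup>2\<^sub>\<omega>\<close>-pairing of \<open>f\<close> and \<open>g\<close> exists and equals \<open>l\<close>.  A Bloch
  function need not be integrable against \<open>\<omega>\<close>, and the library integral of a non-integrable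
  function is \<open>0\<close>, so convergence of the integrals is part of the definition.\<close>

definition has_pairing ::
    "(real \<Rightarrow> real) \<Rightarrow> (complex \<Rightarrow> complex) \<Rightarrow> (complex \<Rightarrow> complex) \<Rightarrow> complex \<Rightarrow> bool"
  where "has_pairing \<omega> f g l \<longleftrightarrow>
    (\<forall>\<^sub>F r in at_left 1. integrable dA (\<lambda>z. f (of_real r * z) * cnj (g z) * of_real (\<omega> (norm z)))) \<and>
    ((\<lambda>r. LINT z|dA. f (of_real r * z) * cnj (g z) * of_real (\<omega> (norm z))) \<longlongrightarrow> l) (at_left 1)"

definition proj_bounded_Linf_bloch :: "(real \<Rightarrow> real) \<Rightarrow> bool"
  where "proj_bounded_Linf_bloch \<omega> \<longleftrightarrow>
    (\<exists>C. \<forall>f\<in>Linf. bergman_proj \<omega> f \<in> bloch \<and> bloch_norm (bergman_proj \<omega> f) \<le> C * Linf_norm f)"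

text \<open>\<open>dual_embeds \<omega> X NX Y NY\<close>: \<open>X\<^sup>\<star> \<subseteq> Y\<close> via the \<open>A\<^sup>2\<^sub>\<omega>\<close>-pairing, with norm control.\<close>

definition dual_embeds ::
    "(real \<Rightarrow> real) \<Rightarrow> (complex \<Rightarrow> complex) set \<Rightarrow> ((complex \<Rightarrow> complex) \<Rightarrow> real) \<Rightarrow>
      (complex \<Rightarrow> complex) set \<Rightarrow> ((complex \<Rightarrow> complex) \<Rightarrow> real) \<Rightarrow> bool"
  where "dual_embeds \<omega> X NX Y NY \<longleftrightarrow>
    (\<exists>C>0. \<forall>L\<in>dual_space X NX.
      (\<exists>!g. g \<in> Y \<and> (\<forall>f\<in>X. has_pairing \<omega> f g (L f))) \<and>
      (\<forall>g\<in>Y. (\<forall>f\<in>X. has_pairing \<omega> f g (L f)) \<longrightarrow> NY g \<le> C * dual_norm X NX L))"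

end

theory Submission
  imports Defs
begin

text \<open>Write \<open>\<mu> n\<close> for the moments and \<open>T\<close> for the tail of \<open>\<omega>\<close>. If the projection is bounded, its values on
  \<open>(z / |z|) ^ n\<close> give the moment doubling \<open>\<mu> (n + 1) \<le> A * \<mu> (2 n + 1)\<close>, and iterating this gives
  \<open>\<omega> \<in> D_hat\<close>. Conversely, \<open>\<omega> \<in> D_hat\<close> yields the kernel estimate: the \<open>A\<^sup>1\<close> norm of the derivative
  \<open>k\<^sub>a\<close> of the Bergman kernel in \<open>cnj a\<close> is at most a constant times \<open>1 / (1 - |a|)\<close>. To prove it, write
  \<open>k\<^sub>a(z) = z * (1 - w)\<^sup>-\<^sup>1 * (\<Sum>n. d\<^sub>n * w ^ n)\<close> with \<open>w = cnj a * z\<close>, where \<open>d\<^sub>n\<close> is at most a multiple of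
  \<open>1 / \<mu> (2 n + 3)\<close> by moment doubling, and use Cauchy-Schwarz with weight \<open>T(|a z|)\<close> and Parseval.

  The function \<open>g\<close> representing a functional \<open>L\<close> has the Taylor coefficients
  \<open>cnj (L (z ^ n)) / (2 * \<mu> (2 n + 1))\<close>, so \<open>cnj (deriv g a) = L k\<^sub>a\<close>, and the kernel estimate says that \<open>g\<close>
  is a Bloch function when \<open>L\<close> is bounded on \<open>A\<^sup>1\<close>. Taking for \<open>L\<close> the pairing with a bounded function
  \<open>\<phi>\<close> gives \<open>g = P \<phi>\<close>, so (ii) implies (i). If \<open>P\<close> is bounded and \<open>L\<close> is bounded on the little Bloch
  space, then \<open>\<integral> |g\<^sub>r| \<omega> dA = |L ((P \<phi>)\<^sub>r)|\<close> with \<open>\<phi> = sgn g\<^sub>r\<close> bounds \<open>g\<close> in \<open>A\<^sup>1\<close>, which is (iii). Finally the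
  functional \<open>f \<mapsto> (1 - |a|\<^sup>2) * deriv f a\<close> on the little Bloch space is represented by \<open>(1 - |a|\<^sup>2) * k\<^sub>a\<close>, so
  (iii) implies the kernel estimate.\<close>

text \<open>The weight in the Cauchy-Schwarz step is forced. With w = cnj a * z, the mean square
  over a circle is at most 1 / (1 - |w|) for the factor 1 / (1 - w), and of order 1 / ((1 - |w|)
  T(|w|)^2) for the series of the d_n. Without a weight the estimate already fails for T(s) = (1 -
  s)^b with b > 1. Dividing the first square by T and multiplying the second by it brings both to
  the size \<omega> / ((1 - |w|) T(|w|)), whose integral is controlled dyadic ring by dyadic ring.

  A functional is accessible only through its values on monomials, so L f has to be recovered as the
  limit of L on the dilations of f. Norm convergence of dilations holds in A^1 and in the little
  Bloch space, but not in the Bloch space.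

  The pairing with the constant 1 exists only if g is integrable against \<omega>. Hence (ii)
  requires membership of g in A^1 besides the Bloch bound; it comes from an A^2 estimate.\<close>

text \<open>The measure of the pairs \<open>(x, y)\<close> with \<open>y\<close> in the disc and \<open>c * x + y \<in> A\<close>, computed by
  Fubini in both orders, gives the rotation invariance without a change of variables theorem.\<close>

lemma distr_lborel_mult_unit:
  fixes c :: complex
  assumes c: "norm c = 1"
  shows "distr lborel borel ((*) c) = lborel"
proof (rule measure_eqI)
  fix A :: "complex set" assume "A \<in> sets (distr lborel borel ((*) c))"
  then have [measurable]: "A \<in> sets borel" by simp
  have c0: "c \<noteq> 0" using c by auto
  define B :: "complex set" where "B = ball 0 1"
  have [measurable]: "B \<in> sets borel" unfolding B_def by simp
  have inv: "emeasure lborel (ball z 1 :: complex set) = emeasure lborel B" for z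
    unfolding B_def by (simp add: emeasure_ball)
  have transl: "(\<integral>\<^sup>+x. f (a + x) \<partial>lborel) = (\<integral>\<^sup>+x. f x \<partial>lborel)"
    if [measurable]: "f \<in> borel_measurable borel" for f :: "complex \<Rightarrow> ennreal" and a
    by (subst (2) lborel_distr_plus[of a, symmetric]) (simp add: nn_integral_distr)
  let ?f = "\<lambda>x y. indicator B y * indicator A (c * x + y) :: ennreal"
  have "(\<integral>\<^sup>+y. (\<integral>\<^sup>+x. ?f x y \<partial>lborel) \<partial>lborel) =
      (\<integral>\<^sup>+y. indicator B y * (\<integral>\<^sup>+x. indicator A (c * (y / c + x)) \<partial>lborel) \<partial>lborel)"
    using c0 by (intro nn_integral_cong) (simp add: nn_integral_cmult algebra_simps)
  also have "\<dots> = (\<integral>\<^sup>+y. indicator B y * (\<integral>\<^sup>+x. indicator A (c * x) \<partial>lborel) \<partial>lborel)"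
    by (intro nn_integral_cong arg_cong2[where f = "(*)"] refl transl) simp
  also have "\<dots> = emeasure lborel B * emeasure (distr lborel borel ((*) c)) A"
    by (simp add: nn_integral_multc emeasure_distr nn_integral_distr flip: nn_integral_indicator)
  finally have 1: "(\<integral>\<^sup>+y. (\<integral>\<^sup>+x. ?f x y \<partial>lborel) \<partial>lborel) =
     emeasure lborel B * emeasure (distr lborel borel ((*) c)) A" .
  have "(\<integral>\<^sup>+x. (\<integral>\<^sup>+y. ?f x y \<partial>lborel) \<partial>lborel) =
      (\<integral>\<^sup>+x. (\<integral>\<^sup>+y. indicator B ((-c * x) + y) * indicator A y \<partial>lborel) \<partial>lborel)"
  proof (rule nn_integral_cong)
    fix x
    show "(\<integral>\<^sup>+y. ?f x y \<partial>lborel) = (\<integral>\<^sup>+y. indicator B ((-c * x) + y) * indicator A y \<partial>lborel)"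
      using transl[of "\<lambda>y. indicator B ((-c * x) + y) * indicator A y" "c * x"] by simp
  qed
  also have "\<dots> = (\<integral>\<^sup>+y. (\<integral>\<^sup>+x. indicator B ((-c * x) + y) * indicator A y \<partial>lborel) \<partial>lborel)"
    by (rule lborel_pair.Fubini') simp
  also have "\<dots> = (\<integral>\<^sup>+y. emeasure lborel B * indicator A y \<partial>lborel)"
  proof (rule nn_integral_cong)
    fix y
    \<comment> \<open>This is where \<open>norm c = 1\<close> enters: it makes the section in x a
      disc of radius 1 about \<open>y / c\<close>, whose measure does not depend on y.\<close>
    have eq: "indicator B ((-c * x) + y) = (indicator (ball (y / c) 1) x :: ennreal)" for x
    proof -
      have "norm (y / c - x) = norm (c * (y / c - x))" by (simp add: norm_mult c)
      also have "c * (y / c - x) = y - c * x" using c0 by (simp add: field_simps)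
      finally show ?thesis by (simp add: indicator_def B_def dist_norm norm_minus_commute)
    qed
    show "(\<integral>\<^sup>+x. indicator B ((-c * x) + y) * indicator A y \<partial>lborel) = emeasure lborel B * indicator A y"
      unfolding eq by (cases "y \<in> A") (simp_all add: inv)
  qed
  also have "\<dots> = emeasure lborel B * emeasure lborel A"
    by (simp add: nn_integral_cmult)
  finally have 2: "(\<integral>\<^sup>+x. (\<integral>\<^sup>+y. ?f x y \<partial>lborel) \<partial>lborel) = emeasure lborel B * emeasure lborel A" .
  have "(\<integral>\<^sup>+x. (\<integral>\<^sup>+y. ?f x y \<partial>lborel) \<partial>lborel) = (\<integral>\<^sup>+y. (\<integral>\<^sup>+x. ?f x y \<partial>lborel) \<partial>lborel)"
    by (rule lborel_pair.Fubini') simp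
  then have "emeasure lborel B * emeasure lborel A = emeasure lborel B * emeasure (distr lborel borel ((*) c)) A"
    using 1 2 by simp
  moreover have "emeasure lborel B = ennreal pi" unfolding B_def
    by (simp add: emeasure_ball unit_ball_vol_2)
  ultimately show "emeasure (distr lborel borel ((*) c)) A = emeasure lborel A"
    by (simp add: ennreal_mult_cancel_left)
qed simp

lemma
  fixes c :: complex
  assumes c: "norm c = 1"
  shows measurable_lebesgue_mult_unit: "(*) c \<in> lebesgue \<rightarrow>\<^sub>M lebesgue"
    and distr_lebesgue_mult_unit: "distr lebesgue lebesgue ((*) c) = lebesgue"
proof -
  have m: "(*) c \<in> lebesgue \<rightarrow>\<^sub>M lborel"
    by (rule measurable_completion) simp
  have eq: "distr lebesgue lborel ((*) c) = lborel"
    using distr_lborel_mult_unit[OF c] by (subst distr_completion) (simp_all cong: distr_cong)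
  show "(*) c \<in> lebesgue \<rightarrow>\<^sub>M lebesgue"
    by (rule completion.measurable_completion2[OF m]) (simp add: eq)
  show "distr lebesgue lebesgue ((*) c) = lebesgue"
    using completion.completion_distr_eq[OF m] eq by simp
qed

section \<open>The normalized area measure and its rotations\<close>

lemma space_dA [simp]: "space dA = \<bbbD>"
  by (simp add: dA_def space_restrict_space)

lemma sets_dA [simp, measurable_cong]: "sets dA = sets (lebesgue_on \<bbbD>)"
  by (simp add: dA_def)

lemma emeasure_dA:
  assumes "A \<in> sets lebesgue" "A \<subseteq> \<bbbD>"
  shows "emeasure dA A = ennreal (1 / pi) * emeasure lebesgue A"
proof -
  have "A \<in> sets (lebesgue_on \<bbbD>)"
    using assms by (auto simp: sets_restrict_space_iff)
  then show ?thesis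
    using assms by (simp add: dA_def emeasure_density_const emeasure_restrict_space)
qed

lemma sets_dA_iff: "A \<in> sets dA \<longleftrightarrow> A \<in> sets lebesgue \<and> A \<subseteq> \<bbbD>"
proof -
  have "\<bbbD> \<inter> space lebesgue \<in> sets (lebesgue :: complex measure)"
    by auto
  from sets_restrict_space_iff[OF this] show ?thesis unfolding sets_dA by blast
qed

lemma
  assumes c: "norm c = 1"
  shows measurable_dA_mult_unit: "(*) c \<in> dA \<rightarrow>\<^sub>M dA"
    and distr_dA_mult_unit: "distr dA dA ((*) c) = dA"
proof -
  have vim: "(*) c -` A \<inter> \<bbbD> = (*) c -` A \<inter> space lebesgue" if "A \<subseteq> \<bbbD>" for A
    using that c by (auto simp: norm_mult)
  show m: "(*) c \<in> dA \<rightarrow>\<^sub>M dA"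
  proof (rule measurableI)
    fix A assume "A \<in> sets dA"
    then have A: "A \<in> sets lebesgue" "A \<subseteq> \<bbbD>" unfolding sets_dA_iff by auto
    have "(*) c -` A \<inter> \<bbbD> \<in> sets lebesgue"
      unfolding vim[OF A(2)] using measurable_lebesgue_mult_unit[OF c] A(1) by (rule measurable_sets)
    then show "(*) c -` A \<inter> space dA \<in> sets dA"
      unfolding sets_dA_iff by auto
  qed (simp add: norm_mult c)
  show "distr dA dA ((*) c) = dA"
  proof (rule measure_eqI)
    fix A assume "A \<in> sets (distr dA dA ((*) c))"
    then have "A \<in> sets dA" by simp
    then have A: "A \<in> sets lebesgue" "A \<subseteq> \<bbbD>" "A \<in> sets dA" unfolding sets_dA_iff by auto
    have "(*) c -` A \<inter> \<bbbD> \<in> sets lebesgue"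
      unfolding vim[OF A(2)] using measurable_lebesgue_mult_unit[OF c] A(1) by (rule measurable_sets)
    then have "emeasure (distr dA dA ((*) c)) A = ennreal (1 / pi) * emeasure lebesgue ((*) c -` A \<inter> \<bbbD>)"
      using m A by (simp add: emeasure_distr emeasure_dA)
    also have "emeasure lebesgue ((*) c -` A \<inter> \<bbbD>) = emeasure (distr lebesgue lebesgue ((*) c)) A"
      unfolding vim[OF A(2)] using measurable_lebesgue_mult_unit[OF c] A(1) by (simp add: emeasure_distr)
    also have "\<dots> = emeasure lebesgue A"
      by (simp add: distr_lebesgue_mult_unit[OF c])
    finally show "emeasure (distr dA dA ((*) c)) A = emeasure dA A"
      using A by (simp add: emeasure_dA)
  qed simp
qed

lemma
  fixes F :: "complex \<Rightarrow> 'a::{banach, second_countable_topology}"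
  assumes "norm c = 1" "F \<in> borel_measurable dA"
  shows integral_dA_rotate: "(LINT z|dA. F (c * z)) = (LINT z|dA. F z)"
    and integrable_dA_rotate: "integrable dA (\<lambda>z. F (c * z)) \<longleftrightarrow> integrable dA F"
  using integral_distr[OF measurable_dA_mult_unit[OF assms(1)] assms(2)]
    integrable_distr_eq[OF measurable_dA_mult_unit[OF assms(1)] assms(2)]
  by (simp_all add: distr_dA_mult_unit[OF assms(1)])

text \<open>Rotation by the angle \<open>pi / (n - m)\<close> turns F into its negative, so the
  integral equals its own negative. This yields the orthogonality of monomials without an
  integration in the angle.\<close>

lemma integral_dA_eq_0_by_rotation:
  fixes F :: "complex \<Rightarrow> complex"
  assumes F: "F \<in> borel_measurable dA" and "n \<noteq> m"
    and rot: "\<And>c z. norm c = 1 \<Longrightarrow> z \<in> \<bbbD> \<Longrightarrow> F (c * z) = c ^ n * cnj c ^ m * F z"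
  shows "(LINT z|dA. F z) = 0"
proof -
  define t where "t = pi / (real n - real m)"
  have "cis t ^ n * cnj (cis t) ^ m = cis (real n * t - real m * t)"
    by (simp add: cis_cnj Complex.DeMoivre cis_mult)
  also have "real n * t - real m * t = (real n - real m) * t" by (simp add: algebra_simps)
  also have "\<dots> = pi" using \<open>n \<noteq> m\<close> by (simp add: t_def)
  finally have "cis t ^ n * cnj (cis t) ^ m = -1" by simp
  then have "(LINT z|dA. F (cis t * z)) = (LINT z|dA. - F z)"
    by (intro Bochner_Integration.integral_cong) (simp_all add: rot)
  then show ?thesis
    using integral_dA_rotate[OF norm_cis F, of t] by simp
qed

lemma borel_measurable_dA_lebesgue:
  assumes "f \<in> borel_measurable lebesgue" shows "f \<in> borel_measurable dA"
  using measurable_restrict_space1[OF assms, of \<bbbD>]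
  by (simp add: dA_def)

lemma borel_measurable_dA_borel:
  assumes "f \<in> borel_measurable borel" shows "f \<in> borel_measurable dA"
  by (intro borel_measurable_dA_lebesgue measurable_completion) (use assms in simp)

lemma borel_measurable_dA_continuous:
  fixes f :: "complex \<Rightarrow> 'a::{second_countable_topology, real_normed_vector}"
  assumes "continuous_on \<bbbD> f" shows "f \<in> borel_measurable dA"
  using continuous_imp_measurable_on_sets_lebesgue[OF assms] by (simp add: dA_def)

section \<open>Polar coordinates for radial functions\<close>

text \<open>The two measures agree on half-lines: on the left stands the area of an annulus, on the
  right an elementary integral. The radius R is free because null sets are pulled back to the whole
  plane, by exhaustion with discs.\<close>

lemma distr_norm_ball:
  assumes "R > 0"
  shows "distr (density lborel (indicator (ball 0 R :: complex set))) borel norm =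
    density lborel (\<lambda>s. ennreal (2 * pi * s) * indicator {0..<R} s)"
proof (rule measure_eqI_lessThan)
  fix x :: real
  have L: "emeasure (distr (density lborel (indicator (ball 0 R :: complex set))) borel norm) {x<..} =
      emeasure lborel (ball 0 R - cball 0 x :: complex set)"
  proof -
    have [measurable]: "ball 0 R \<in> sets (borel :: complex measure)" by simp
    have "norm -` {x<..} \<in> sets (borel :: complex measure)"
      using measurable_sets_borel[of "norm :: complex \<Rightarrow> real" borel "{x<..}"] by simp
    then have "emeasure (distr (density lborel (indicator (ball 0 R :: complex set))) borel norm) {x<..} =
      (\<integral>\<^sup>+z. indicator (ball 0 R) z * indicator (norm -` {x<..}) (z::complex) \<partial>lborel)"
      by (simp add: emeasure_distr emeasure_density)
    also have "\<dots> = (\<integral>\<^sup>+z. indicator (ball 0 R - cball 0 x) (z::complex) \<partial>lborel)"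
      by (intro nn_integral_cong) (auto simp: indicator_def)
    finally show ?thesis by simp
  qed
  have "emeasure lborel (ball 0 R - cball 0 x :: complex set) = ennreal (pi * (R\<^sup>2 - (if 0 \<le> x \<and> x < R then x\<^sup>2 else if x < R then 0 else R\<^sup>2)))"
  proof -
    consider "x < 0" | "0 \<le> x" "x < R" | "x \<ge> R" by linarith
    then show ?thesis
    proof cases
      case 1
      with assms show ?thesis by (simp add: emeasure_ball unit_ball_vol_2 mult.commute)
    next
      case 2
      then have "cball 0 x \<subseteq> (ball 0 R :: complex set)" by auto
      with 2 show ?thesis
        by (subst emeasure_Diff) (auto simp: emeasure_ball emeasure_cball unit_ball_vol_2 ennreal_minus algebra_simps)
    next
      case 3
      then have "ball 0 R - cball 0 x = ({} :: complex set)" by auto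
      with 3 assms show ?thesis unfolding \<open>ball 0 R - cball 0 x = {}\<close> by simp
    qed
  qed
  note L2 = L[unfolded this]
  then show "emeasure (distr (density lborel (indicator (ball 0 R :: complex set))) borel norm) {x<..} < \<infinity>"
    by simp
  \<comment> \<open>The lower limit \<open>max 0 (min x R)\<close> treats x < 0, 0 \<le> x < R and x
    \<ge> R at once; the closed interval differs from the given one at most by the points x and
    R.\<close>
  have "emeasure (density lborel (\<lambda>s. ennreal (2 * pi * s) * indicator {0..<R} s)) {x<..} =
    (\<integral>\<^sup>+s. ennreal (2 * pi * s) * indicator {max 0 (min x R)..R} s \<partial>lborel)"
    unfolding emeasure_density[OF borel_measurable_times_ennreal[OF _ borel_measurable_indicator]]
    apply (subst emeasure_density, simp, simp)
    apply (rule nn_integral_cong_AE)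
    using AE_lborel_singleton[of x] AE_lborel_singleton[of R]
    apply eventually_elim
    apply (auto simp: indicator_def max_def min_def)
    done
  also have "\<dots> = ennreal (pi * R\<^sup>2 - pi * (max 0 (min x R))\<^sup>2)"
    using assms by (intro nn_integral_FTC_Icc) (auto intro!: derivative_eq_intros mult_nonneg_nonneg simp: max_def min_def split: if_splits)
  also have "pi * R\<^sup>2 - pi * (max 0 (min x R))\<^sup>2 = pi * (R\<^sup>2 - (if 0 \<le> x \<and> x < R then x\<^sup>2 else if x < R then 0 else R\<^sup>2))"
    using assms by (auto simp: max_def min_def algebra_simps)
  finally show "emeasure (distr (density lborel (indicator (ball 0 R :: complex set))) borel norm) {x<..} =
     emeasure (density lborel (\<lambda>s. ennreal (2 * pi * s) * indicator {0..<R} s)) {x<..}"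
    using L2 by simp
qed simp_all

text \<open>On each disc of integer radius the law of \<open>norm\<close> has a density, so
  preimages of null sets are null. Hence \<open>norm\<close> is measurable between the completed
  measures, which is what composing a merely Lebesgue measurable profile with it requires.\<close>

lemma null_sets_lborel_norm:
  "null_sets lborel \<subseteq> null_sets (distr lebesgue lborel (norm :: complex \<Rightarrow> real))"
proof
  fix N :: "real set" assume N: "N \<in> null_sets lborel"
  then have [measurable]: "N \<in> sets borel" by auto
  have N0: "AE s in lborel. s \<notin> N" using N by (rule AE_not_in)
  have "AE z in lborel. norm (z::complex) \<notin> N"
  proof -
    have "AE z in lborel. norm (z::complex) < real (Suc k) \<longrightarrow> norm z \<notin> N" for k
    proof -
      have [measurable]: "ball 0 (real (Suc k)) \<in> sets (borel :: complex measure)" by (rule borel_open) simp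
      have "AE s in density lborel (\<lambda>s. ennreal (2 * pi * s) * indicator {0..<real (Suc k)} s). s \<notin> N"
        using N0 by (subst AE_density) auto
      then have "AE s in distr (density lborel (indicator (ball 0 (real (Suc k)) :: complex set))) borel norm. s \<notin> N"
        by (subst distr_norm_ball) auto
      then have "AE z in density lborel (indicator (ball 0 (real (Suc k)) :: complex set)). norm z \<notin> N"
        by (subst (asm) AE_distr_iff) auto
      then show ?thesis
        by (subst (asm) AE_density) (auto simp: indicator_def simp del: of_nat_Suc)
    qed
    then have "AE z in lborel. \<forall>k. norm (z::complex) < real (Suc k) \<longrightarrow> norm z \<notin> N"
      by (simp only: AE_all_countable) blast
    then show ?thesis
    proof eventually_elim
      case (elim z)
      then show ?case by (meson reals_Archimedean2 less_trans of_nat_less_iff lessI)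
    qed
  qed
  then have "AE z in lebesgue. norm (z::complex) \<notin> N" by (rule AE_completion)
  then have "AE s in distr lebesgue lborel (norm :: complex \<Rightarrow> real). s \<notin> N"
    by (subst AE_distr_iff) (auto intro: measurable_completion)
  then show "N \<in> null_sets (distr lebesgue lborel (norm :: complex \<Rightarrow> real))"
    using N by (subst AE_iff_null_sets) auto
qed

lemma measurable_lebesgue_norm: "(norm :: complex \<Rightarrow> real) \<in> lebesgue \<rightarrow>\<^sub>M lebesgue"
  by (rule completion.measurable_completion2[OF measurable_completion null_sets_lborel_norm]) simp

lemma AE_dA_iff: "(AE z in dA. P z) \<longleftrightarrow> (AE z in lebesgue. z \<in> \<bbbD> \<longrightarrow> P z)"
  unfolding dA_def by (subst AE_density, simp, subst AE_restrict_space_iff) auto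

lemma AE_dA_norm:
  assumes "AE s in lebesgue. P s" shows "AE z in dA. P (norm z)"
proof -
  have "AE s in lborel. P s" using assms by (simp add: AE_completion_iff)
  then obtain N where N: "N \<in> null_sets lborel" "{s. \<not> P s} \<subseteq> N"
    by (auto simp: eventually_ae_filter)
  have "N \<in> null_sets (distr lebesgue lborel (norm :: complex \<Rightarrow> real))"
    using null_sets_lborel_norm N(1) by auto
  then have "AE s in distr lebesgue lborel (norm :: complex \<Rightarrow> real). s \<notin> N"
    by (rule AE_not_in)
  then have "AE z in lebesgue. norm (z::complex) \<notin> N"
    using N(1) by (subst (asm) AE_distr_iff) (auto intro: measurable_completion)
  then show ?thesis unfolding AE_dA_iff
    by eventually_elim (use N(2) in auto)
qed

lemma
  fixes h :: "complex \<Rightarrow> real"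
  assumes [measurable]: "h \<in> borel_measurable borel"
  shows integral_dA_borel: "(LINT z|dA. h z) = (1 / pi) * (LINT z|density lborel (indicator \<bbbD>). h z)"
    and integrable_dA_borel: "integrable dA h \<longleftrightarrow> integrable (density lborel (indicator \<bbbD>)) h"
proof -
  have [measurable]: "\<bbbD> \<in> sets borel" by simp
  have *: "density lborel (indicator \<bbbD>) = density lborel (\<lambda>z. ennreal (indicator \<bbbD> (z::complex)))"
    by (simp add: ennreal_indicator)
  have m: "h \<in> borel_measurable (lebesgue_on \<bbbD>)"
    by (rule measurable_restrict_space1) (auto intro: measurable_completion)
  have "(LINT z|dA. h z) = (1 / pi) * (LINT z|lebesgue_on \<bbbD>. h z)"
    unfolding dA_def using m by (subst integral_density) auto
  also have "(LINT z|lebesgue_on \<bbbD>. h z) = (LINT z|lebesgue. indicator \<bbbD> z * h z)"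
    by (subst integral_restrict_space) (auto simp: mult.commute)
  also have "\<dots> = (LINT z|lborel. indicator \<bbbD> z * h z)"
    by (rule integral_completion) simp
  also have "\<dots> = (LINT z|density lborel (indicator \<bbbD>). h z)"
    unfolding * by (subst integral_density) auto
  finally show "(LINT z|dA. h z) = (1 / pi) * (LINT z|density lborel (indicator \<bbbD>). h z)" .
  have "integrable dA h \<longleftrightarrow> integrable (lebesgue_on \<bbbD>) h"
    unfolding dA_def using m
    by (subst integrable_density, simp, simp, simp, simp only: real_scaleR_def integrable_mult_left_iff) simp
  also have "\<dots> \<longleftrightarrow> integrable lebesgue (\<lambda>z. indicator \<bbbD> z * h z)"
    by (subst integrable_restrict_space) (auto simp: mult.commute)
  also have "\<dots> \<longleftrightarrow> integrable lborel (\<lambda>z. indicator \<bbbD> z * h z)"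
    by (rule integrable_completion) simp
  also have "\<dots> \<longleftrightarrow> integrable (density lborel (indicator \<bbbD>)) h"
    unfolding * by (subst integrable_density) auto
  finally show "integrable dA h \<longleftrightarrow> integrable (density lborel (indicator \<bbbD>)) h" .
qed

text \<open>Since \<open>g\<close> is only Lebesgue measurable, and arbitrary off
  \<open>[0,1)\<close>, it is cut off and replaced by a Borel function that agrees with it almost
  everywhere; the image measure of \<open>norm\<close> applies to the latter. The factor
  \<open>2 * s\<close> is the density \<open>2 * pi * s\<close> divided by the pi of
  \<open>dA\<close>.\<close>

lemma
  fixes g :: "real \<Rightarrow> real"
  assumes g: "set_integrable lebesgue {0..<1} g"
  shows integrable_dA_radial: "integrable dA (\<lambda>z. g (norm z))"
    and integral_dA_radial: "(LINT z|dA. g (norm z)) = (LINT s:{0..<1}|lebesgue. 2 * s * g s)"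
proof -
  let ?g1 = "\<lambda>s. indicator {0..<1} s * g s"
  have gi: "integrable lebesgue ?g1" using g by (simp add: set_integrable_def)
  then have "?g1 \<in> borel_measurable lebesgue" by simp
  from completion_ex_borel_measurable_real[OF this] obtain g'
    where g'[measurable]: "g' \<in> borel_measurable borel" and ae: "AE s in lborel. ?g1 s = g' s" by auto
  have ae': "AE s in lebesgue. ?g1 s = g' s" using ae by (rule AE_completion)
  have aeD: "AE z in dA. g (norm z) = g' (norm z)"
    using AE_dA_norm[OF ae'] AE_space[of dA] by eventually_elim auto
  have "AE z in lebesgue. z \<in> \<bbbD> \<longrightarrow> g (norm z) = g' (norm z)"
    using aeD unfolding AE_dA_iff .
  have gm: "(\<lambda>z. g (norm z)) \<in> borel_measurable dA"
  proof -
    have "(\<lambda>z::complex. ?g1 (norm z)) \<in> borel_measurable lebesgue"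
      using measurable_compose[OF measurable_lebesgue_norm \<open>?g1 \<in> borel_measurable lebesgue\<close>] .
    then have "(\<lambda>z::complex. ?g1 (norm z)) \<in> borel_measurable dA"
      by (rule borel_measurable_dA_lebesgue)
    then show ?thesis by (rule measurable_cong[THEN iffD1, rotated]) simp
  qed
  have g'm: "(\<lambda>z::complex. g' (norm z)) \<in> borel_measurable dA"
    by (rule borel_measurable_dA_borel) simp
  have d: "distr (density lborel (indicator \<bbbD> :: complex \<Rightarrow> ennreal)) borel norm =
     density lborel (\<lambda>s. ennreal (2 * pi * s * indicator {0..<1} s))"
    by (subst distr_norm_ball) (auto intro!: arg_cong2[where f = density] simp: indicator_def)
  have eq: "integrable (density lborel (indicator \<bbbD> :: complex \<Rightarrow> ennreal)) (\<lambda>z. g' (norm z)) \<longleftrightarrow>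
     integrable lborel (\<lambda>s. (2 * pi * s * indicator {0..<1} s) * g' s)"
    apply (subst integrable_distr_eq[where N = borel and g = norm and f = g', symmetric], simp, simp)
    apply (unfold d)
    apply (subst integrable_density, simp, simp)
    apply (auto simp: indicator_def)
    done
  have "integrable lborel (\<lambda>s. (2 * pi * s * indicator {0..<1} s) * g' s)"
  proof (rule Bochner_Integration.integrable_bound)
    have "integrable lborel g'"
      using integrable_cong_AE[of ?g1 lebesgue g'] gi ae' integrable_completion[of g' lborel]
      by (simp add: measurable_completion)
    then show "integrable lborel (\<lambda>s. 2 * pi * g' s)" by simp
    show "AE s in lborel. norm (2 * pi * s * indicator {0..<1} s * g' s) \<le> norm (2 * pi * g' s)"
      by (auto simp: indicator_def abs_mult mult_left_le_one_le)
  qed simp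
  then have int': "integrable dA (\<lambda>z. g' (norm z))"
    by (subst integrable_dA_borel) (simp_all add: eq)
  then show "integrable dA (\<lambda>z. g (norm z))"
    using integrable_cong_AE[OF gm g'm aeD] by simp
  have "(LINT z|dA. g (norm z)) = (LINT z|dA. g' (norm z))"
    using integral_cong_AE[OF gm g'm aeD] .
  also have "\<dots> = (1 / pi) * (LINT z|density lborel (indicator \<bbbD>). g' (norm z))"
    by (rule integral_dA_borel) simp
  also have "(LINT z|density lborel (indicator \<bbbD>). g' (norm (z::complex))) =
     (LINT s|density lborel (\<lambda>s. ennreal (2 * pi * s * indicator {0..<1} s)). g' s)"
    unfolding d[symmetric] by (subst integral_distr) auto
  also have "\<dots> = (LINT s|lborel. (2 * pi * s * indicator {0..<1} s) * g' s)"
    by (subst integral_density) (auto simp: indicator_def)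
  also have "\<dots> = (LINT s|lebesgue. (2 * pi * s * indicator {0..<1} s) * g' s)"
    by (rule integral_completion[symmetric]) simp
  also have "\<dots> = (LINT s|lebesgue. pi * (indicator {0..<1} s * (2 * s * g s)))"
  proof (rule integral_cong_AE)
    show "(\<lambda>s. 2 * pi * s * indicator {0..<1} s * g' s) \<in> borel_measurable lebesgue"
      by (rule measurable_completion) simp
    have "(\<lambda>s. pi * (2 * s * ?g1 s)) \<in> borel_measurable lebesgue"
      by (intro borel_measurable_times \<open>?g1 \<in> borel_measurable lebesgue\<close>) (auto intro: measurable_completion)
    then show "(\<lambda>s. pi * (indicator {0..<1} s * (2 * s * g s))) \<in> borel_measurable lebesgue"
      by (simp add: mult_ac)
    show "AE s in lebesgue. 2 * pi * s * indicator {0..<1} s * g' s = pi * (indicator {0..<1} s * (2 * s * g s))"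
      using ae' proof eventually_elim
      case (elim s)
      then show ?case by (cases "s \<in> {0..<1}") (auto simp: indicator_def)
    qed
  qed
  finally show "(LINT z|dA. g (norm z)) = (LINT s:{0..<1}|lebesgue. 2 * s * g s)"
    by (subst (asm) integral_mult_right_zero) (simp add: set_lebesgue_integral_def)
qed

subsection \<open>Power series on the disc\<close>

text \<open>Zero off the disc, like the members of \<open>hol_disc\<close>, so that a function in
  \<open>hol_disc\<close> and its power series are equal as total functions.\<close>

definition pser :: "(nat \<Rightarrow> complex) \<Rightarrow> complex \<Rightarrow> complex"
  where "pser \<alpha> z = (if z \<in> \<bbbD> then \<Sum>n. \<alpha> n * z ^ n else 0)"

text \<open>Radius of convergence at least 1.\<close>

definition disc_conv :: "(nat \<Rightarrow> complex) \<Rightarrow> bool"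
  where "disc_conv \<alpha> \<longleftrightarrow> (\<forall>r. 0 \<le> r \<and> r < 1 \<longrightarrow> summable (\<lambda>n. norm (\<alpha> n) * r ^ n))"

text \<open>Coefficients for which the series and its derivative converge absolutely on the closed disc;
  both norms of such a function are bounded by the sum.\<close>

definition fast :: "(nat \<Rightarrow> complex) \<Rightarrow> bool"
  where "fast \<alpha> \<longleftrightarrow> summable (\<lambda>n. real (Suc n) * norm (\<alpha> n))"

text \<open>The dilation that enters the pairing, cut off so that it stays in
  \<open>hol_disc\<close>.\<close>

definition dil :: "real \<Rightarrow> (complex \<Rightarrow> complex) \<Rightarrow> complex \<Rightarrow> complex"
  where "dil r f z = (if z \<in> \<bbbD> then f (of_real r * z) else 0)"

definition zpow :: "nat \<Rightarrow> complex \<Rightarrow> complex"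
  where "zpow n z = (if z \<in> \<bbbD> then z ^ n else 0)"

lemma disc_convD: "disc_conv \<alpha> \<Longrightarrow> 0 \<le> r \<Longrightarrow> r < 1 \<Longrightarrow> summable (\<lambda>n. norm (\<alpha> n) * r ^ n)"
  by (simp add: disc_conv_def)

lemma disc_conv_summable_norm:
  "disc_conv \<alpha> \<Longrightarrow> norm z < 1 \<Longrightarrow> summable (\<lambda>n. norm (\<alpha> n * z ^ n))"
  unfolding norm_mult norm_power by (rule disc_convD) auto

lemma disc_conv_summable: "disc_conv \<alpha> \<Longrightarrow> norm z < 1 \<Longrightarrow> summable (\<lambda>n. \<alpha> n * z ^ n)"
  by (rule summable_norm_cancel[OF disc_conv_summable_norm])

lemma pser_sums: "disc_conv \<alpha> \<Longrightarrow> norm z < 1 \<Longrightarrow> (\<lambda>n. \<alpha> n * z ^ n) sums pser \<alpha> z"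
  by (simp add: pser_def disc_conv_summable summable_sums)

lemma disc_convI:
  assumes "\<And>z. norm z < 1 \<Longrightarrow> summable (\<lambda>n. \<alpha> n * z ^ n)" shows "disc_conv \<alpha>"
  unfolding disc_conv_def
proof (intro allI impI)
  fix r :: real assume r: "0 \<le> r \<and> r < 1"
  have "summable (\<lambda>n. norm (\<alpha> n * complex_of_real r ^ n))"
  proof (rule powser_insidea)
    show "summable (\<lambda>n. \<alpha> n * complex_of_real ((1 + r) / 2) ^ n)"
      using r by (intro assms) (simp only: norm_of_real; simp)
    show "norm (complex_of_real r) < norm (complex_of_real ((1 + r) / 2))"
      using r by (simp only: norm_of_real; simp)
  qed
  then show "summable (\<lambda>n. norm (\<alpha> n) * r ^ n)" using r by (simp add: norm_mult norm_power)
qed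

lemma disc_conv_bound:
  assumes "disc_conv \<alpha>" "\<And>n. norm (\<beta> n) \<le> K * norm (\<alpha> n)" shows "disc_conv \<beta>"
  unfolding disc_conv_def
proof (intro allI impI)
  fix r :: real assume r: "0 \<le> r \<and> r < 1"
  have "summable (\<lambda>n. K * (norm (\<alpha> n) * r ^ n))"
    using disc_convD[OF assms(1)] r by (intro summable_mult) auto
  then show "summable (\<lambda>n. norm (\<beta> n) * r ^ n)"
  proof (rule summable_comparison_test'[where N = 0])
    fix n
    show "norm (norm (\<beta> n) * r ^ n) \<le> K * (norm (\<alpha> n) * r ^ n)"
      using r mult_right_mono[OF assms(2)[of n], of "r ^ n"] by (simp add: mult_ac)
  qed
qed

text \<open>The left side is n + 1 copies of the smallest of the first n + 1 terms of the geometric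
  series.\<close>

lemma Suc_mult_power_le:
  fixes q :: real assumes "0 \<le> q" "q < 1" shows "real (Suc n) * q ^ n \<le> 1 / (1 - q)"
proof -
  have "real (Suc n) * q ^ n = (\<Sum>k\<in>{..n}. q ^ n)" by simp
  also have "\<dots> \<le> (\<Sum>k\<in>{..n}. q ^ k)"
    using assms by (intro sum_mono power_decreasing) auto
  also have "\<dots> \<le> (\<Sum>k. q ^ k)"
    using assms by (intro sum_le_suminf summable_geometric) auto
  finally show ?thesis using assms by (simp add: suminf_geometric)
qed

lemma disc_conv_mult_Suc:
  assumes "disc_conv \<alpha>" shows "disc_conv (\<lambda>n. of_nat (Suc n) * \<alpha> n)"
  unfolding disc_conv_def
proof (intro allI impI)
  fix r :: real assume r: "0 \<le> r \<and> r < 1"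
  define s where "s = (1 + r) / 2"
  have s: "0 < s" "s < 1" "r < s" using r by (auto simp: s_def)
  have q: "0 \<le> r / s" "r / s < 1" using r s by auto
  have "summable (\<lambda>n. 1 / (1 - r / s) * (norm (\<alpha> n) * s ^ n))"
    using disc_convD[OF assms] s by (intro summable_mult) auto
  then show "summable (\<lambda>n. norm (of_nat (Suc n) * \<alpha> n) * r ^ n)"
  proof (rule summable_comparison_test'[where N = 0])
    fix n
    have "norm (of_nat (Suc n) * \<alpha> n) * r ^ n = (real (Suc n) * (r / s) ^ n) * (norm (\<alpha> n) * s ^ n)"
      using s by (simp add: norm_mult power_divide del: of_nat_Suc)
    also have "\<dots> \<le> 1 / (1 - r / s) * (norm (\<alpha> n) * s ^ n)"
      using Suc_mult_power_le[OF q, of n] s by (intro mult_right_mono) auto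
    finally show "norm (norm (of_nat (Suc n) * \<alpha> n) * r ^ n) \<le> 1 / (1 - r / s) * (norm (\<alpha> n) * s ^ n)"
      using r by (simp add: norm_mult)
  qed
qed

lemma disc_conv_Suc:
  assumes "disc_conv \<alpha>" shows "disc_conv (\<lambda>n. \<alpha> (Suc n))"
proof (rule disc_convI)
  fix z :: complex assume z: "norm z < 1"
  show "summable (\<lambda>n. \<alpha> (Suc n) * z ^ n)"
  proof (cases "z = 0")
    case True
    then show ?thesis using summable_finite[of "{0}" "\<lambda>n. \<alpha> (Suc n) * z ^ n"] by (auto simp: power_0_left)
  next
    case False
    have "summable (\<lambda>n. \<alpha> (Suc n) * z ^ Suc n)"
      using disc_conv_summable[OF assms z] by (subst summable_Suc_iff[of "\<lambda>n. \<alpha> n * z ^ n"])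
    then have "summable (\<lambda>n. (\<alpha> (Suc n) * z ^ Suc n) / z)" by (rule summable_divide)
    then show ?thesis using False by simp
  qed
qed

lemma pser_in_hol_disc: assumes "disc_conv \<alpha>" shows "pser \<alpha> \<in> hol_disc"
proof -
  have "pser \<alpha> holomorphic_on ball 0 1"
    by (rule power_series_holomorphic[of 0 1 \<alpha>]) (use pser_sums[OF assms] in auto)
  then show ?thesis by (auto simp: hol_disc_def pser_def)
qed

lemma has_field_derivative_pser:
  assumes \<alpha>: "disc_conv \<alpha>" and z: "norm z < 1"
  shows "(pser \<alpha> has_field_derivative pser (\<lambda>n. of_nat (Suc n) * \<alpha> (Suc n)) z) (at z)"
proof -
  have "((\<lambda>z. \<Sum>n. \<alpha> n * z ^ n) has_field_derivative (\<Sum>n. diffs \<alpha> n * z ^ n)) (at z)"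
    by (rule termdiffs_strong'[of 1]) (use disc_conv_summable[OF \<alpha>] z in auto)
  also have "(\<Sum>n. diffs \<alpha> n * z ^ n) = pser (\<lambda>n. of_nat (Suc n) * \<alpha> (Suc n)) z"
    using z by (simp add: pser_def diffs_def)
  finally show ?thesis
    by (rule has_field_derivative_transform_within_open[where S = \<bbbD>]) (use z in \<open>auto simp: pser_def\<close>)
qed

lemma deriv_pser:
  assumes "disc_conv \<alpha>" "norm z < 1"
  shows "deriv (pser \<alpha>) z = pser (\<lambda>n. of_nat (Suc n) * \<alpha> (Suc n)) z"
  using has_field_derivative_pser[OF assms] by (rule DERIV_imp_deriv)

lemma disc_conv_deriv: "disc_conv \<alpha> \<Longrightarrow> disc_conv (\<lambda>n. of_nat (Suc n) * \<alpha> (Suc n))"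
  by (rule disc_conv_mult_Suc[OF disc_conv_Suc])

lemma hol_disc_imp_pser:
  assumes "f \<in> hol_disc" obtains \<alpha> where "disc_conv \<alpha>" "f = pser \<alpha>"
proof -
  define \<alpha> where "\<alpha> n = (deriv ^^ n) f 0 / fact n" for n
  have s: "(\<lambda>n. \<alpha> n * z ^ n) sums f z" if "norm z < 1" for z
    using holomorphic_power_series[of f 0 1 z] assms that by (simp add: hol_disc_def \<alpha>_def)
  then have "disc_conv \<alpha>" by (intro disc_convI) (auto simp: sums_iff)
  moreover have "f = pser \<alpha>"
    using s assms by (auto simp: pser_def fun_eq_iff sums_iff hol_disc_def)
  ultimately show ?thesis using that by blast
qed

lemma norm_of_real_mult_less: "0 \<le> r \<Longrightarrow> r \<le> 1 \<Longrightarrow> norm z < 1 \<Longrightarrow> norm (complex_of_real r * z) < 1"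
  by (simp add: norm_mult) (meson le_less_trans mult_left_le_one_le norm_ge_zero)

lemma dil_pser:
  assumes "0 \<le> r" "r \<le> 1" shows "dil r (pser \<alpha>) = pser (\<lambda>n. \<alpha> n * of_real r ^ n)"
  using norm_of_real_mult_less[OF assms]
  by (auto simp: dil_def pser_def fun_eq_iff power_mult_distrib mult_ac)

lemma fast_imp_summable: assumes "fast \<alpha>" shows "summable (\<lambda>n. norm (\<alpha> n))"
  using assms unfolding fast_def
  by (rule summable_comparison_test'[where N = 0]) (auto simp: mult_le_cancel_right1)

lemma fast_imp_disc_conv: assumes "fast \<alpha>" shows "disc_conv \<alpha>"
  unfolding disc_conv_def
proof (intro allI impI)
  fix r :: real assume r: "0 \<le> r \<and> r < 1"
  show "summable (\<lambda>n. norm (\<alpha> n) * r ^ n)"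
    using fast_imp_summable[OF assms]
    by (rule summable_comparison_test'[where N = 0]) (use r in \<open>auto simp: mult_left_le power_le_one\<close>)
qed

lemma disc_conv_fast: assumes "disc_conv \<alpha>" "0 \<le> r" "r < 1" shows "fast (\<lambda>n. \<alpha> n * of_real r ^ n)"
  using disc_convD[OF disc_conv_mult_Suc[OF assms(1)] assms(2,3)] assms(2)
  by (simp add: fast_def norm_mult norm_power mult_ac del: of_nat_Suc)

lemma disc_conv_dil: assumes "disc_conv \<alpha>" "0 \<le> r" "r \<le> 1" shows "disc_conv (\<lambda>n. \<alpha> n * of_real r ^ n)"
  using assms(2,3)
  by (intro disc_conv_bound[OF assms(1), where K = 1]) (simp add: norm_mult norm_power mult_left_le power_le_one)

lemma fast_finite: "fast (\<lambda>n. if n < N then \<alpha> n else 0)"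
  unfolding fast_def by (rule summable_finite[of "{..<N}"]) auto

lemma pser_finite: "pser (\<lambda>n. if n < N then \<alpha> n else 0) z = (\<Sum>n<N. \<alpha> n * zpow n z)"
proof (cases "z \<in> \<bbbD>")
  case True
  then show ?thesis unfolding pser_def zpow_def
    by (subst suminf_finite[of "{..<N}"]) auto
qed (simp add: pser_def zpow_def)

lemma zpow_eq_pser: "zpow n = pser (\<lambda>k. if k = n then 1 else 0)"
proof
  fix z :: complex
  have "(\<Sum>k. (if k = n then 1 else 0) * z ^ k) = (\<Sum>k\<in>{n}. (if k = n then 1 else 0) * z ^ k)"
    by (rule suminf_finite) auto
  then show "zpow n z = pser (\<lambda>k. if k = n then 1 else 0) z" by (simp add: pser_def zpow_def)
qed

lemma fast_single: "fast (\<lambda>k. if k = n then c else 0)"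
  unfolding fast_def by (rule summable_finite[of "{n}"]) auto

lemma norm_pser_le:
  assumes "summable (\<lambda>n. norm (\<alpha> n))" shows "norm (pser \<alpha> z) \<le> (\<Sum>n. norm (\<alpha> n))"
proof (cases "z \<in> \<bbbD>")
  case True
  have le: "norm (\<alpha> n * z ^ n) \<le> norm (\<alpha> n)" for n
    using True by (simp add: norm_mult norm_power mult_left_le power_le_one)
  have s: "summable (\<lambda>n. norm (\<alpha> n * z ^ n))"
    using assms by (rule summable_comparison_test'[where N = 0]) (use le in auto)
  have "norm (pser \<alpha> z) \<le> (\<Sum>n. norm (\<alpha> n * z ^ n))"
    using True by (simp add: pser_def summable_norm[OF s])
  also have "\<dots> \<le> (\<Sum>n. norm (\<alpha> n))" by (intro suminf_le le s assms)
  finally show ?thesis .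
qed (simp add: pser_def suminf_nonneg assms)

lemma norm_deriv_pser_le:
  assumes "fast \<alpha>" "norm z < 1"
  shows "norm (deriv (pser \<alpha>) z) \<le> (\<Sum>n. real (Suc n) * norm (\<alpha> n))"
proof -
  have s0: "summable (\<lambda>n. real (Suc n) * norm (\<alpha> n))" using assms(1) by (simp add: fast_def)
  have s1: "summable (\<lambda>n. real (Suc (Suc n)) * norm (\<alpha> (Suc n)))"
    using s0 by (subst summable_Suc_iff[of "\<lambda>n. real (Suc n) * norm (\<alpha> n)"])
  have le: "norm (of_nat (Suc n) * \<alpha> (Suc n)) \<le> real (Suc (Suc n)) * norm (\<alpha> (Suc n))" for n
    by (simp add: norm_mult mult_right_mono del: of_nat_Suc)
  have s2: "summable (\<lambda>n. norm (of_nat (Suc n) * \<alpha> (Suc n)))"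
    using s1 by (rule summable_comparison_test'[where N = 0]) (use le in auto)
  have "norm (deriv (pser \<alpha>) z) \<le> (\<Sum>n. norm (of_nat (Suc n) * \<alpha> (Suc n)))"
    using norm_pser_le[OF s2, of z] deriv_pser[OF fast_imp_disc_conv[OF assms(1)] assms(2)] by simp
  also have "\<dots> \<le> (\<Sum>n. real (Suc (Suc n)) * norm (\<alpha> (Suc n)))"
    by (intro suminf_le le s1 s2)
  also have "\<dots> \<le> (\<Sum>n. real (Suc n) * norm (\<alpha> n))"
    using suminf_split_initial_segment[OF s0, of 1] by simp
  finally show ?thesis .
qed

subsection \<open>Integrals of power series over the disc\<close>

lemma integrable_dA_bounded_mult:
  fixes h v :: "complex \<Rightarrow> 'a::{real_normed_div_algebra, banach, second_countable_topology}"
  assumes "integrable dA v" "h \<in> borel_measurable dA" "\<And>z. z \<in> \<bbbD> \<Longrightarrow> norm (h z) \<le> B"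
  shows "integrable dA (\<lambda>z. h z * v z)"
proof (rule Bochner_Integration.integrable_bound)
  show "integrable dA (\<lambda>z. B * norm (v z))" using assms(1) by simp
  show "(\<lambda>z. h z * v z) \<in> borel_measurable dA" using assms by (intro borel_measurable_times) auto
  show "AE z in dA. norm (h z * v z) \<le> norm (B * norm (v z))"
  proof (rule AE_I2)
    fix z assume "z \<in> space dA"
    then have "norm (h z) \<le> B" using assms(3) by simp
    then have "norm (h z) \<le> \<bar>B\<bar>" by linarith
    then show "norm (h z * v z) \<le> norm (B * norm (v z))"
      by (simp add: norm_mult abs_mult mult_right_mono)
  qed
qed

lemma power_measurable_dA: "(\<lambda>z::complex. z ^ n) \<in> borel_measurable dA"
  by (rule borel_measurable_dA_borel) simp

text \<open>The series need only converge absolutely at radius \<rho>, because v vanishes beyond it.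
  The case \<rho> < 1 serves the cutoff in \<open>dilation_contractive_aux\<close>, where the
  coefficients may be of any \<open>disc_conv\<close> sequence; the case \<rho> = 1 is
  \<open>integral_pser\<close>.\<close>

lemma integral_power_series:
  fixes v :: "complex \<Rightarrow> complex"
  assumes v: "integrable dA v" and \<rho>: "0 < \<rho>" "\<rho> \<le> 1"
    and supp: "\<And>z. z \<in> \<bbbD> \<Longrightarrow> \<rho> \<le> norm z \<Longrightarrow> v z = 0"
    and b: "summable (\<lambda>n. norm (b n) * \<rho> ^ n)"
  shows "(\<lambda>n. b n * (LINT z|dA. z ^ n * v z)) sums (LINT z|dA. (\<Sum>n. b n * z ^ n) * v z)"
    and "integrable dA (\<lambda>z. (\<Sum>n. b n * z ^ n) * v z)"
proof -
  have int: "integrable dA (\<lambda>z. z ^ n * v z)" for n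
    by (rule integrable_dA_bounded_mult[OF v power_measurable_dA, of _ 1]) (simp add: norm_power power_le_one)
  have le: "norm (b n * z ^ n * v z) \<le> norm (b n) * \<rho> ^ n * norm (v z)" if "z \<in> \<bbbD>" for n z
  proof (cases "\<rho> \<le> norm z")
    case False
    then show ?thesis by (auto simp: norm_mult norm_power intro!: mult_right_mono mult_left_mono power_mono)
  next
    case True
    then show ?thesis using \<rho> by (simp add: supp[OF that True])
  qed
  let ?f = "\<lambda>n z. b n * z ^ n * v z"
  have fi: "integrable dA (?f n)" for n using int[of n] by (simp add: mult.assoc)
  have s: "AE z in dA. summable (\<lambda>n. norm (?f n z))"
  proof (rule AE_I2)
    fix z assume "z \<in> space dA"
    then show "summable (\<lambda>n. norm (?f n z))"
      using le by (intro summable_comparison_test'[where N = 0, OF summable_mult2[OF b, of "norm (v z)"]]) simp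
  qed
  have si: "summable (\<lambda>n. LINT z|dA. norm (?f n z))"
  proof (rule summable_comparison_test'[where N = 0, OF summable_mult2[OF b, of "LINT z|dA. norm (v z)"]])
    fix n
    have "(LINT z|dA. norm (?f n z)) \<le> (LINT z|dA. norm (b n) * \<rho> ^ n * norm (v z))"
      using v by (intro integral_mono integrable_norm fi) (auto intro: le)
    then show "norm (LINT z|dA. norm (?f n z)) \<le> norm (b n) * \<rho> ^ n * (LINT z|dA. norm (v z))"
      by (simp add: integral_nonneg_AE)
  qed
  have eq: "(\<Sum>n. ?f n z) = (\<Sum>n. b n * z ^ n) * v z" if "z \<in> \<bbbD>" for z
  proof (cases "v z = 0")
    case False
    then have z: "norm z < \<rho>" using supp that by force
    have "summable (\<lambda>n. b n * z ^ n)"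
      by (rule summable_norm_cancel, rule summable_comparison_test'[where N = 0, OF b])
        (use z in \<open>auto simp: norm_mult norm_power intro!: mult_left_mono power_mono\<close>)
    then show ?thesis by (rule suminf_mult2[symmetric])
  qed simp
  have "(LINT z|dA. (\<Sum>n. ?f n z)) = (LINT z|dA. (\<Sum>n. b n * z ^ n) * v z)"
    by (rule Bochner_Integration.integral_cong) (auto simp: eq)
  then show "(\<lambda>n. b n * (LINT z|dA. z ^ n * v z)) sums (LINT z|dA. (\<Sum>n. b n * z ^ n) * v z)"
    using sums_integral[OF fi s si] by (simp add: mult.assoc)
  have "integrable dA (\<lambda>z. (\<Sum>n. ?f n z))" by (rule integrable_suminf[OF fi s si])
  then show "integrable dA (\<lambda>z. (\<Sum>n. b n * z ^ n) * v z)"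
    by (rule Bochner_Integration.integrable_cong[THEN iffD1, rotated 2]) (auto simp: eq)
qed

lemma integral_pser:
  fixes v :: "complex \<Rightarrow> complex"
  assumes v: "integrable dA v" and b: "summable (\<lambda>n. norm (b n))"
  shows "(\<lambda>n. b n * (LINT z|dA. z ^ n * v z)) sums (LINT z|dA. pser b z * v z)"
    and "integrable dA (\<lambda>z. pser b z * v z)"
proof -
  have eq: "(LINT z|dA. (\<Sum>n. b n * z ^ n) * v z) = (LINT z|dA. pser b z * v z)"
    by (rule Bochner_Integration.integral_cong) (auto simp: pser_def)
  have eqi: "integrable dA (\<lambda>z. (\<Sum>n. b n * z ^ n) * v z) = integrable dA (\<lambda>z. pser b z * v z)"
    by (rule Bochner_Integration.integrable_cong) (auto simp: pser_def)
  from integral_power_series[OF v, of 1 b] b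
  show "(\<lambda>n. b n * (LINT z|dA. z ^ n * v z)) sums (LINT z|dA. pser b z * v z)"
    and "integrable dA (\<lambda>z. pser b z * v z)" by (simp_all add: eq eqi)
qed

lemma borel_measurable_dA_hol_disc: "f \<in> hol_disc \<Longrightarrow> f \<in> borel_measurable dA"
  by (intro borel_measurable_dA_continuous holomorphic_on_imp_continuous_on) (simp add: hol_disc_def)

lemma borel_measurable_dA_pser: "disc_conv \<alpha> \<Longrightarrow> pser \<alpha> \<in> borel_measurable dA"
  by (intro borel_measurable_dA_hol_disc pser_in_hol_disc)

lemma integrable_pow_radial:
  assumes "integrable dA (\<lambda>z. V (norm z))"
  shows "integrable dA (\<lambda>z. norm z ^ k * V (norm z) :: real)"
  by (rule integrable_dA_bounded_mult[OF assms, of _ 1])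
    (auto intro!: borel_measurable_dA_borel simp: power_le_one)

lemma cnj_power_measurable_dA: "(\<lambda>z. cnj z ^ n) \<in> borel_measurable dA"
  by (intro borel_measurable_dA_continuous continuous_intros)

lemma integral_monomials:
  fixes V :: "real \<Rightarrow> real"
  assumes V: "integrable dA (\<lambda>z. V (norm z))"
  shows "(LINT z|dA. z ^ m * (cnj z ^ n * of_real (V (norm z)))) =
    (if m = n then of_real (LINT z|dA. norm z ^ (2 * n) * V (norm z)) else 0)"
proof (cases "m = n")
  case True
  have "(LINT z|dA. z ^ n * (cnj z ^ n * of_real (V (norm z)))) =
     (LINT z|dA. complex_of_real (norm z ^ (2 * n) * V (norm z)))"
  proof (rule Bochner_Integration.integral_cong)
    fix z :: complex
    have "z ^ n * cnj z ^ n = (z * cnj z) ^ n" by (simp add: power_mult_distrib)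
    also have "\<dots> = of_real ((norm z)\<^sup>2) ^ n" by (simp only: complex_norm_square)
    finally have "z ^ n * cnj z ^ n = of_real (norm z ^ (2 * n))" by (simp add: power_mult)
    then show "z ^ n * (cnj z ^ n * of_real (V (norm z))) = of_real (norm z ^ (2 * n) * V (norm z))"
      by (simp flip: mult.assoc)
  qed simp
  also have "\<dots> = of_real (LINT z|dA. norm z ^ (2 * n) * V (norm z))"
    by (rule integral_complex_of_real)
  finally show ?thesis by (simp only: True simp_thms if_True)
next
  case False
  have m: "(\<lambda>z. z ^ m * (cnj z ^ n * complex_of_real (V (norm z)))) \<in> borel_measurable dA"
    using V by (intro borel_measurable_times power_measurable_dA cnj_power_measurable_dA) simp
  show ?thesis using False
    by (simp, intro integral_dA_eq_0_by_rotation[OF m False])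
      (simp add: norm_mult power_mult_distrib mult_ac)
qed

lemma summable_norm_square:
  fixes b :: "nat \<Rightarrow> 'a::real_normed_vector"
  assumes "summable (\<lambda>n. norm (b n))" shows "summable (\<lambda>n. (norm (b n))\<^sup>2)"
proof (rule summable_comparison_test'[where N = 0, OF summable_mult[OF assms, of "\<Sum>n. norm (b n)"]])
  fix n
  have "norm (b n) \<le> (\<Sum>n. norm (b n))"
    using sum_le_suminf[OF assms, of "{n}"] by simp
  then show "norm ((norm (b n))\<^sup>2) \<le> (\<Sum>n. norm (b n)) * norm (b n)"
    by (simp add: power2_eq_square mult_right_mono)
qed

text \<open>The series is integrated termwise twice, once in each factor of
  \<open>pser b z * cnj (pser b z)\<close>. The first conclusion keeps the sum under the integral,
  since the kernel estimate bounds that sum pointwise in z; the third expresses the integral by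
  moments and serves the A^2 estimate.\<close>

lemma parseval_dA:
  fixes V :: "real \<Rightarrow> real"
  assumes V: "integrable dA (\<lambda>z. V (norm z))" and b: "summable (\<lambda>n. norm (b n))"
  shows "(LINT z|dA. (norm (pser b z))\<^sup>2 * V (norm z)) =
         (LINT z|dA. (\<Sum>n. (norm (b n))\<^sup>2 * norm z ^ (2 * n)) * V (norm z))" (is "_ = ?R")
    and "integrable dA (\<lambda>z. (norm (pser b z))\<^sup>2 * V (norm z))"
    and "(\<lambda>n. (norm (b n))\<^sup>2 * (LINT z|dA. norm z ^ (2 * n) * V (norm z)))
          sums (LINT z|dA. (norm (pser b z))\<^sup>2 * V (norm z))"
proof -
  define I where "I n = (LINT z|dA. norm z ^ (2 * n) * V (norm z))" for n
  have dc: "disc_conv b" by (rule disc_convI)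
      (rule summable_norm_cancel, rule summable_comparison_test'[where N = 0, OF b],
        auto simp: norm_mult norm_power mult_left_le power_le_one)
  have Vc: "integrable dA (\<lambda>z. complex_of_real (V (norm z)))" using V by simp
  have cb: "integrable dA (\<lambda>z. cnj (pser b z) * of_real (V (norm z)))"
    using integral_pser(2)[OF Vc b] complex_integrable_cnj[of dA "\<lambda>z. pser b z * of_real (V (norm z))"]
    by simp
  have cz: "integrable dA (\<lambda>z. cnj z ^ n * of_real (V (norm z)))" for n
    by (rule integrable_dA_bounded_mult[OF Vc cnj_power_measurable_dA, of _ 1])
      (auto simp: norm_power power_le_one)
  have coeff: "(LINT z|dA. z ^ n * (cnj (pser b z) * of_real (V (norm z)))) = cnj (b n) * of_real (I n)" for n
  proof -
    have "(\<lambda>m. b m * (LINT z|dA. z ^ m * (cnj z ^ n * of_real (V (norm z)))))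
        sums (LINT z|dA. pser b z * (cnj z ^ n * of_real (V (norm z))))"
      by (rule integral_pser(1)[OF cz b])
    also have "(\<lambda>m. b m * (LINT z|dA. z ^ m * (cnj z ^ n * of_real (V (norm z))))) =
       (\<lambda>m. if m = n then b n * of_real (I n) else 0)"
      by (auto simp: integral_monomials[OF V] I_def)
    finally have "(LINT z|dA. pser b z * (cnj z ^ n * of_real (V (norm z)))) = b n * of_real (I n)"
      using sums_single[of n "\<lambda>_. b n * of_real (I n)"] sums_unique2 by blast
    then have "cnj (b n) * of_real (I n) = cnj (LINT z|dA. pser b z * (cnj z ^ n * of_real (V (norm z))))"
      by simp
    also have "\<dots> =
      (LINT z|dA. cnj (pser b z * (cnj z ^ n * of_real (V (norm z)))))"
      by (rule Bochner_Integration.integral_cnj[symmetric])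
    also have "\<dots> = (LINT z|dA. z ^ n * (cnj (pser b z) * of_real (V (norm z))))"
      by (rule Bochner_Integration.integral_cong) (simp_all add: mult_ac)
    finally show ?thesis by (rule sym)
  qed
  have "(\<lambda>n. b n * (LINT z|dA. z ^ n * (cnj (pser b z) * of_real (V (norm z)))))
      sums (LINT z|dA. pser b z * (cnj (pser b z) * of_real (V (norm z))))"
    by (rule integral_pser(1)[OF cb b])
  also have "(\<lambda>n. b n * (LINT z|dA. z ^ n * (cnj (pser b z) * of_real (V (norm z))))) =
      (\<lambda>n. of_real ((norm (b n))\<^sup>2 * I n))"
    by (simp only: coeff of_real_mult complex_norm_square mult.assoc)
  also have eqf: "(\<lambda>z. pser b z * (cnj (pser b z) * of_real (V (norm z)))) =
      (\<lambda>z. complex_of_real ((norm (pser b z))\<^sup>2 * V (norm z)))"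
    by (simp only: of_real_mult complex_norm_square mult.assoc)
  finally have s: "(\<lambda>n. (norm (b n))\<^sup>2 * I n) sums (LINT z|dA. (norm (pser b z))\<^sup>2 * V (norm z))"
    by (simp add: sums_of_real_iff del: of_real_mult of_real_power)
  then show "(\<lambda>n. (norm (b n))\<^sup>2 * (LINT z|dA. norm z ^ (2 * n) * V (norm z)))
          sums (LINT z|dA. (norm (pser b z))\<^sup>2 * V (norm z))" by (simp add: I_def)
  show "integrable dA (\<lambda>z. (norm (pser b z))\<^sup>2 * V (norm z))"
    using integrable_Re[OF integral_pser(2)[OF cb b, unfolded eqf]] by (simp only: Re_complex_of_real)
  let ?f = "\<lambda>n z. (norm (b n))\<^sup>2 * norm z ^ (2 * n) * V (norm (z::complex))"
  have fi: "integrable dA (?f n)" for n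
    using integrable_pow_radial[OF V, of "2 * n"] by (simp add: mult.assoc)
  note b2 = summable_norm_square[OF b]
  have le: "\<bar>?f n z\<bar> \<le> (norm (b n))\<^sup>2 * \<bar>V (norm z)\<bar>" if "z \<in> \<bbbD>" for n z
    using that by (auto simp: abs_mult power_le_one intro!: mult_right_mono mult_left_le)
  have sm: "AE z in dA. summable (\<lambda>n. norm (?f n z))"
    by (rule AE_I2, rule summable_comparison_test'[where N = 0, OF summable_mult2[OF b2]])
      (use le in auto)
  have si: "summable (\<lambda>n. LINT z|dA. norm (?f n z))"
  proof (rule summable_comparison_test'[where N = 0, OF summable_mult2[OF b2, of "LINT z|dA. \<bar>V (norm z)\<bar>"]])
    fix n
    have "(LINT z|dA. norm (?f n z)) \<le> (LINT z|dA. (norm (b n))\<^sup>2 * \<bar>V (norm z)\<bar>)"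
      using V by (intro integral_mono integrable_norm fi) (simp_all add: le)
    then show "norm (LINT z|dA. norm (?f n z)) \<le> (norm (b n))\<^sup>2 * (LINT z|dA. \<bar>V (norm z)\<bar>)"
      by (simp add: integral_nonneg_AE)
  qed
  have "(\<lambda>n. LINT z|dA. ?f n z) sums (LINT z|dA. (\<Sum>n. ?f n z))"
    by (rule sums_integral[OF fi sm si])
  also have "(\<lambda>n. LINT z|dA. ?f n z) = (\<lambda>n. (norm (b n))\<^sup>2 * I n)"
    by (simp add: I_def mult.assoc)
  also have "(LINT z|dA. (\<Sum>n. ?f n z)) = ?R"
  proof (rule Bochner_Integration.integral_cong)
    fix z assume "z \<in> space dA"
    then have "summable (\<lambda>n. (norm (b n))\<^sup>2 * norm z ^ (2 * n))"
      by (intro summable_comparison_test'[where N = 0, OF b2]) (auto simp: abs_mult power_le_one intro!: mult_left_le)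
    then show "(\<Sum>n. ?f n z) = (\<Sum>n. (norm (b n))\<^sup>2 * norm z ^ (2 * n)) * V (norm z)"
      by (rule suminf_mult2[symmetric])
  qed simp
  finally show "(LINT z|dA. (norm (pser b z))\<^sup>2 * V (norm z)) = ?R"
    using s sums_unique2 by blast
qed

subsection \<open>Dilations\<close>

lemma borel_measurable_sgn [measurable]: "(sgn :: complex \<Rightarrow> complex) \<in> borel_measurable borel"
  unfolding sgn_div_norm by measurable

lemma norm_sgn_le_1: "norm (sgn z) \<le> 1" for z :: complex
  by (simp add: norm_sgn)

lemma sgn_cnj_mult: "z * cnj (sgn z) = of_real (norm z)"
proof (cases "z = 0")
  case False
  have "z * cnj (sgn z) = (z * cnj z) / of_real (norm z)" by (simp add: sgn_eq)
  also have "\<dots> = of_real ((norm z)\<^sup>2) / of_real (norm z)" by (simp only: complex_norm_square)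
  finally show ?thesis using False by (simp add: power2_eq_square)
qed simp

lemma norm_mult_less_1: "norm w \<le> 1 \<Longrightarrow> norm z < 1 \<Longrightarrow> norm (w * z) < 1" for w z :: complex
  using mult_right_mono[of "norm w" 1 "norm z"] by (simp add: norm_mult)

text \<open>The function \<open>F w = \<integral> f (w z) v z dA\<close> with \<open>v = cnj (sgn (f (r z))) V\<close> is bounded on the unit circle
  by rotation invariance, and \<open>F r\<close> is the norm of the dilation, so the maximum principle applies.
  Cutting off at \<open>\<rho>\<close> makes \<open>F\<close> holomorphic beyond the closed disc.\<close>

lemma dilation_contractive_aux:
  fixes V :: "real \<Rightarrow> real"
  assumes \<alpha>: "disc_conv \<alpha>" and V: "integrable dA (\<lambda>z. V (norm z))"
    and V0: "\<And>s. 0 \<le> s \<Longrightarrow> s < 1 \<Longrightarrow> 0 \<le> V s"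
    and f: "integrable dA (\<lambda>z. norm (pser \<alpha> z) * V (norm z))"
    and r: "0 \<le> r" "r < 1" and \<rho>: "0 < \<rho>" "\<rho> < 1"
  shows "(LINT z|dA. norm (pser \<alpha> (of_real r * z)) * (V (norm z) * indicator {..<\<rho>} (norm z)))
     \<le> (LINT z|dA. norm (pser \<alpha> z) * V (norm z))"
proof -
  let ?f = "pser \<alpha>"
  define W where "W z = V (norm z) * indicator {..<\<rho>} (norm z)" for z :: complex
  define v where "v z = cnj (sgn (?f (of_real r * z))) * of_real (W z)" for z
  define c where "c n = (LINT z|dA. z ^ n * v z)" for n
  define F where "F w = (\<Sum>n. \<alpha> n * c n * w ^ n)" for w
  have W0: "0 \<le> W z" if "z \<in> \<bbbD>" for z using V0[of "norm z"] that by (simp add: W_def)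
  have im: "(\<lambda>z::complex. indicator {..<\<rho>} (norm z) :: real) \<in> borel_measurable dA"
    by (rule borel_measurable_dA_borel) simp
  have Wi: "integrable dA W" unfolding W_def
    using integrable_dA_bounded_mult[OF V im, of 1] by (simp add: mult.commute)
  have Wrot: "W (c * z) = W z" if "norm c = 1" for c z
    using that by (simp add: W_def norm_mult)
  have fr: "(\<lambda>z. ?f (of_real r * z)) \<in> borel_measurable dA"
  proof -
    have "dil r ?f \<in> borel_measurable dA"
      unfolding dil_pser[OF r(1) less_imp_le[OF r(2)]]
      by (intro borel_measurable_dA_pser disc_conv_dil \<alpha>) (use r in auto)
    then show ?thesis by (rule measurable_cong[THEN iffD1, rotated]) (auto simp: dil_def)
  qed
  have vi: "integrable dA v"
    unfolding v_def
  proof (rule integrable_dA_bounded_mult)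
    show "integrable dA (\<lambda>z. complex_of_real (W z))" using Wi by simp
    show "(\<lambda>z. cnj (sgn (?f (of_real r * z)))) \<in> borel_measurable dA"
      by (rule measurable_compose[OF measurable_compose[OF fr borel_measurable_sgn]])
        (intro borel_measurable_continuous_onI continuous_intros)
    show "norm (cnj (sgn (?f (of_real r * z)))) \<le> 1" for z by (simp add: norm_sgn_le_1)
  qed
  have nv: "norm (v z) \<le> W z" if "z \<in> \<bbbD>" for z
    using W0[OF that] by (auto simp: v_def norm_mult intro!: mult_left_le_one_le norm_sgn_le_1)
  have supp: "v z = 0" if "\<rho> \<le> norm z" for z using that by (simp add: v_def W_def)
  have c_le: "norm (c n) \<le> \<rho> ^ n * (LINT z|dA. W z)" for n
  proof -
    have "norm (c n) \<le> (LINT z|dA. norm (z ^ n * v z))" unfolding c_def by (rule integral_norm_bound)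
    also have "\<dots> \<le> (LINT z|dA. \<rho> ^ n * W z)"
    proof (rule integral_mono)
      show "integrable dA (\<lambda>z. norm (z ^ n * v z))"
        by (intro integrable_norm integrable_dA_bounded_mult[OF vi power_measurable_dA, of _ 1])
          (simp add: norm_power power_le_one)
      show "norm (z ^ n * v z) \<le> \<rho> ^ n * W z" if "z \<in> space dA" for z
      proof (cases "\<rho> \<le> norm z")
        case True
        then show ?thesis using supp W0[of z] \<rho> that by simp
      next
        case False
        then show ?thesis using nv[of z] \<rho> that
          by (auto simp: norm_mult norm_power intro!: mult_mono power_mono)
      qed
    qed (use Wi in simp)
    finally show ?thesis by simp
  qed
  have sums: "(\<lambda>n. \<alpha> n * c n * w ^ n) sums F w" if w: "norm w < 1 / \<rho>" for w
  proof -
    have q: "0 \<le> norm w * \<rho>" "norm w * \<rho> < 1" using w \<rho> by (auto simp: field_simps)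
    have "summable (\<lambda>n. norm (\<alpha> n * c n * w ^ n))"
    proof (rule summable_comparison_test'[where N = 0, OF summable_mult[OF disc_convD[OF \<alpha> q], of "LINT z|dA. W z"]])
      fix n
      have "norm (\<alpha> n * c n * w ^ n) = norm (\<alpha> n) * norm w ^ n * norm (c n)"
        by (simp add: norm_mult norm_power)
      also have "\<dots> \<le> norm (\<alpha> n) * norm w ^ n * (\<rho> ^ n * (LINT z|dA. W z))"
        by (intro mult_left_mono c_le) auto
      finally show "norm (norm (\<alpha> n * c n * w ^ n)) \<le> (LINT z|dA. W z) * (norm (\<alpha> n) * (norm w * \<rho>) ^ n)"
        by (simp add: power_mult_distrib mult_ac)
    qed
    then show ?thesis unfolding F_def by (rule summable_sums[OF summable_norm_cancel])
  qed
  have F_int: "F w = (LINT z|dA. ?f (w * z) * v z)"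
    and fv_int: "integrable dA (\<lambda>z. ?f (w * z) * v z)" if w: "norm w \<le> 1" for w
  proof -
    have sm: "summable (\<lambda>n. norm (\<alpha> n * w ^ n) * \<rho> ^ n)"
    proof (rule summable_comparison_test'[where N = 0, OF disc_convD[OF \<alpha>, of \<rho>]])
      show "norm (norm (\<alpha> n * w ^ n) * \<rho> ^ n) \<le> norm (\<alpha> n) * \<rho> ^ n" for n
        using \<rho> w by (simp add: norm_mult norm_power abs_mult power_le_one mult_right_mono mult_left_le)
    qed (use \<rho> in auto)
    have pf: "(\<Sum>n. \<alpha> n * w ^ n * z ^ n) = ?f (w * z)" if "z \<in> \<bbbD>" for z
    proof -
      have "norm (w * z) < 1" using that w by (simp add: norm_mult_less_1)
      then show ?thesis by (simp add: pser_def power_mult_distrib mult_ac)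
    qed
    have supp': "\<And>z. z \<in> \<bbbD> \<Longrightarrow> \<rho> \<le> norm z \<Longrightarrow> v z = 0" using supp by blast
    note ips = integral_power_series[OF vi \<rho>(1) less_imp_le[OF \<rho>(2)] supp' sm]
    have "(LINT z|dA. (\<Sum>n. \<alpha> n * w ^ n * z ^ n) * v z) = (LINT z|dA. ?f (w * z) * v z)"
      by (rule Bochner_Integration.integral_cong) (auto simp: pf)
    with ips(1) have "(\<lambda>n. \<alpha> n * w ^ n * c n) sums (LINT z|dA. ?f (w * z) * v z)"
      by (simp add: c_def)
    moreover have "norm w < 1 / \<rho>" using w \<rho> less_divide_eq_1_pos[of \<rho> 1] by linarith
    ultimately show "F w = (LINT z|dA. ?f (w * z) * v z)"
      using sums[of w] by (simp add: mult_ac sums_unique2)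
    show "integrable dA (\<lambda>z. ?f (w * z) * v z)"
      using ips(2) by (rule Bochner_Integration.integrable_cong[THEN iffD1, rotated 2]) (auto simp: pf)
  qed
  define B where "B = (LINT z|dA. norm (?f z) * V (norm z))"
  have "norm (F (of_real r)) \<le> B"
  proof (rule maximum_modulus_frontier[where S = "cball 0 1" and f = F and \<xi> = "of_real r"])
    have "F holomorphic_on ball 0 (1 / \<rho>)"
      by (rule power_series_holomorphic[of 0 "1 / \<rho>" "\<lambda>n. \<alpha> n * c n"]) (use sums in auto)
    moreover have "cball 0 1 \<subseteq> (ball 0 (1 / \<rho>) :: complex set)"
    proof
      fix x :: complex assume "x \<in> cball 0 1"
      moreover have "1 < 1 / \<rho>" using \<rho> by simp
      ultimately have "norm x < 1 / \<rho>" unfolding mem_cball_0 by linarith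
      then show "x \<in> ball 0 (1 / \<rho>)" by simp
    qed
    ultimately have "F holomorphic_on cball 0 1" by (rule holomorphic_on_subset)
    then show "F holomorphic_on interior (cball 0 1)" "continuous_on (closure (cball 0 1)) F"
      by (auto intro: holomorphic_on_subset holomorphic_on_imp_continuous_on)
    fix w :: complex assume "w \<in> frontier (cball 0 1)"
    then have w: "norm w = 1" by simp
    have int: "integrable dA (\<lambda>z. norm (?f z) * W z)"
      unfolding W_def
      using integrable_dA_bounded_mult[OF f im, of 1] by (simp add: mult_ac)
    have "norm (F w) \<le> (LINT z|dA. norm (?f (w * z) * v z))"
      using w by (simp add: F_int integral_norm_bound)
    also have "\<dots> \<le> (LINT z|dA. norm (?f (w * z)) * W (w * z))"
    proof (rule integral_mono)
      show "integrable dA (\<lambda>z. norm (?f (w * z) * v z))" using fv_int[of w] w by simp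
      show "integrable dA (\<lambda>z. norm (?f (w * z)) * W (w * z))"
        using integrable_dA_rotate[OF w borel_measurable_integrable[OF int]] int by simp
      show "norm (?f (w * z) * v z) \<le> norm (?f (w * z)) * W (w * z)" if "z \<in> space dA" for z
        using nv[of z] that by (simp add: norm_mult Wrot w mult_left_mono)
    qed
    also have "\<dots> = (LINT z|dA. norm (?f z) * W z)"
      using integral_dA_rotate[OF w borel_measurable_integrable[OF int]] by simp
    also have "\<dots> \<le> B" unfolding B_def
      using V0 by (intro integral_mono int f) (auto simp: W_def indicator_def)
    finally show "norm (F w) \<le> B" .
  qed (use r in auto)
  moreover have "F (of_real r) = of_real (LINT z|dA. norm (?f (of_real r * z)) * W z)"
  proof -
    have "F (of_real r) = (LINT z|dA. ?f (of_real r * z) * v z)" using r by (intro F_int) simp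
    also have "\<dots> = (LINT z|dA. complex_of_real (norm (?f (of_real r * z)) * W z))"
      by (simp add: v_def sgn_cnj_mult flip: mult.assoc)
    finally show ?thesis by (simp only: integral_complex_of_real)
  qed
  ultimately show ?thesis by (simp add: W_def B_def)
qed

lemma integrable_dilation:
  fixes V :: "real \<Rightarrow> real"
  assumes \<alpha>: "disc_conv \<alpha>" and V: "integrable dA (\<lambda>z. V (norm z))" and r: "0 \<le> r" "r < 1"
  shows "integrable dA (\<lambda>z. norm (pser \<alpha> (of_real r * z)) * V (norm z))"
proof (rule integrable_dA_bounded_mult[OF V])
  have eq: "pser (\<lambda>n. \<alpha> n * of_real r ^ n) z = pser \<alpha> (of_real r * z)" if "z \<in> \<bbbD>" for z
    using fun_cong[OF dil_pser[of r \<alpha>], of z] r that by (simp add: dil_def)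
  have "pser (\<lambda>n. \<alpha> n * of_real r ^ n) \<in> borel_measurable dA"
    by (intro borel_measurable_dA_pser disc_conv_dil \<alpha>) (use r in auto)
  then have "(\<lambda>z. norm (pser (\<lambda>n. \<alpha> n * of_real r ^ n) z)) \<in> borel_measurable dA" by simp
  then show "(\<lambda>z. norm (pser \<alpha> (of_real r * z))) \<in> borel_measurable dA"
    by (rule measurable_cong[THEN iffD1, rotated]) (auto simp: eq)
  show "norm (norm (pser \<alpha> (of_real r * z))) \<le> (\<Sum>n. norm (\<alpha> n * of_real r ^ n))" if "z \<in> \<bbbD>" for z
    using norm_pser_le[OF fast_imp_summable[OF disc_conv_fast[OF \<alpha> r]], of z] by (simp add: eq[OF that])
qed

text \<open>The cutoff radius of \<open>dilation_contractive_aux\<close> tends to 1. Dominated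
  convergence applies because for fixed r < 1 the dilation is already integrable.\<close>

lemma dilation_contractive:
  fixes V :: "real \<Rightarrow> real"
  assumes \<alpha>: "disc_conv \<alpha>" and V: "integrable dA (\<lambda>z. V (norm z))"
    and V0: "\<And>s. 0 \<le> s \<Longrightarrow> s < 1 \<Longrightarrow> 0 \<le> V s"
    and f: "integrable dA (\<lambda>z. norm (pser \<alpha> z) * V (norm z))"
    and r: "0 \<le> r" "r < 1"
  shows "(LINT z|dA. norm (pser \<alpha> (of_real r * z)) * V (norm z)) \<le> (LINT z|dA. norm (pser \<alpha> z) * V (norm z))"
proof (rule LIMSEQ_le_const2)
  define \<rho> where "\<rho> k = real (Suc k) / real (Suc (Suc k))" for k
  have \<rho>: "0 < \<rho> k" "\<rho> k < 1" for k by (auto simp: \<rho>_def)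
  have lim: "\<rho> \<longlonglongrightarrow> 1" unfolding \<rho>_def using LIMSEQ_Suc[OF LIMSEQ_n_over_Suc_n] by simp
  note fi = integrable_dilation[OF \<alpha> V r]
  show "(\<lambda>k. LINT z|dA. norm (pser \<alpha> (of_real r * z)) * (V (norm z) * indicator {..<\<rho> k} (norm z)))
      \<longlonglongrightarrow> (LINT z|dA. norm (pser \<alpha> (of_real r * z)) * V (norm z))"
  proof (rule integral_dominated_convergence[where w = "\<lambda>z. norm (pser \<alpha> (of_real r * z)) * V (norm z)"])
    show "(\<lambda>z. norm (pser \<alpha> (of_real r * z)) * V (norm z)) \<in> borel_measurable dA"
      "integrable dA (\<lambda>z. norm (pser \<alpha> (of_real r * z)) * V (norm z))" using fi by auto
    have "(\<lambda>z. indicator {..<\<rho> k} (norm (z::complex)) :: real) \<in> borel_measurable dA" for k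
      by (rule borel_measurable_dA_borel) simp
    from borel_measurable_times[OF borel_measurable_integrable[OF fi] this]
    show "(\<lambda>z. norm (pser \<alpha> (of_real r * z)) * (V (norm z) * indicator {..<\<rho> k} (norm z))) \<in> borel_measurable dA" for k
      by (simp add: mult.assoc)
    show "AE z in dA. (\<lambda>k. norm (pser \<alpha> (of_real r * z)) * (V (norm z) * indicator {..<\<rho> k} (norm z)))
       \<longlonglongrightarrow> norm (pser \<alpha> (of_real r * z)) * V (norm z)"
    proof (rule AE_I2)
      fix z assume "z \<in> space dA"
      then have "eventually (\<lambda>k. norm z < \<rho> k) sequentially"
        using lim by (intro order_tendstoD) auto
      then have "eventually (\<lambda>k. norm (pser \<alpha> (of_real r * z)) * (V (norm z) * indicator {..<\<rho> k} (norm z)) =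
         norm (pser \<alpha> (of_real r * z)) * V (norm z)) sequentially"
        by eventually_elim simp
      then show "(\<lambda>k. norm (pser \<alpha> (of_real r * z)) * (V (norm z) * indicator {..<\<rho> k} (norm z)))
       \<longlonglongrightarrow> norm (pser \<alpha> (of_real r * z)) * V (norm z)" by (rule tendsto_eventually)
    qed
    show "AE z in dA. norm (norm (pser \<alpha> (of_real r * z)) * (V (norm z) * indicator {..<\<rho> k} (norm z)))
       \<le> norm (pser \<alpha> (of_real r * z)) * V (norm z)" for k
      by (rule AE_I2) (auto simp: indicator_def V0)
  qed
  show "\<exists>N. \<forall>k\<ge>N. (LINT z|dA. norm (pser \<alpha> (of_real r * z)) * (V (norm z) * indicator {..<\<rho> k} (norm z)))
     \<le> (LINT z|dA. norm (pser \<alpha> z) * V (norm z))"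
    using dilation_contractive_aux[OF \<alpha> V V0 f r \<rho>] by blast
qed

text \<open>Contractivity takes the place of a dominating function: dilations converge pointwise and
  their norms do not exceed the norm of the limit, so Scheffe's lemma gives convergence in
  norm.\<close>

lemma dilation_tendsto:
  fixes V :: "real \<Rightarrow> real"
  assumes \<alpha>: "disc_conv \<alpha>" and V: "integrable dA (\<lambda>z. V (norm z))"
    and V0: "\<And>s. 0 \<le> s \<Longrightarrow> s < 1 \<Longrightarrow> 0 \<le> V s"
    and f: "integrable dA (\<lambda>z. norm (pser \<alpha> z) * V (norm z))"
  shows "((\<lambda>r. LINT z|dA. norm (pser \<alpha> (of_real r * z) - pser \<alpha> z) * V (norm z)) \<longlongrightarrow> 0) (at_left 1)"
proof (rule tendsto_at_left_sequentially[of 0])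
  fix S :: "nat \<Rightarrow> real" assume S: "\<And>n. S n < 1" "\<And>n. 0 < S n" "S \<longlonglongrightarrow> 1"
  let ?F = "\<lambda>n z. pser \<alpha> (of_real (S n) * z) * of_real (V (norm z))"
  let ?f = "\<lambda>z. pser \<alpha> z * of_real (V (norm z))"
  have Vm: "(\<lambda>z. complex_of_real (V (norm z))) \<in> borel_measurable dA" using V by simp
  have nF: "norm (?F n z) = norm (pser \<alpha> (of_real (S n) * z)) * V (norm z)" if "z \<in> \<bbbD>" for n z
    using that V0 by (simp add: norm_mult)
  have nf: "norm (?f z) = norm (pser \<alpha> z) * V (norm z)" if "z \<in> \<bbbD>" for z
    using that V0 by (simp add: norm_mult)
  have mF: "?F n \<in> borel_measurable dA" for n
  proof (intro borel_measurable_times Vm)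
    have "dil (S n) (pser \<alpha>) \<in> borel_measurable dA"
      unfolding dil_pser[OF less_imp_le[OF S(2)] less_imp_le[OF S(1)]]
      by (intro borel_measurable_dA_pser disc_conv_dil \<alpha>) (use S in \<open>auto intro: less_imp_le\<close>)
    then show "(\<lambda>z. pser \<alpha> (of_real (S n) * z)) \<in> borel_measurable dA"
      by (rule measurable_cong[THEN iffD1, rotated]) (auto simp: dil_def)
  qed
  have iF: "integrable dA (?F n)" for n
  proof -
    have "integrable dA (\<lambda>z. norm (?F n z))"
      using integrable_dilation[OF \<alpha> V less_imp_le[OF S(2)] S(1), of n]
      by (rule Bochner_Integration.integrable_cong[THEN iffD2, rotated 2]) (use nF in auto)
    then show ?thesis using integrable_norm_iff[OF mF] by blast
  qed
  have mf: "?f \<in> borel_measurable dA" by (intro borel_measurable_times Vm borel_measurable_dA_pser \<alpha>)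
  have "integrable dA (\<lambda>z. norm (?f z))"
    using f by (rule Bochner_Integration.integrable_cong[THEN iffD2, rotated 2]) (use nf in auto)
  then have if': "integrable dA ?f" using integrable_norm_iff[OF mf] by blast
  have lim: "(\<lambda>n. \<integral>\<^sup>+ z. norm (?F n z - ?f z) \<partial>dA) \<longlonglongrightarrow> 0"
  proof (rule Scheffe_lemma1[OF iF if'])
    show "AE z in dA. (\<lambda>n. ?F n z) \<longlonglongrightarrow> ?f z"
    proof (rule AE_I2)
      fix z assume "z \<in> space dA"
      then have z: "norm z < 1" by simp
      have "isCont (pser \<alpha>) z" using has_field_derivative_pser[OF \<alpha> z] by (rule DERIV_isCont)
      moreover have "(\<lambda>n. of_real (S n) * z) \<longlonglongrightarrow> of_real 1 * z"
        by (intro tendsto_intros S)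
      ultimately have "(\<lambda>n. pser \<alpha> (of_real (S n) * z)) \<longlonglongrightarrow> pser \<alpha> z"
        by (intro isCont_tendsto_compose[of z "pser \<alpha>"]) auto
      then show "(\<lambda>n. ?F n z) \<longlonglongrightarrow> ?f z" by (intro tendsto_intros)
    qed
    have "(\<integral>\<^sup>+ z. norm (?F n z) \<partial>dA) \<le> (\<integral>\<^sup>+ z. norm (?f z) \<partial>dA)" for n
    proof -
      have "(\<integral>\<^sup>+ z. norm (?F n z) \<partial>dA) = ennreal (LINT z|dA. norm (?F n z))"
        using iF by (intro nn_integral_eq_integral integrable_norm) auto
      also have "(LINT z|dA. norm (?F n z)) = (LINT z|dA. norm (pser \<alpha> (of_real (S n) * z)) * V (norm z))"
        by (rule Bochner_Integration.integral_cong) (use nF in auto)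
      also have "\<dots> \<le> (LINT z|dA. norm (pser \<alpha> z) * V (norm z))"
        by (rule dilation_contractive[OF \<alpha> V V0 f less_imp_le[OF S(2)] S(1)])
      also have "\<dots> = (LINT z|dA. norm (?f z))"
        by (rule Bochner_Integration.integral_cong) (use nf in auto)
      also have "ennreal \<dots> = (\<integral>\<^sup>+ z. norm (?f z) \<partial>dA)"
        using if' by (intro nn_integral_eq_integral[symmetric] integrable_norm) auto
      finally show ?thesis by (simp add: ennreal_leI)
    qed
    then show "limsup (\<lambda>n. \<integral>\<^sup>+ z. norm (?F n z) \<partial>dA) \<le> (\<integral>\<^sup>+ z. norm (?f z) \<partial>dA)"
      by (intro Limsup_bounded) auto
  qed
  have eq: "(\<integral>\<^sup>+ z. norm (?F n z - ?f z) \<partial>dA) =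
     ennreal (LINT z|dA. norm (pser \<alpha> (of_real (S n) * z) - pser \<alpha> z) * V (norm z))" for n
  proof -
    have "(\<integral>\<^sup>+ z. norm (?F n z - ?f z) \<partial>dA) = ennreal (LINT z|dA. norm (?F n z - ?f z))"
      using iF if' by (intro nn_integral_eq_integral integrable_norm Bochner_Integration.integrable_diff) auto
    also have "(LINT z|dA. norm (?F n z - ?f z)) =
       (LINT z|dA. norm (pser \<alpha> (of_real (S n) * z) - pser \<alpha> z) * V (norm z))"
    proof (rule Bochner_Integration.integral_cong)
      fix z assume "z \<in> space dA"
      then show "norm (?F n z - ?f z) = norm (pser \<alpha> (of_real (S n) * z) - pser \<alpha> z) * V (norm z)"
        using V0 by (simp add: norm_mult flip: left_diff_distrib)
    qed simp
    finally show ?thesis .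
  qed
  have nn: "0 \<le> (LINT z|dA. norm (pser \<alpha> (of_real (S n) * z) - pser \<alpha> z) * V (norm z))" for n
    by (rule integral_nonneg_AE) (auto simp: V0)
  have "(\<lambda>n. ennreal (LINT z|dA. norm (pser \<alpha> (of_real (S n) * z) - pser \<alpha> z) * V (norm z))) \<longlonglongrightarrow> ennreal 0"
    using lim unfolding eq by simp
  then show "(\<lambda>n. LINT z|dA. norm (pser \<alpha> (of_real (S n) * z) - pser \<alpha> z) * V (norm z)) \<longlonglongrightarrow> 0"
    using nn by (subst (asm) tendsto_ennreal_iff) auto
qed simp

subsection \<open>Moments and tails of a radial weight\<close>

locale weight =
  fixes \<omega> :: "real \<Rightarrow> real"
  assumes radial_weight: "radial_weight \<omega>"
begin

abbreviation mu :: "nat \<Rightarrow> real" where "mu n \<equiv> moment \<omega> (real n)"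

abbreviation tail :: "real \<Rightarrow> real" where "tail \<equiv> weight_tail \<omega>"

lemma weight_nonneg: "0 \<le> s \<Longrightarrow> s < 1 \<Longrightarrow> 0 \<le> \<omega> s"
  using radial_weight by (simp add: radial_weight_def)

lemma set_integrable_weight: "set_integrable lebesgue {0..<1} \<omega>"
  using radial_weight by (simp add: radial_weight_def)

lemma tail_pos: "0 \<le> r \<Longrightarrow> r < 1 \<Longrightarrow> 0 < tail r"
  using radial_weight by (simp add: radial_weight_def)

lemma integrable_weight: "integrable dA (\<lambda>z. \<omega> (norm z))"
  by (rule integrable_dA_radial[OF set_integrable_weight])

lemma integrable_weight_complex: "integrable dA (\<lambda>z. complex_of_real (\<omega> (norm z)))"
  using integrable_weight by simp

lemma set_integrable_mult_weight:
  assumes h: "h \<in> borel_measurable borel" and B: "\<And>s. 0 \<le> s \<Longrightarrow> s < 1 \<Longrightarrow> \<bar>h s\<bar> \<le> B"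
  shows "set_integrable lebesgue {0..<1} (\<lambda>s. h s * \<omega> s)"
  unfolding set_integrable_def
proof (rule Bochner_Integration.integrable_bound)
  have w: "integrable lebesgue (\<lambda>s. indicator {0..<1} s * \<omega> s)"
    using set_integrable_weight by (simp add: set_integrable_def)
  then show "integrable lebesgue (\<lambda>s. B * (indicator {0..<1} s * \<omega> s))" by simp
  have "(\<lambda>s. h s * (indicator {0..<1} s * \<omega> s)) \<in> borel_measurable lebesgue"
    using h by (intro borel_measurable_times borel_measurable_integrable[OF w] measurable_completion) simp
  then show "(\<lambda>s. indicator {0..<1} s *\<^sub>R (h s * \<omega> s)) \<in> borel_measurable lebesgue"
    by (simp add: mult_ac)
  show "AE s in lebesgue. norm (indicator {0..<1} s *\<^sub>R (h s * \<omega> s)) \<le> norm (B * (indicator {0..<1} s * \<omega> s))"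
  proof (rule AE_I2)
    fix s :: real
    show "norm (indicator {0..<1} s *\<^sub>R (h s * \<omega> s)) \<le> norm (B * (indicator {0..<1} s * \<omega> s))"
    proof (cases "s \<in> {0..<1}")
      case True
      then have "\<bar>h s\<bar> \<le> \<bar>B\<bar>" using B[of s] by auto
      then show ?thesis using True by (auto simp: abs_mult intro: mult_right_mono)
    qed simp
  qed
qed

lemma set_integrable_moment: "0 \<le> x \<Longrightarrow> set_integrable lebesgue {0..<1} (\<lambda>s. s powr x * \<omega> s)"
  by (rule set_integrable_mult_weight[where B = 1]) (auto simp: powr_le1)

lemma set_integrable_tail: "0 \<le> r \<Longrightarrow> set_integrable lebesgue {r..<1} \<omega>"
  by (rule set_integrable_subset[OF set_integrable_weight]) auto

lemma LINT_indicator_tail: "tail r = (LINT s|lebesgue. indicator {r..<1} s * \<omega> s)"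
  by (simp add: weight_tail_def set_lebesgue_integral_def)

lemma LINT_indicator_moment: "moment \<omega> x = (LINT s|lebesgue. indicator {0..<1} s * (s powr x * \<omega> s))"
  by (simp add: moment_def set_lebesgue_integral_def)

lemma integrable_indicator_tail: "0 \<le> r \<Longrightarrow> integrable lebesgue (\<lambda>s. indicator {r..<1} s * \<omega> s)"
  using set_integrable_tail[of r] by (simp add: set_integrable_def)

lemma integrable_indicator_moment: "0 \<le> x \<Longrightarrow> integrable lebesgue (\<lambda>s. indicator {0..<1} s * (s powr x * \<omega> s))"
  using set_integrable_moment[of x] by (simp add: set_integrable_def)

lemma moment_lower:
  assumes "0 < r" "r < 1" "0 \<le> x" shows "r powr x * tail r \<le> moment \<omega> x"
proof -
  have "r powr x * tail r = (LINT s|lebesgue. r powr x * (indicator {r..<1} s * \<omega> s))"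
    by (simp add: LINT_indicator_tail)
  also have "\<dots> \<le> moment \<omega> x" unfolding LINT_indicator_moment
  proof (rule integral_mono)
    show "r powr x * (indicator {r..<1} s * \<omega> s) \<le> indicator {0..<1} s * (s powr x * \<omega> s)" for s
      using assms by (auto simp: indicator_def weight_nonneg intro!: mult_right_mono powr_mono2)
  qed (use assms integrable_indicator_tail[of r] integrable_indicator_moment in auto)
  finally show ?thesis .
qed

lemma moment_pos: assumes "0 \<le> x" shows "0 < moment \<omega> x"
proof -
  have "0 < (1 / 2) powr x * tail (1 / 2)" using tail_pos[of "1 / 2"] by simp
  also have "\<dots> \<le> moment \<omega> x" using assms by (intro moment_lower) auto
  finally show ?thesis .
qed

lemma moment_antimono:
  assumes "0 \<le> x" "x \<le> y" shows "moment \<omega> y \<le> moment \<omega> x"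
  unfolding LINT_indicator_moment
proof (rule integral_mono)
  show "indicator {0..<1} s * (s powr y * \<omega> s) \<le> indicator {0..<1} s * (s powr x * \<omega> s)" for s
    using assms by (auto simp: indicator_def weight_nonneg intro!: mult_right_mono powr_mono')
qed (use assms integrable_indicator_moment in auto)

lemma mu_pos: "0 < mu n" by (rule moment_pos) simp

text \<open>Above r the power is at most 1; below r the surplus factor \<open>s powr (y - x)\<close>
  is at most \<open>r powr (y - x)\<close>. Together with \<open>moment_lower\<close> this is the
  bridge between moments and tails. It is applied with 1 - r of order 1 / x and y a large multiple
  of x, when the last term is small enough to be absorbed.\<close>

lemma moment_upper:
  assumes "0 \<le> r" "r < 1" "0 \<le> x" "x \<le> y"
  shows "moment \<omega> y \<le> tail r + r powr (y - x) * moment \<omega> x"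
proof -
  have "moment \<omega> y \<le> (LINT s|lebesgue. indicator {r..<1} s * \<omega> s + r powr (y - x) * (indicator {0..<1} s * (s powr x * \<omega> s)))"
    unfolding LINT_indicator_moment
  proof (rule integral_mono)
    fix s :: real
    show "indicator {0..<1} s * (s powr y * \<omega> s) \<le>
      indicator {r..<1} s * \<omega> s + r powr (y - x) * (indicator {0..<1} s * (s powr x * \<omega> s))"
    proof (cases "s \<in> {0..<1}")
      case True
      then have w: "0 \<le> \<omega> s" using weight_nonneg by simp
      show ?thesis
      proof (cases "r \<le> s")
        case True
        have "s powr y * \<omega> s \<le> 1 * \<omega> s"
          using \<open>s \<in> {0..<1}\<close> assms w by (intro mult_right_mono powr_le1) auto
        moreover have "0 \<le> r powr (y - x) * (s powr x * \<omega> s)" using w by simp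
        ultimately show ?thesis using True \<open>s \<in> {0..<1}\<close> by simp
      next
        case False
        have "s powr y = s powr (y - x) * s powr x" by (simp flip: powr_add)
        also have "\<dots> \<le> r powr (y - x) * s powr x"
          using False \<open>s \<in> {0..<1}\<close> assms by (intro mult_right_mono powr_mono2) auto
        finally have "s powr y * \<omega> s \<le> r powr (y - x) * s powr x * \<omega> s"
          using w by (rule mult_right_mono)
        then show ?thesis using False \<open>s \<in> {0..<1}\<close> by (simp add: mult.assoc)
      qed
    next
      case False
      then have "s \<notin> {r..<1}" using assms by auto
      then show ?thesis using False by simp
    qed
  qed (use assms integrable_indicator_moment integrable_indicator_tail[of r] in auto)
  also have "\<dots> = tail r + r powr (y - x) * moment \<omega> x"
    using assms integrable_indicator_moment[of x] integrable_indicator_tail[of r]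
    by (simp add: LINT_indicator_moment LINT_indicator_tail)
  finally show ?thesis .
qed

lemma tail_antimono:
  assumes "0 \<le> r" "r \<le> s" shows "tail s \<le> tail r"
  unfolding LINT_indicator_tail
proof (rule integral_mono)
  show "indicator {s..<1} t * \<omega> t \<le> indicator {r..<1} t * \<omega> t" for t
    using assms weight_nonneg[of t] by (auto simp: indicator_def)
qed (use assms integrable_indicator_tail in auto)

lemma moment_le_tail_0: "0 \<le> x \<Longrightarrow> moment \<omega> x \<le> tail 0"
  unfolding LINT_indicator_moment LINT_indicator_tail
  by (intro integral_mono integrable_indicator_moment integrable_indicator_tail)
    (auto simp: indicator_def weight_nonneg powr_le1 intro!: mult_left_le_one_le)

text \<open>The area element contributes the factor 2 and one more power of the modulus, which is
  why squares of monomials lead to the odd moments.\<close>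

lemma integral_norm_power_weight: "(LINT z|dA. norm z ^ k * \<omega> (norm z)) = 2 * mu (Suc k)"
proof -
  have "set_integrable lebesgue {0..<1} (\<lambda>s. s ^ k * \<omega> s)"
    by (rule set_integrable_mult_weight[where B = 1]) (auto simp: power_le_one)
  then have "(LINT z|dA. norm z ^ k * \<omega> (norm z)) = (LINT s:{0..<1}|lebesgue. 2 * s * (s ^ k * \<omega> s))"
    by (rule integral_dA_radial)
  also have "\<dots> = (LINT s|lebesgue. 2 * (indicator {0..<1} s * (s powr real (Suc k) * \<omega> s)))"
    unfolding set_lebesgue_integral_def
    by (intro Bochner_Integration.integral_cong refl)
      (auto simp: indicator_def powr_realpow' simp del: of_nat_Suc)
  finally show ?thesis by (simp add: LINT_indicator_moment)
qed

lemma integral_weight: "(LINT z|dA. \<omega> (norm z)) = 2 * mu 1"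
  using integral_norm_power_weight[of 0] by simp

lemma disc_conv_inverse_moment: "disc_conv (\<lambda>n. 1 / of_real (2 * mu (2 * n + 1)))"
  unfolding disc_conv_def
proof (intro allI impI)
  fix r :: real assume r: "0 \<le> r \<and> r < 1"
  show "summable (\<lambda>n. norm (1 / complex_of_real (2 * mu (2 * n + 1))) * r ^ n)"
  proof (cases "r = 0")
    case True
    then show ?thesis by (intro summable_finite[of "{0}"]) (auto simp: power_0_left)
  next
    case False
    \<comment> \<open>A fourth root: \<open>moment_lower\<close> at \<rho> costs \<rho>^(-2n), and
      r^n = \<rho>^(4n) still leaves a convergent geometric series.\<close>
    define \<rho> where "\<rho> = sqrt (sqrt r)"
    have \<rho>: "0 < \<rho>" "\<rho> < 1" using r False by (auto simp: \<rho>_def)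
    have "\<rho> ^ 4 = (\<rho>\<^sup>2)\<^sup>2" by (simp flip: power_mult)
    then have r4: "r = \<rho> ^ 4" using r by (simp add: \<rho>_def)
    have T: "0 < tail \<rho>" using \<rho> by (intro tail_pos) auto
    have "summable (\<lambda>n. 1 / (\<rho> * tail \<rho>) * (\<rho>\<^sup>2) ^ n)"
      using \<rho> by (intro summable_mult summable_geometric) (simp add: power_less_one_iff abs_square_less_1)
    then show ?thesis
    proof (rule summable_comparison_test'[where N = 0])
      fix n
      have l: "\<rho> ^ (2 * n + 1) * tail \<rho> \<le> mu (2 * n + 1)"
        using moment_lower[OF \<rho>, of "real (2 * n + 1)"] \<rho> by (simp only: powr_realpow of_nat_0_le_iff)
      have "1 / (2 * mu (2 * n + 1)) \<le> 1 / mu (2 * n + 1)"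
        using mu_pos[of "2 * n + 1"] by (simp add: field_simps del: of_nat_add of_nat_mult)
      also have "\<dots> \<le> 1 / (\<rho> ^ (2 * n + 1) * tail \<rho>)"
        using l \<rho> T by (intro divide_left_mono mult_pos_pos mu_pos) auto
      finally have "1 / (2 * mu (2 * n + 1)) * r ^ n \<le> 1 / (\<rho> ^ (2 * n + 1) * tail \<rho>) * r ^ n"
        using r by (intro mult_right_mono) auto
      also have "1 / (\<rho> ^ (2 * n + 1) * tail \<rho>) * r ^ n = 1 / (\<rho> * tail \<rho>) * (\<rho>\<^sup>2) ^ n"
      proof -
        have "r ^ n = \<rho> ^ (2 * n) * (\<rho>\<^sup>2) ^ n"
          by (simp add: r4 flip: power_mult power_add)
        then show ?thesis using \<rho> T by (simp add: field_simps)
      qed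
      finally show "norm (norm (1 / complex_of_real (2 * mu (2 * n + 1))) * r ^ n) \<le> 1 / (\<rho> * tail \<rho>) * (\<rho>\<^sup>2) ^ n"
        using r mu_pos[of "2 * n + 1"] by (simp add: norm_divide norm_mult abs_mult del: of_nat_add of_nat_mult)
    qed
  qed
qed

lemma integral_zpow:
  "(LINT z|dA. z ^ m * (cnj z ^ n * of_real (\<omega> (norm z)))) = (if m = n then of_real (2 * mu (2 * n + 1)) else 0)"
  by (simp add: integral_monomials[OF integrable_weight] integral_norm_power_weight)

subsection \<open>The Bergman space and the pairing\<close>

definition nrm1 :: "(complex \<Rightarrow> complex) \<Rightarrow> real"
  where "nrm1 f = (LINT z|dA. norm (f z) * \<omega> (norm z))"

lemma nrm1_nonneg: "0 \<le> nrm1 f"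
  unfolding nrm1_def by (rule integral_nonneg_AE) (auto simp: weight_nonneg)

lemma Lp_weight_norm_1: "Lp_weight_norm 1 \<omega> f = nrm1 f"
  using nrm1_nonneg[of f] by (simp add: Lp_weight_norm_def nrm1_def)

lemma bergman_space_1: "bergman_space 1 \<omega> = {f \<in> hol_disc. integrable dA (\<lambda>z. norm (f z) * \<omega> (norm z))}"
  by (auto simp: bergman_space_def Lp_weight_def borel_measurable_dA_hol_disc)

lemma integrable_norm_weight_iff:
  fixes g :: "complex \<Rightarrow> complex"
  assumes "g \<in> borel_measurable dA"
  shows "integrable dA (\<lambda>z. norm (g z) * \<omega> (norm z)) \<longleftrightarrow> integrable dA (\<lambda>z. g z * of_real (\<omega> (norm z)))"
proof -
  have "integrable dA (\<lambda>z. norm (g z) * \<omega> (norm z)) \<longleftrightarrow> integrable dA (\<lambda>z. norm (g z * of_real (\<omega> (norm z))))"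
    by (rule Bochner_Integration.integrable_cong) (auto simp: norm_mult weight_nonneg)
  also have "\<dots> \<longleftrightarrow> integrable dA (\<lambda>z. g z * of_real (\<omega> (norm z)))"
    using assms integrable_weight by (intro integrable_norm_iff borel_measurable_times) auto
  finally show ?thesis .
qed

text \<open>For a dilation of \<open>pser \<beta>\<close> this is orthogonality of monomials; the general case follows since
  dilations converge in \<open>A\<^sup>1\<close>.\<close>

lemma monomial_pairing:
  assumes \<beta>: "disc_conv \<beta>" and g: "integrable dA (\<lambda>z. norm (pser \<beta> z) * \<omega> (norm z))"
  shows "(LINT z|dA. z ^ n * (cnj (pser \<beta> z) * of_real (\<omega> (norm z)))) = of_real (2 * mu (2 * n + 1)) * cnj (\<beta> n)"
proof (rule tendsto_unique)
  show "at_left (1::real) \<noteq> bot" by simp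
  define I where "I r = (LINT z|dA. z ^ n * (cnj (pser \<beta> (of_real r * z)) * of_real (\<omega> (norm z))))" for r
  let ?J = "LINT z|dA. z ^ n * (cnj (pser \<beta> z) * of_real (\<omega> (norm z)))"
  have ev: "eventually (\<lambda>r::real. 0 < r \<and> r < 1) (at_left 1)"
    using eventually_at_left_real[of 0 1] by simp
  have I: "I r = of_real (2 * mu (2 * n + 1)) * cnj (\<beta> n) * of_real r ^ n" if r: "0 < r" "r < 1" for r
  proof -
    have cz: "integrable dA (\<lambda>z. cnj z ^ n * of_real (\<omega> (norm z)))"
      by (rule integrable_dA_bounded_mult[OF integrable_weight_complex cnj_power_measurable_dA, of _ 1])
        (auto simp: norm_power power_le_one)
    let ?b = "\<lambda>m. \<beta> m * of_real r ^ m"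
    have b: "summable (\<lambda>m. norm (?b m))"
      using r by (intro fast_imp_summable disc_conv_fast \<beta>) auto
    have "(\<lambda>m. ?b m * (LINT z|dA. z ^ m * (cnj z ^ n * of_real (\<omega> (norm z)))))
        sums (LINT z|dA. pser ?b z * (cnj z ^ n * of_real (\<omega> (norm z))))"
      by (rule integral_pser(1)[OF cz b])
    also have "(\<lambda>m. ?b m * (LINT z|dA. z ^ m * (cnj z ^ n * of_real (\<omega> (norm z))))) =
       (\<lambda>m. if m = n then ?b n * of_real (2 * mu (2 * n + 1)) else 0)"
      by (auto simp: integral_zpow)
    finally have eq: "(LINT z|dA. pser ?b z * (cnj z ^ n * of_real (\<omega> (norm z)))) = ?b n * of_real (2 * mu (2 * n + 1))"
      using sums_single[of n "\<lambda>_. ?b n * of_real (2 * mu (2 * n + 1))"] sums_unique2 by blast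
    have pb: "pser ?b z = pser \<beta> (of_real r * z)" if "z \<in> \<bbbD>" for z
      using fun_cong[OF dil_pser[of r \<beta>], of z] r that by (simp add: dil_def)
    have "I r = (LINT z|dA. cnj (pser ?b z * (cnj z ^ n * of_real (\<omega> (norm z)))))"
      unfolding I_def by (rule Bochner_Integration.integral_cong) (auto simp: pb)
    also have "\<dots> = cnj (LINT z|dA. pser ?b z * (cnj z ^ n * of_real (\<omega> (norm z))))"
      by (rule Bochner_Integration.integral_cnj)
    also have "\<dots> = cnj (?b n * of_real (2 * mu (2 * n + 1)))" by (simp only: eq)
    finally show ?thesis by simp
  qed
  have "((\<lambda>r. of_real (2 * mu (2 * n + 1)) * cnj (\<beta> n) * of_real r ^ n) \<longlongrightarrow>
     of_real (2 * mu (2 * n + 1)) * cnj (\<beta> n) * of_real 1 ^ n) (at_left (1::real))"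
    by (intro tendsto_intros)
  then have lim: "((\<lambda>r. of_real (2 * mu (2 * n + 1)) * cnj (\<beta> n) * of_real r ^ n) \<longlongrightarrow>
     of_real (2 * mu (2 * n + 1)) * cnj (\<beta> n)) (at_left (1::real))"
    by (simp only: of_real_1 power_one mult_1_right)
  have "eventually (\<lambda>r. I r = of_real (2 * mu (2 * n + 1)) * cnj (\<beta> n) * of_real r ^ n) (at_left 1)"
    using ev by eventually_elim (rule I, auto)
  then show "(I \<longlongrightarrow> of_real (2 * mu (2 * n + 1)) * cnj (\<beta> n)) (at_left 1)"
    using lim tendsto_cong[of I] by fast
  have gi: "integrable dA (\<lambda>z. z ^ n * (cnj (pser \<beta> z) * of_real (\<omega> (norm z))))"
  proof (rule integrable_dA_bounded_mult[OF _ power_measurable_dA, of _ _ 1])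
    have "integrable dA (\<lambda>z. pser \<beta> z * of_real (\<omega> (norm z)))"
      using integrable_norm_weight_iff[OF borel_measurable_dA_pser[OF \<beta>]] g by simp
    then show "integrable dA (\<lambda>z. cnj (pser \<beta> z) * of_real (\<omega> (norm z)))"
      using complex_integrable_cnj[of dA "\<lambda>z. pser \<beta> z * of_real (\<omega> (norm z))"] by simp
  qed (simp add: norm_power power_le_one)
  have gir: "integrable dA (\<lambda>z. z ^ n * (cnj (pser \<beta> (of_real r * z)) * of_real (\<omega> (norm z))))"
    and gnr: "integrable dA (\<lambda>z. pser \<beta> (of_real r * z) * of_real (\<omega> (norm z)))" if r: "0 < r" "r < 1" for r
  proof -
    have "dil r (pser \<beta>) \<in> borel_measurable dA"
      using r by (simp add: dil_pser borel_measurable_dA_pser disc_conv_dil \<beta>)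
    then have m: "(\<lambda>z. pser \<beta> (of_real r * z)) \<in> borel_measurable dA"
      by (rule measurable_cong[THEN iffD1, rotated]) (auto simp: dil_def)
    show i: "integrable dA (\<lambda>z. pser \<beta> (of_real r * z) * of_real (\<omega> (norm z)))"
      using integrable_norm_weight_iff[OF m] integrable_dilation[OF \<beta> integrable_weight, of r] r by simp
    have "integrable dA (\<lambda>z. cnj (pser \<beta> (of_real r * z)) * of_real (\<omega> (norm z)))"
      using i complex_integrable_cnj[of dA "\<lambda>z. pser \<beta> (of_real r * z) * of_real (\<omega> (norm z))"] by simp
    then show "integrable dA (\<lambda>z. z ^ n * (cnj (pser \<beta> (of_real r * z)) * of_real (\<omega> (norm z))))"
      by (rule integrable_dA_bounded_mult[OF _ power_measurable_dA, of _ _ 1]) (simp add: norm_power power_le_one)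
  qed
  have gn: "integrable dA (\<lambda>z. pser \<beta> z * of_real (\<omega> (norm z)))"
    using integrable_norm_weight_iff[OF borel_measurable_dA_pser[OF \<beta>]] g by simp
  have "norm (I r - ?J) \<le> (LINT z|dA. norm (pser \<beta> (of_real r * z) - pser \<beta> z) * \<omega> (norm z))"
    if r: "0 < r" "r < 1" for r
  proof -
    have eq: "I r - ?J = (LINT z|dA. z ^ n * (cnj (pser \<beta> (of_real r * z)) * of_real (\<omega> (norm z)))
        - z ^ n * (cnj (pser \<beta> z) * of_real (\<omega> (norm z))))"
      unfolding I_def by (rule Bochner_Integration.integral_diff[symmetric, OF gir[OF r] gi])
    have "norm (I r - ?J) \<le> (LINT z|dA. norm (z ^ n * (cnj (pser \<beta> (of_real r * z)) * of_real (\<omega> (norm z)))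
        - z ^ n * (cnj (pser \<beta> z) * of_real (\<omega> (norm z)))))"
      unfolding eq by (rule integral_norm_bound)
    also have "\<dots> \<le> (LINT z|dA. norm (pser \<beta> (of_real r * z) - pser \<beta> z) * \<omega> (norm z))"
    proof (rule integral_mono)
      show "integrable dA (\<lambda>z. norm (z ^ n * (cnj (pser \<beta> (of_real r * z)) * of_real (\<omega> (norm z)))
        - z ^ n * (cnj (pser \<beta> z) * of_real (\<omega> (norm z)))))"
        by (rule integrable_norm[OF Bochner_Integration.integrable_diff[OF gir[OF r] gi]])
      have "integrable dA (\<lambda>z. norm (pser \<beta> (of_real r * z) * of_real (\<omega> (norm z)) - pser \<beta> z * of_real (\<omega> (norm z))))"
        by (rule integrable_norm[OF Bochner_Integration.integrable_diff[OF gnr[OF r] gn]])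
      moreover have "norm (pser \<beta> (of_real r * z) * of_real (\<omega> (norm z)) - pser \<beta> z * of_real (\<omega> (norm z))) =
          norm (pser \<beta> (of_real r * z) - pser \<beta> z) * \<omega> (norm z)" if "z \<in> space dA" for z
        unfolding left_diff_distrib[symmetric] norm_mult using that weight_nonneg[of "norm z"] by simp
      ultimately show "integrable dA (\<lambda>z. norm (pser \<beta> (of_real r * z) - pser \<beta> z) * \<omega> (norm z))"
        by (subst (asm) Bochner_Integration.integrable_cong[OF refl]) auto
      fix z assume "z \<in> space dA"
      then have z: "norm z < 1" by simp
      have "norm (z ^ n * (cnj (pser \<beta> (of_real r * z)) * of_real (\<omega> (norm z)))
        - z ^ n * (cnj (pser \<beta> z) * of_real (\<omega> (norm z)))) =
        norm (z ^ n * (cnj (pser \<beta> (of_real r * z) - pser \<beta> z) * of_real (\<omega> (norm z))))"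
        by (simp only: complex_cnj_diff left_diff_distrib right_diff_distrib)
      also have "\<dots> = norm z ^ n * (norm (pser \<beta> (of_real r * z) - pser \<beta> z) * \<omega> (norm z))"
        using z weight_nonneg[of "norm z"] by (simp only: norm_mult norm_power complex_mod_cnj norm_of_real) simp
      also have "\<dots> \<le> norm (pser \<beta> (of_real r * z) - pser \<beta> z) * \<omega> (norm z)"
        using z weight_nonneg[of "norm z"] by (intro mult_left_le_one_le) (auto simp: power_le_one)
      finally show "norm (z ^ n * (cnj (pser \<beta> (of_real r * z)) * of_real (\<omega> (norm z)))
        - z ^ n * (cnj (pser \<beta> z) * of_real (\<omega> (norm z)))) \<le> norm (pser \<beta> (of_real r * z) - pser \<beta> z) * \<omega> (norm z)" .
    qed
    finally show ?thesis .
  qed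
  then have "eventually (\<lambda>r. norm (I r - ?J) \<le> (LINT z|dA. norm (pser \<beta> (of_real r * z) - pser \<beta> z) * \<omega> (norm z))) (at_left 1)"
    using ev by (auto elim!: eventually_mono)
  then have "((\<lambda>r. I r - ?J) \<longlongrightarrow> 0) (at_left 1)"
    by (rule Lim_null_comparison) (rule dilation_tendsto[OF \<beta> integrable_weight weight_nonneg g])
  then show "(I \<longlongrightarrow> ?J) (at_left 1)" by (simp add: LIM_zero_iff)
qed

lemma
  assumes \<beta>: "disc_conv \<beta>" and g: "integrable dA (\<lambda>z. norm (pser \<beta> z) * \<omega> (norm z))"
    and \<alpha>: "disc_conv \<alpha>" and r: "0 \<le> r" "r < 1"
  shows pairing_sums: "(\<lambda>n. \<alpha> n * of_real r ^ n * (of_real (2 * mu (2 * n + 1)) * cnj (\<beta> n)))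
      sums (LINT z|dA. pser \<alpha> (of_real r * z) * cnj (pser \<beta> z) * of_real (\<omega> (norm z)))"
    and pairing_integrable: "integrable dA (\<lambda>z. pser \<alpha> (of_real r * z) * cnj (pser \<beta> z) * of_real (\<omega> (norm z)))"
proof -
  let ?a = "\<lambda>n. \<alpha> n * of_real r ^ n"
  have a: "summable (\<lambda>n. norm (?a n))"
    using r by (intro fast_imp_summable disc_conv_fast \<alpha>) auto
  have "integrable dA (\<lambda>z. pser \<beta> z * of_real (\<omega> (norm z)))"
    using integrable_norm_weight_iff[OF borel_measurable_dA_pser[OF \<beta>]] g by simp
  then have gi: "integrable dA (\<lambda>z. cnj (pser \<beta> z) * of_real (\<omega> (norm z)))"
    using complex_integrable_cnj[of dA "\<lambda>z. pser \<beta> z * of_real (\<omega> (norm z))"] by simp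
  have pa: "pser ?a z = pser \<alpha> (of_real r * z)" if "z \<in> \<bbbD>" for z
    using fun_cong[OF dil_pser[of r \<alpha>], of z] r that by (simp add: dil_def)
  have "(LINT z|dA. pser ?a z * (cnj (pser \<beta> z) * of_real (\<omega> (norm z)))) =
     (LINT z|dA. pser \<alpha> (of_real r * z) * cnj (pser \<beta> z) * of_real (\<omega> (norm z)))"
    by (rule Bochner_Integration.integral_cong) (auto simp: pa)
  with integral_pser(1)[OF gi a]
  show "(\<lambda>n. \<alpha> n * of_real r ^ n * (of_real (2 * mu (2 * n + 1)) * cnj (\<beta> n)))
      sums (LINT z|dA. pser \<alpha> (of_real r * z) * cnj (pser \<beta> z) * of_real (\<omega> (norm z)))"
    by (simp only: monomial_pairing[OF \<beta> g])
  show "integrable dA (\<lambda>z. pser \<alpha> (of_real r * z) * cnj (pser \<beta> z) * of_real (\<omega> (norm z)))"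
    using integral_pser(2)[OF gi a]
    by (rule Bochner_Integration.integrable_cong[THEN iffD1, rotated 2]) (auto simp: pa)
qed

text \<open>Dilations fix the constant function \<open>zpow 0\<close>, so the integrability clause
  of \<open>has_pairing\<close> for it is a statement about g alone.\<close>

lemma has_pairing_integrable:
  assumes "has_pairing \<omega> (zpow 0) g l" "g \<in> borel_measurable dA"
  shows "integrable dA (\<lambda>z. norm (g z) * \<omega> (norm z))"
proof -
  have "eventually (\<lambda>r::real. 0 < r \<and> r < 1) (at_left 1)"
    using eventually_at_left_real[of 0 1] by simp
  moreover have "eventually (\<lambda>r. integrable dA (\<lambda>z. zpow 0 (of_real r * z) * cnj (g z) * of_real (\<omega> (norm z)))) (at_left 1)"
    using assms by (simp add: has_pairing_def)
  ultimately have "eventually (\<lambda>r::real. integrable dA (\<lambda>z. cnj (g z) * of_real (\<omega> (norm z)))) (at_left 1)"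
  proof eventually_elim
    case (elim r)
    have "zpow 0 (of_real r * z) = 1" if "z \<in> \<bbbD>" for z
      using norm_of_real_mult_less[of r z] elim that by (simp add: zpow_def)
    with elim(2) show ?case
      by (auto elim!: Bochner_Integration.integrable_cong[THEN iffD1, rotated 2])
  qed
  then have "integrable dA (\<lambda>z. cnj (g z) * of_real (\<omega> (norm z)))" by simp
  then have "integrable dA (\<lambda>z. g z * of_real (\<omega> (norm z)))"
    using complex_integrable_cnj[of dA "\<lambda>z. g z * of_real (\<omega> (norm z))"] by simp
  then show ?thesis using integrable_norm_weight_iff assms(2) by blast
qed

text \<open>A representing function is determined by the values of the functional on monomials; this
  gives uniqueness and the formula for the candidate. The pairing with \<open>zpow 0\<close>
  supplies the integrability that \<open>monomial_pairing\<close> asks for.\<close>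

lemma has_pairing_zpow:
  assumes \<beta>: "disc_conv \<beta>" and p0: "has_pairing \<omega> (zpow 0) (pser \<beta>) l0"
    and p: "has_pairing \<omega> (zpow n) (pser \<beta>) l"
  shows "\<beta> n = cnj l / of_real (2 * mu (2 * n + 1))"
proof -
  note g = has_pairing_integrable[OF p0 borel_measurable_dA_pser[OF \<beta>]]
  have ev: "eventually (\<lambda>r::real. 0 < r \<and> r < 1) (at_left 1)"
    using eventually_at_left_real[of 0 1] by simp
  have "eventually (\<lambda>r. (LINT z|dA. zpow n (of_real r * z) * cnj (pser \<beta> z) * of_real (\<omega> (norm z))) =
     of_real r ^ n * (of_real (2 * mu (2 * n + 1)) * cnj (\<beta> n))) (at_left 1)"
    using ev
  proof eventually_elim
    case (elim r)
    have "zpow n (of_real r * z) = of_real r ^ n * z ^ n" if "z \<in> \<bbbD>" for z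
      using norm_of_real_mult_less[of r z] elim that by (simp add: zpow_def power_mult_distrib)
    then have "(LINT z|dA. zpow n (of_real r * z) * cnj (pser \<beta> z) * of_real (\<omega> (norm z))) =
      (LINT z|dA. of_real r ^ n * (z ^ n * (cnj (pser \<beta> z) * of_real (\<omega> (norm z)))))"
      by (intro Bochner_Integration.integral_cong) (auto simp: mult.assoc)
    also have "\<dots> = of_real r ^ n * (LINT z|dA. z ^ n * (cnj (pser \<beta> z) * of_real (\<omega> (norm z))))"
      by (rule integral_mult_right_zero)
    finally show ?case by (simp only: monomial_pairing[OF \<beta> g])
  qed
  moreover have "((\<lambda>r. LINT z|dA. zpow n (of_real r * z) * cnj (pser \<beta> z) * of_real (\<omega> (norm z))) \<longlongrightarrow> l) (at_left 1)"
    using p by (simp add: has_pairing_def)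
  ultimately have "((\<lambda>r. of_real r ^ n * (of_real (2 * mu (2 * n + 1)) * cnj (\<beta> n))) \<longlongrightarrow> l) (at_left (1::real))"
    using tendsto_cong by fast
  moreover have "((\<lambda>r. of_real r ^ n * (of_real (2 * mu (2 * n + 1)) * cnj (\<beta> n))) \<longlongrightarrow>
      of_real 1 ^ n * (of_real (2 * mu (2 * n + 1)) * cnj (\<beta> n))) (at_left (1::real))"
    by (intro tendsto_intros)
  ultimately have "l = of_real (2 * mu (2 * n + 1)) * cnj (\<beta> n)"
    using tendsto_unique[OF trivial_limit_at_left_real] by force
  then show ?thesis using mu_pos[of "2 * n + 1"] by (simp del: of_nat_add of_nat_mult)
qed

end

section \<open>Linear functionals on rapidly convergent power series\<close>

lemma pser_linear:
  assumes "disc_conv \<alpha>" "disc_conv \<beta>"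
  shows "pser (\<lambda>n. a * \<alpha> n + b * \<beta> n) = (\<lambda>z. a * pser \<alpha> z + b * pser \<beta> z)"
proof
  fix z :: complex
  show "pser (\<lambda>n. a * \<alpha> n + b * \<beta> n) z = a * pser \<alpha> z + b * pser \<beta> z"
  proof (cases "z \<in> \<bbbD>")
    case True
    then have z: "norm z < 1" by simp
    have "(\<lambda>n. a * (\<alpha> n * z ^ n) + b * (\<beta> n * z ^ n)) sums (a * pser \<alpha> z + b * pser \<beta> z)"
      using pser_sums[OF assms(1) z] pser_sums[OF assms(2) z] by (intro sums_add sums_mult)
    then have "(\<lambda>n. (a * \<alpha> n + b * \<beta> n) * z ^ n) sums (a * pser \<alpha> z + b * pser \<beta> z)"
      by (simp add: algebra_simps)
    then show ?thesis using True by (simp add: pser_def sums_iff)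
  qed (simp add: pser_def)
qed

lemma fast_linear:
  assumes "fast \<alpha>" "fast \<beta>" shows "fast (\<lambda>n. a * \<alpha> n + b * \<beta> n)"
  unfolding fast_def
proof (rule summable_comparison_test'[where N = 0])
  show "summable (\<lambda>n. norm a * (real (Suc n) * norm (\<alpha> n)) + norm b * (real (Suc n) * norm (\<beta> n)))"
    using assms unfolding fast_def by (intro summable_add summable_mult)
  fix n
  have "norm (a * \<alpha> n + b * \<beta> n) \<le> norm a * norm (\<alpha> n) + norm b * norm (\<beta> n)"
    using norm_triangle_ineq[of "a * \<alpha> n" "b * \<beta> n"] by (simp add: norm_mult)
  from mult_left_mono[OF this, of "real (Suc n)"]
  show "norm (real (Suc n) * norm (a * \<alpha> n + b * \<beta> n)) \<le>
      norm a * (real (Suc n) * norm (\<alpha> n)) + norm b * (real (Suc n) * norm (\<beta> n))"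
    by (simp add: algebra_simps)
qed

text \<open>The partial sums converge in the norm that weights the n-th coefficient by n + 1, and L
  is continuous for that norm. The space \<open>X\<close> is left abstract because both A^1 and the
  little Bloch space dominate their norms in this way.\<close>

lemma functional_sums:
  assumes lin: "\<And>f g a b. f \<in> X \<Longrightarrow> g \<in> X \<Longrightarrow> L (\<lambda>z. a * f z + b * g z) = a * L f + b * L g"
    and X: "\<And>\<alpha>. fast \<alpha> \<Longrightarrow> pser \<alpha> \<in> X"
    and bd: "\<And>\<alpha>. fast \<alpha> \<Longrightarrow> norm (L (pser \<alpha>)) \<le> K * (\<Sum>n. real (Suc n) * norm (\<alpha> n))"
    and \<alpha>: "fast \<alpha>"
  shows "(\<lambda>n. \<alpha> n * L (zpow n)) sums (L (pser \<alpha>) :: complex)"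
proof -
  have zpowX: "zpow n \<in> X" for n unfolding zpow_eq_pser by (intro X fast_single)
  let ?t = "\<lambda>N n. if n < N then \<alpha> n else 0"
  have part: "L (pser (?t N)) = (\<Sum>n<N. \<alpha> n * L (zpow n))" for N
  proof (induction N)
    case 0
    have "pser (?t 0) = (\<lambda>z. 0 * zpow 0 z + 0 * zpow 0 z)" by (simp add: pser_def fun_eq_iff)
    then show ?case using lin[OF zpowX zpowX, of 0 0 0 0] by simp
  next
    case (Suc N)
    have "pser (?t (Suc N)) = (\<lambda>z. 1 * pser (?t N) z + \<alpha> N * zpow N z)"
      unfolding fun_eq_iff pser_finite by simp
    then have "L (pser (?t (Suc N))) = 1 * L (pser (?t N)) + \<alpha> N * L (zpow N)"
      by (simp only: lin[OF X[OF fast_finite] zpowX])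
    then show ?case using Suc by simp
  qed
  let ?S = "\<lambda>n. real (Suc n) * norm (\<alpha> n)"
  have sS: "summable ?S" using \<alpha> by (simp add: fast_def)
  have "norm ((\<Sum>n<N. \<alpha> n * L (zpow n)) - L (pser \<alpha>)) \<le> K * (suminf ?S - sum ?S {..<N})" for N
  proof -
    let ?d = "\<lambda>n. 1 * \<alpha> n + (-1) * ?t N n"
    have d: "fast ?d" by (rule fast_linear[OF \<alpha> fast_finite])
    have "L (pser ?d) = L (pser \<alpha>) - L (pser (?t N))"
      unfolding pser_linear[OF fast_imp_disc_conv[OF \<alpha>] fast_imp_disc_conv[OF fast_finite]]
      by (subst lin[OF X[OF \<alpha>] X[OF fast_finite]]) simp
    then have "norm ((\<Sum>n<N. \<alpha> n * L (zpow n)) - L (pser \<alpha>)) = norm (L (pser ?d))"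
      by (simp add: part norm_minus_commute)
    also have "\<dots> \<le> K * (\<Sum>n. real (Suc n) * norm (?d n))" by (rule bd[OF d])
    also have "(\<Sum>n. real (Suc n) * norm (?d n)) = (\<Sum>n. ?S n - (if n \<in> {..<N} then ?S n else 0))"
      by (intro arg_cong[where f = suminf] ext) auto
    also have "\<dots> = suminf ?S - sum ?S {..<N}"
      using sums_diff[OF summable_sums[OF sS] sums_If_finite_set[of "{..<N}" ?S]] by (simp add: sums_iff)
    finally show ?thesis .
  qed
  then have bound: "\<forall>N. norm ((\<Sum>n<N. \<alpha> n * L (zpow n)) - L (pser \<alpha>)) \<le> K * (suminf ?S - sum ?S {..<N})"
    by blast
  have "(\<lambda>N. sum ?S {..<N}) \<longlonglongrightarrow> suminf ?S" by (rule summable_LIMSEQ[OF sS])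
  then have "(\<lambda>N. K * (suminf ?S - sum ?S {..<N})) \<longlonglongrightarrow> K * (suminf ?S - suminf ?S)"
    by (intro tendsto_mult tendsto_diff tendsto_const)
  then have "(\<lambda>N. K * (suminf ?S - sum ?S {..<N})) \<longlonglongrightarrow> 0"
    by (simp only: diff_self mult_zero_right)
  from Lim_null_comparison[OF always_eventually[OF bound] this]
  show ?thesis unfolding sums_def by (rule Lim_null[THEN iffD2])
qed

subsection \<open>Duals and the Bloch space\<close>

text \<open>The supremum in \<open>dual_norm\<close> is one of reals and says something only for a
  set that is bounded above; the constant K of \<open>dual_space\<close> provides the bound, with
  its modulus because its sign is not prescribed. A function with \<open>N f = 0\<close> cannot be
  normalized, but then K gives \<open>L f = 0\<close>.\<close>

lemma norm_le_dual_norm: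
  assumes L: "L \<in> dual_space X N" and f: "f \<in> X"
    and scale: "\<And>a. (\<lambda>z. a * f z) \<in> X" and hom: "\<And>a. N (\<lambda>z. a * f z) \<le> norm a * N f"
    and nn: "\<And>g. g \<in> X \<Longrightarrow> 0 \<le> N g"
  shows "norm (L f) \<le> dual_norm X N L * N f"
proof -
  from L obtain K where K: "\<And>g. g \<in> X \<Longrightarrow> norm (L g) \<le> K * N g"
    and lin: "\<And>f g a b. f \<in> X \<Longrightarrow> g \<in> X \<Longrightarrow> L (\<lambda>z. a * f z + b * g z) = a * L f + b * L g"
    unfolding dual_space_def by blast
  show ?thesis
  proof (cases "N f = 0")
    case True
    then show ?thesis using K[OF f] by simp
  next
    case False
    then have Nf: "0 < N f" using nn[OF f] by simp
    let ?a = "of_real (1 / N f) :: complex"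
    have "N (\<lambda>z. ?a * f z) \<le> 1"
      using hom[of ?a] Nf by (simp add: norm_divide)
    moreover have "bdd_above ((\<lambda>f. norm (L f)) ` {f \<in> X. N f \<le> 1})"
    proof (intro bdd_aboveI2)
      fix g assume "g \<in> {f \<in> X. N f \<le> 1}"
      then have g: "g \<in> X" "N g \<le> 1" by auto
      have "norm (L g) \<le> \<bar>K\<bar> * N g"
        using K[OF g(1)] mult_right_mono[OF abs_ge_self nn[OF g(1)], of K] by linarith
      also have "\<dots> \<le> \<bar>K\<bar> * 1" using g by (intro mult_left_mono) auto
      finally show "norm (L g) \<le> \<bar>K\<bar>" by simp
    qed
    ultimately have "norm (L (\<lambda>z. ?a * f z)) \<le> dual_norm X N L"
      unfolding dual_norm_def by (intro cSUP_upper) (use scale[of ?a] in auto)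
    moreover have "L (\<lambda>z. ?a * f z) = ?a * L f" using lin[OF f f, of ?a 0] by simp
    ultimately have "norm (L f) / N f \<le> dual_norm X N L"
      using Nf by (simp add: norm_mult norm_divide)
    then show ?thesis using Nf by (simp add: field_simps)
  qed
qed

lemma dual_norm_le:
  assumes "\<And>f. f \<in> X \<Longrightarrow> norm (L f) \<le> M * N f" "0 \<le> M" "f0 \<in> X" "N f0 \<le> 1"
  shows "dual_norm X N L \<le> M"
  unfolding dual_norm_def
proof (rule cSUP_least)
  show "{f \<in> X. N f \<le> 1} \<noteq> {}" using assms by auto
  fix f assume "f \<in> {f \<in> X. N f \<le> 1}"
  then show "norm (L f) \<le> M" using assms(1)[of f] mult_left_mono[of "N f" 1 M] assms(2) by auto
qed

lemma one_minus_norm_square_nonneg: "norm z < 1 \<Longrightarrow> 0 \<le> 1 - (norm z)\<^sup>2" for z :: complex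
  using power_le_one[of "norm z" 2] by simp

lemma
  assumes "f \<in> hol_disc" "\<And>z. norm z < 1 \<Longrightarrow> norm (deriv f z) * (1 - (norm z)\<^sup>2) \<le> M"
  shows blochI: "f \<in> bloch" and bloch_norm_le: "bloch_norm f \<le> M + norm (f 0)"
proof -
  show "f \<in> bloch" using assms by (auto simp: bloch_def intro!: bdd_aboveI2)
  have "(SUP z\<in>\<bbbD>. norm (deriv f z) * (1 - (norm z)\<^sup>2)) \<le> M"
    by (rule cSUP_least) (use assms(2) in auto)
  then show "bloch_norm f \<le> M + norm (f 0)" by (simp add: bloch_norm_def)
qed

lemma bloch_norm_ge:
  assumes "f \<in> bloch" "norm z < 1"
  shows "norm (deriv f z) * (1 - (norm z)\<^sup>2) + norm (f 0) \<le> bloch_norm f"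
  using assms cSUP_upper[of z \<bbbD> "\<lambda>z. norm (deriv f z) * (1 - (norm z)\<^sup>2)"]
  by (simp add: bloch_def bloch_norm_def)

lemma bloch_norm_nonneg: assumes "f \<in> bloch" shows "0 \<le> bloch_norm f"
proof -
  have "0 \<le> norm (deriv f 0) * (1 - (norm (0::complex))\<^sup>2) + norm (f 0)" by simp
  also have "\<dots> \<le> bloch_norm f" by (rule bloch_norm_ge[OF assms]) simp
  finally show ?thesis .
qed

lemma hol_disc_linear: "f \<in> hol_disc \<Longrightarrow> g \<in> hol_disc \<Longrightarrow> (\<lambda>z. a * f z + b * g z) \<in> hol_disc"
  by (auto simp: hol_disc_def intro!: holomorphic_intros)

lemma hol_disc_differentiable: "f \<in> hol_disc \<Longrightarrow> norm z < 1 \<Longrightarrow> f field_differentiable at z"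
  using holomorphic_on_imp_differentiable_at[of f \<bbbD> z] by (simp add: hol_disc_def)

lemma deriv_linear:
  assumes "f \<in> hol_disc" "g \<in> hol_disc" "norm z < 1"
  shows "deriv (\<lambda>z. a * f z + b * g z) z = a * deriv f z + b * deriv g z"
  using hol_disc_differentiable[OF assms(1,3)] hol_disc_differentiable[OF assms(2,3)]
  by (simp add: field_differentiable_mult)

lemma norm_deriv_linear_le:
  assumes "f \<in> bloch" "g \<in> bloch" "norm z < 1"
  shows "norm (deriv (\<lambda>z. a * f z + b * g z) z) * (1 - (norm z)\<^sup>2) \<le>
    norm a * (norm (deriv f z) * (1 - (norm z)\<^sup>2)) + norm b * (norm (deriv g z) * (1 - (norm z)\<^sup>2))"
proof -
  have "norm (deriv (\<lambda>z. a * f z + b * g z) z) \<le> norm a * norm (deriv f z) + norm b * norm (deriv g z)"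
    using assms norm_triangle_ineq[of "a * deriv f z" "b * deriv g z"]
    by (simp add: deriv_linear bloch_def norm_mult)
  from mult_right_mono[OF this one_minus_norm_square_nonneg[OF assms(3)]]
  show ?thesis by (simp add: algebra_simps)
qed

lemma bloch_norm_scale:
  assumes "f \<in> bloch" shows "bloch_norm (\<lambda>z. a * f z) \<le> norm a * bloch_norm f"
proof -
  have h: "f \<in> hol_disc" using assms by (simp add: bloch_def)
  have "norm (deriv (\<lambda>z. a * f z) z) * (1 - (norm z)\<^sup>2) \<le> norm a * (bloch_norm f - norm (f 0))"
    if "norm z < 1" for z
    using norm_deriv_linear_le[OF assms assms that, of a 0]
      mult_left_mono[OF bloch_norm_ge[OF assms that], of "norm a"]
    by (simp add: algebra_simps)
  from bloch_norm_le[OF hol_disc_linear[OF h h, of a 0, simplified] this]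
  show ?thesis by (simp add: algebra_simps norm_mult)
qed

lemma little_bloch_iff:
  "f \<in> little_bloch \<longleftrightarrow> f \<in> hol_disc \<and>
    (\<forall>e>0. \<exists>R. 0 < R \<and> R < 1 \<and> (\<forall>z. R \<le> norm z \<and> norm z < 1 \<longrightarrow> norm (deriv f z) * (1 - (norm z)\<^sup>2) < e))"
proof -
  have n: "norm (deriv f z * of_real (1 - (norm z)\<^sup>2)) = norm (deriv f z) * (1 - (norm z)\<^sup>2)" if "norm z < 1" for z
    using one_minus_norm_square_nonneg[OF that] by (simp only: norm_mult norm_of_real abs_of_nonneg)
  have "((\<lambda>z. deriv f z * of_real (1 - (norm z)\<^sup>2)) \<longlongrightarrow> 0) (filtercomap norm (at_left 1)) \<longleftrightarrow>
    (\<forall>e>0. \<exists>R. 0 < R \<and> R < 1 \<and> (\<forall>z. R \<le> norm z \<and> norm z < 1 \<longrightarrow> norm (deriv f z) * (1 - (norm z)\<^sup>2) < e))"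
    unfolding tendsto_iff dist_0_norm eventually_filtercomap
  proof (intro all_cong1 imp_cong refl)
    fix e :: real
    show "(\<exists>Q. eventually Q (at_left 1) \<and> (\<forall>x. Q (norm x) \<longrightarrow> dist (deriv f x * of_real (1 - (norm x)\<^sup>2)) 0 < e)) \<longleftrightarrow>
      (\<exists>R. 0 < R \<and> R < 1 \<and> (\<forall>z. R \<le> norm z \<and> norm z < 1 \<longrightarrow> norm (deriv f z) * (1 - (norm z)\<^sup>2) < e))"
    proof safe
      fix Q assume Q: "eventually Q (at_left 1)" "\<forall>x. Q (norm x) \<longrightarrow> dist (deriv f x * of_real (1 - (norm x)\<^sup>2)) 0 < e"
      then obtain b where b: "b < 1" "\<And>y. b < y \<Longrightarrow> y < 1 \<Longrightarrow> Q y"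
        using eventually_at_left[of 0 1 Q] by auto
      show "\<exists>R. 0 < R \<and> R < 1 \<and> (\<forall>z. R \<le> norm z \<and> norm z < 1 \<longrightarrow> norm (deriv f z) * (1 - (norm z)\<^sup>2) < e)"
      proof (intro exI[of _ "(max b 0 + 1) / 2"] conjI allI impI)
        fix z :: complex assume z: "(max b 0 + 1) / 2 \<le> norm z \<and> norm z < 1"
        moreover have "b \<le> max b 0" "0 \<le> max b 0" by simp_all
        ultimately have "b < norm z" using b(1) by argo
        then have "dist (deriv f z * of_real (1 - (norm z)\<^sup>2)) 0 < e" using Q(2) b(2)[of "norm z"] z by blast
        then show "norm (deriv f z) * (1 - (norm z)\<^sup>2) < e" using z n[of z] by (simp only: norm_conv_dist[symmetric])
      qed (use b in auto)
    next
      fix R :: real assume R: "0 < R" "R < 1"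
        "\<forall>z. R \<le> norm z \<and> norm z < 1 \<longrightarrow> norm (deriv f z) * (1 - (norm z)\<^sup>2) < e"
      show "\<exists>Q. eventually Q (at_left 1) \<and> (\<forall>x. Q (norm x) \<longrightarrow> dist (deriv f x * of_real (1 - (norm x)\<^sup>2)) 0 < e)"
      proof (intro exI[of _ "\<lambda>y. R < y \<and> y < 1"] conjI allI impI)
        show "eventually (\<lambda>y. R < y \<and> y < 1) (at_left 1)"
          using eventually_at_left_real[OF R(2)] by simp
        fix x :: complex assume "R < norm x \<and> norm x < 1"
        then show "dist (deriv f x * of_real (1 - (norm x)\<^sup>2)) 0 < e"
          using R(3) n[of x] by (simp only: norm_conv_dist[symmetric]) auto
      qed
    qed
  qed
  then show ?thesis unfolding little_bloch_def by blast
qed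

lemma little_bloch_imp_hol_disc: "f \<in> little_bloch \<Longrightarrow> f \<in> hol_disc"
  by (simp add: little_bloch_iff)

lemma little_bloch_obtain:
  assumes "f \<in> little_bloch" "0 < e"
  obtains R where "0 < R" "R < 1" "\<And>z. R \<le> norm z \<Longrightarrow> norm z < 1 \<Longrightarrow> norm (deriv f z) * (1 - (norm z)\<^sup>2) < e"
  using assms(1)[unfolded little_bloch_iff, THEN conjunct2, rule_format, OF assms(2)] that by metis

lemma hol_disc_deriv_continuous: "f \<in> hol_disc \<Longrightarrow> R < 1 \<Longrightarrow> continuous_on (cball 0 R) (deriv f)"
proof -
  assume f: "f \<in> hol_disc" and R: "R < 1"
  have "deriv f holomorphic_on \<bbbD>" using f by (simp add: hol_disc_def holomorphic_deriv)
  then show ?thesis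
    by (intro continuous_on_subset[OF holomorphic_on_imp_continuous_on]) (use R in auto)
qed

lemma hol_disc_deriv_bounded:
  assumes "f \<in> hol_disc" "R < 1"
  obtains M where "0 \<le> M" "\<And>z. norm z \<le> R \<Longrightarrow> norm (deriv f z) \<le> M"
proof -
  have "compact (deriv f ` cball 0 R)"
    by (intro compact_continuous_image hol_disc_deriv_continuous assms compact_cball)
  then have "bounded (deriv f ` cball 0 R)" by (rule compact_imp_bounded)
  then obtain M where "\<forall>x\<in>deriv f ` cball 0 R. norm x \<le> M" by (auto simp: bounded_iff)
  then have "norm (deriv f z) \<le> \<bar>M\<bar>" if "norm z \<le> R" for z
    using that abs_ge_self[of M] by force
  then show ?thesis using that[of "\<bar>M\<bar>"] abs_ge_zero by blast
qed

lemma little_bloch_subset_bloch: "little_bloch \<subseteq> bloch"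
proof
  fix f assume f: "f \<in> little_bloch"
  obtain R where R: "0 < R" "R < 1" "\<And>z. R \<le> norm z \<Longrightarrow> norm z < 1 \<Longrightarrow> norm (deriv f z) * (1 - (norm z)\<^sup>2) < 1"
    using little_bloch_obtain[OF f zero_less_one] by blast
  obtain M where M: "0 \<le> M" "\<And>z. norm z \<le> R \<Longrightarrow> norm (deriv f z) \<le> M"
    using hol_disc_deriv_bounded[OF little_bloch_imp_hol_disc[OF f] R(2)] by blast
  show "f \<in> bloch"
  proof (rule blochI[OF little_bloch_imp_hol_disc[OF f]])
    fix z :: complex assume z: "norm z < 1"
    show "norm (deriv f z) * (1 - (norm z)\<^sup>2) \<le> M + 1"
    proof (cases "R \<le> norm z")
      case True
      then show ?thesis using R(3)[OF True z] M(1) by linarith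
    next
      case False
      then have "norm (deriv f z) * (1 - (norm z)\<^sup>2) \<le> M * 1"
        using M z one_minus_norm_square_nonneg[OF z] by (intro mult_mono) auto
      then show ?thesis by simp
    qed
  qed
qed

lemma little_bloch_linear:
  assumes f: "f \<in> little_bloch" and g: "g \<in> little_bloch"
  shows "(\<lambda>z. a * f z + b * g z) \<in> little_bloch"
  unfolding little_bloch_iff
proof (intro conjI allI impI)
  note fb = subsetD[OF little_bloch_subset_bloch f] and gb = subsetD[OF little_bloch_subset_bloch g]
  show "(\<lambda>z. a * f z + b * g z) \<in> hol_disc"
    using assms by (intro hol_disc_linear little_bloch_imp_hol_disc)
  fix e :: real assume e: "0 < e"
  define d where "d = e / (2 * (norm a + norm b + 1))"
  have s: "0 < norm a + norm b + 1" using norm_ge_zero[of a] norm_ge_zero[of b] by linarith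
  then have d: "0 < d" using e by (simp add: d_def)
  obtain R where R: "0 < R" "R < 1" "\<And>z. R \<le> norm z \<Longrightarrow> norm z < 1 \<Longrightarrow> norm (deriv f z) * (1 - (norm z)\<^sup>2) < d"
    using little_bloch_obtain[OF f d] by blast
  obtain R' where R': "0 < R'" "R' < 1" "\<And>z. R' \<le> norm z \<Longrightarrow> norm z < 1 \<Longrightarrow> norm (deriv g z) * (1 - (norm z)\<^sup>2) < d"
    using little_bloch_obtain[OF g d] by blast
  show "\<exists>R. 0 < R \<and> R < 1 \<and> (\<forall>z. R \<le> norm z \<and> norm z < 1 \<longrightarrow>
    norm (deriv (\<lambda>z. a * f z + b * g z) z) * (1 - (norm z)\<^sup>2) < e)"
  proof (intro exI[of _ "max R R'"] conjI allI impI)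
    fix z :: complex assume z: "max R R' \<le> norm z \<and> norm z < 1"
    have "norm (deriv (\<lambda>z. a * f z + b * g z) z) * (1 - (norm z)\<^sup>2) \<le>
      norm a * (norm (deriv f z) * (1 - (norm z)\<^sup>2)) + norm b * (norm (deriv g z) * (1 - (norm z)\<^sup>2))"
      using z by (intro norm_deriv_linear_le fb gb) simp
    also have "\<dots> \<le> norm a * d + norm b * d"
      using R(3)[of z] R'(3)[of z] z by (intro add_mono mult_left_mono) (auto intro: less_imp_le)
    also have "\<dots> \<le> (norm a + norm b + 1) * d" using d by (simp add: algebra_simps)
    also have "\<dots> = e / 2"
    proof -
      have "x * (e / (2 * x)) = e / 2" if "0 < x" for x using that by simp
      from this[OF s] show ?thesis by (simp only: d_def)
    qed
    finally show "norm (deriv (\<lambda>z. a * f z + b * g z) z) * (1 - (norm z)\<^sup>2) < e" using e by linarith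
  qed (use R R' in auto)
qed

lemma one_minus_square_le: "r \<le> 1 \<Longrightarrow> 1 - r\<^sup>2 \<le> 2 * (1 - r)" for r :: real
  using zero_le_power2[of "1 - r"] by (simp add: power2_eq_square algebra_simps)

text \<open>The derivative is bounded on the disc, so its product with 1 - |z|^2 tends to 0 at the
  boundary. In the factor 2 one sum accounts for the derivative and one for the value at 0.\<close>

lemma
  assumes \<alpha>: "fast \<alpha>"
  shows fast_imp_little_bloch: "pser \<alpha> \<in> little_bloch"
    and bloch_norm_pser_le: "bloch_norm (pser \<alpha>) \<le> 2 * (\<Sum>n. real (Suc n) * norm (\<alpha> n))"
proof -
  define S where "S = (\<Sum>n. real (Suc n) * norm (\<alpha> n))"
  have S0: "0 \<le> S" unfolding S_def using \<alpha> by (intro suminf_nonneg) (auto simp: fast_def)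
  have dS: "norm (deriv (pser \<alpha>) z) * (1 - (norm z)\<^sup>2) \<le> S * (1 - (norm z)\<^sup>2)" if "norm z < 1" for z
    unfolding S_def by (intro mult_right_mono norm_deriv_pser_le \<alpha> that one_minus_norm_square_nonneg)
  have h: "pser \<alpha> \<in> hol_disc" by (intro pser_in_hol_disc fast_imp_disc_conv \<alpha>)
  show "pser \<alpha> \<in> little_bloch"
    unfolding little_bloch_iff
  proof (intro conjI allI impI h)
    fix e :: real assume e: "0 < e"
    define d where "d = min (1 / 2) (e / (2 * (S + 1)))"
    have d: "0 < d" "d < 1" using e S0 by (auto simp: d_def)
    have "d \<le> e / (2 * (S + 1))" by (simp add: d_def)
    then have d2: "d * (2 * (S + 1)) \<le> e" using S0 by (simp add: pos_le_divide_eq)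
    show "\<exists>R. 0 < R \<and> R < 1 \<and> (\<forall>z. R \<le> norm z \<and> norm z < 1 \<longrightarrow> norm (deriv (pser \<alpha>) z) * (1 - (norm z)\<^sup>2) < e)"
    proof (intro exI[of _ "1 - d"] conjI allI impI)
      fix z :: complex assume z: "1 - d \<le> norm z \<and> norm z < 1"
      have "norm (deriv (pser \<alpha>) z) * (1 - (norm z)\<^sup>2) \<le> S * (1 - (norm z)\<^sup>2)" using dS z by blast
      also have "\<dots> \<le> S * (2 * d)"
        using one_minus_square_le[of "norm z"] z S0 by (intro mult_left_mono) auto
      also have "\<dots> < e" using d d2 by (simp add: algebra_simps)
      finally show "norm (deriv (pser \<alpha>) z) * (1 - (norm z)\<^sup>2) < e" .
    qed (use d in auto)
  qed
  have "bloch_norm (pser \<alpha>) \<le> S + norm (pser \<alpha> 0)"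
  proof (rule bloch_norm_le[OF h])
    fix z :: complex assume z: "norm z < 1"
    have "S * (1 - (norm z)\<^sup>2) \<le> S * 1" using S0 by (intro mult_left_mono) auto
    then show "norm (deriv (pser \<alpha>) z) * (1 - (norm z)\<^sup>2) \<le> S" using dS[OF z] by simp
  qed
  also have "norm (pser \<alpha> 0) \<le> (\<Sum>n. norm (\<alpha> n))" by (intro norm_pser_le fast_imp_summable \<alpha>)
  also have "\<dots> \<le> S" unfolding S_def
    using \<alpha> by (intro suminf_le fast_imp_summable) (auto simp: fast_def mult_le_cancel_right1)
  finally show "bloch_norm (pser \<alpha>) \<le> 2 * (\<Sum>n. real (Suc n) * norm (\<alpha> n))" by (simp add: S_def)
qed

lemma
  assumes f: "f \<in> hol_disc" and r: "0 \<le> r" "r \<le> 1"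
  shows dil_hol_disc: "dil r f \<in> hol_disc"
    and deriv_dil: "norm z < 1 \<Longrightarrow> deriv (dil r f) z = of_real r * deriv f (of_real r * z)"
proof -
  obtain \<alpha> where \<alpha>: "disc_conv \<alpha>" "f = pser \<alpha>" using hol_disc_imp_pser[OF f] .
  show "dil r f \<in> hol_disc"
    unfolding \<alpha>(2) dil_pser[OF r] by (intro pser_in_hol_disc disc_conv_dil \<alpha> r)
  assume z: "norm z < 1"
  then have "(f has_field_derivative deriv f (of_real r * z)) (at (of_real r * z))"
    using f r norm_of_real_mult_less by (intro DERIV_deriv_iff_field_differentiable[THEN iffD2] hol_disc_differentiable)
  then have "((\<lambda>z. f (of_real r * z)) has_field_derivative deriv f (of_real r * z) * of_real r) (at z)"
    by (rule DERIV_chain2) (auto intro!: derivative_eq_intros)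
  then have "(dil r f has_field_derivative deriv f (of_real r * z) * of_real r) (at z)"
    by (rule has_field_derivative_transform_within_open[where S = \<bbbD>]) (use z in \<open>auto simp: dil_def\<close>)
  then show "deriv (dil r f) z = of_real r * deriv f (of_real r * z)"
    by (simp add: DERIV_imp_deriv mult.commute)
qed

lemma norm_of_real_mult_le: "0 \<le> r \<Longrightarrow> r \<le> 1 \<Longrightarrow> norm (complex_of_real r * z) \<le> norm z"
  by (simp add: norm_mult mult_left_le_one_le)

text \<open>Two effects point the same way: the chain rule gives a factor r \<le> 1, and the weight
  1 - |z|^2 grows towards the centre. Hence dilations contract the Bloch norm.\<close>

lemma norm_deriv_dil_le:
  assumes f: "f \<in> hol_disc" and r: "0 \<le> r" "r \<le> 1" and z: "norm z < 1"
  shows "norm (deriv (dil r f) z) * (1 - (norm z)\<^sup>2) \<le>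
    norm (deriv f (of_real r * z)) * (1 - (norm (of_real r * z))\<^sup>2)"
proof (rule mult_mono)
  show "norm (deriv (dil r f) z) \<le> norm (deriv f (of_real r * z))"
    using r by (simp add: deriv_dil[OF f r z] norm_mult mult_left_le_one_le)
  show "1 - (norm z)\<^sup>2 \<le> 1 - (norm (of_real r * z))\<^sup>2"
    using power_mono[OF norm_of_real_mult_le[OF r, of z] norm_ge_zero, of 2] by simp
qed (use one_minus_norm_square_nonneg[OF z] in auto)

lemma
  assumes f: "f \<in> bloch" and r: "0 \<le> r" "r \<le> 1"
  shows dil_bloch: "dil r f \<in> bloch"
    and bloch_norm_dil: "bloch_norm (dil r f) \<le> bloch_norm f"
proof -
  have h: "f \<in> hol_disc" using f by (simp add: bloch_def)
  have b: "norm (deriv (dil r f) z) * (1 - (norm z)\<^sup>2) \<le> bloch_norm f - norm (f 0)" if "norm z < 1" for z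
    using norm_deriv_dil_le[OF h r that] bloch_norm_ge[OF f norm_of_real_mult_less[OF r that]] by linarith
  show "dil r f \<in> bloch" using blochI[OF dil_hol_disc[OF h r]] b by blast
  show "bloch_norm (dil r f) \<le> bloch_norm f"
    using bloch_norm_le[OF dil_hol_disc[OF h r] b] by (simp add: dil_def)
qed

text \<open>Beyond radius Q both z and r * z lie where the weighted derivative of f is small, which
  is the little Bloch condition; inside, the derivative is uniformly continuous. The difference is
  written with the coefficients 1 and -1 to match the linearity clause of
  \<open>dual_space\<close>.\<close>

lemma little_bloch_dil_tendsto:
  assumes f: "f \<in> little_bloch"
  shows "((\<lambda>r. bloch_norm (\<lambda>z. 1 * dil r f z + (-1) * f z)) \<longlongrightarrow> 0) (at_left 1)"
  unfolding tendsto_iff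
proof (intro allI impI)
  fix e :: real assume e: "0 < e"
  note fb = subsetD[OF little_bloch_subset_bloch f] and h = little_bloch_imp_hol_disc[OF f]
  have e4: "0 < e / 4" using e by simp
  obtain R where R: "0 < R" "R < 1" "\<And>z. R \<le> norm z \<Longrightarrow> norm z < 1 \<Longrightarrow> norm (deriv f z) * (1 - (norm z)\<^sup>2) < e / 4"
    using little_bloch_obtain[OF f e4] by blast
  define Q where "Q = (1 + R) / 2"
  have Q: "0 < Q" "Q < 1" "R < Q" using R by (auto simp: Q_def)
  obtain M where M: "0 \<le> M" "\<And>z. norm z \<le> Q \<Longrightarrow> norm (deriv f z) \<le> M"
    using hol_disc_deriv_bounded[OF h Q(2)] by blast
  have "uniformly_continuous_on (cball 0 Q) (deriv f)"
    by (intro compact_uniformly_continuous hol_disc_deriv_continuous h Q compact_cball)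
  then obtain d where d: "0 < d" "\<And>x y. x \<in> cball 0 Q \<Longrightarrow> y \<in> cball 0 Q \<Longrightarrow> dist y x < d \<Longrightarrow> dist (deriv f y) (deriv f x) < e / 4"
    using e4 unfolding uniformly_continuous_on_def by blast
  \<comment> \<open>In this order the bounds give |r z - z| < d, then r * Q > R, then (1 - r) * M
    \<le> e / 4, and r > 0. The second one is possible because Q was taken strictly above R.\<close>
  define r0 where "r0 = Max {1 - d, R / Q, 1 - e / (4 * (M + 1)), 0}"
  have "r0 < 1" using d Q R e M by (auto simp: r0_def)
  then have "eventually (\<lambda>r. r0 < r \<and> r < 1) (at_left 1)"
    using eventually_at_left_real[of r0 1] by simp
  then show "eventually (\<lambda>r. dist (bloch_norm (\<lambda>z. 1 * dil r f z + (-1) * f z)) 0 < e) (at_left 1)"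
  proof eventually_elim
    case (elim r)
    have "Max {1 - d, R / Q, 1 - e / (4 * (M + 1)), 0} < r" using elim by (simp add: r0_def)
    then have r: "1 - d < r" "R / Q < r" "1 - e / (4 * (M + 1)) < r" "0 < r" by simp_all
    have r01: "0 \<le> r" "r \<le> 1" using r elim by auto
    have rR: "R < r * Q" using r(2) Q by (simp add: field_simps)
    have "1 - r < e / (4 * (M + 1))" using r(3) by linarith
    then have "(1 - r) * (4 * (M + 1)) < e" using M(1) by (simp add: pos_less_divide_eq)
    then have rM: "(1 - r) * M \<le> e / 4" using r01 by (simp add: algebra_simps)
    note dh = dil_hol_disc[OF h r01]
    note db = dil_bloch[OF fb r01]
    let ?g = "\<lambda>z. 1 * dil r f z + (-1) * f z"
    have gh: "?g \<in> hol_disc" by (rule hol_disc_linear[OF dh h])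
    have b: "norm (deriv ?g z) * (1 - (norm z)\<^sup>2) \<le> e / 2" if z: "norm z < 1" for z
    proof (cases "norm z \<le> Q")
      case False
      then have zQ: "Q \<le> norm z" by simp
      have "r * Q \<le> norm (of_real r * z)" using zQ r by (simp add: norm_mult)
      then have "norm (deriv f (of_real r * z)) * (1 - (norm (of_real r * z))\<^sup>2) < e / 4"
        using rR norm_of_real_mult_less[OF r01 z] by (intro R(3)) auto
      then have "norm (deriv (dil r f) z) * (1 - (norm z)\<^sup>2) \<le> e / 4"
        using norm_deriv_dil_le[OF h r01 z] by linarith
      moreover have "norm (deriv f z) * (1 - (norm z)\<^sup>2) < e / 4" using zQ Q z by (intro R(3)) auto
      ultimately show ?thesis using norm_deriv_linear_le[OF db fb z, of 1 "-1"] by simp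
    next
      case True
      let ?w = "of_real r * z"
      have w: "norm ?w \<le> Q" using norm_of_real_mult_le[OF r01, of z] True by linarith
      have "dist ?w z = (1 - r) * norm z"
      proof -
        have "?w - z = of_real (r - 1) * z" by (simp add: algebra_simps)
        then show ?thesis using r01 by (simp only: dist_norm norm_mult norm_of_real) simp
      qed
      also have "\<dots> \<le> (1 - r) * 1" using z r01 by (intro mult_left_mono) auto
      also have "\<dots> < d" using r by simp
      finally have cl: "norm (deriv f ?w - deriv f z) < e / 4"
        using d(2)[of z ?w] w True by (simp add: dist_norm)
      have "deriv ?g z = (deriv f ?w - deriv f z) - of_real (1 - r) * deriv f ?w"
        by (subst deriv_linear[OF dh h z]) (simp add: deriv_dil[OF h r01 z] algebra_simps)
      also have "norm \<dots> \<le> norm (deriv f ?w - deriv f z) + norm (of_real (1 - r) * deriv f ?w)"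
        by (rule norm_triangle_ineq4)
      also have "norm (of_real (1 - r) * deriv f ?w) \<le> (1 - r) * M"
        using M(2)[OF w] r01 by (simp only: norm_mult norm_of_real) (simp add: mult_left_mono)
      finally have "norm (deriv ?g z) \<le> e / 2" using cl rM by linarith
      moreover have "norm (deriv ?g z) * (1 - (norm z)\<^sup>2) \<le> norm (deriv ?g z) * 1"
        by (intro mult_left_mono) auto
      ultimately show ?thesis by linarith
    qed
    have "bloch_norm ?g \<le> e / 2 + norm (?g 0)" by (rule bloch_norm_le[OF gh b])
    also have "norm (?g 0) = 0" by (simp add: dil_def)
    finally have "bloch_norm ?g \<le> e / 2" by simp
    moreover have "0 \<le> bloch_norm ?g" by (intro bloch_norm_nonneg blochI[OF gh b])
    ultimately show ?case using e by simp
  qed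
qed

subsection \<open>The kernel estimate for doubling weights\<close>

text \<open>This is 1 + t \<le> exp t at t = r - 1; the companion \<open>exp_le_powr\<close> takes t
  = 1 / r - 1. Between them \<open>r powr x\<close> is compared with exp(-x (1 - r)) from both
  sides.\<close>

lemma powr_le_exp:
  fixes r :: real
  assumes "0 \<le> r" "0 \<le> x" shows "r powr x \<le> exp (- (x * (1 - r)))"
proof -
  have "r \<le> exp (- (1 - r))" using exp_ge_add_one_self[of "- (1 - r)"] by simp
  then have "r powr x \<le> exp (- (1 - r)) powr x" using assms by (intro powr_mono2) auto
  also have "exp (- (1 - r)) powr x = exp (- (x * (1 - r)))" by (simp only: exp_powr_real) (simp add: algebra_simps)
  finally show ?thesis .
qed

lemma exp_le_powr:
  fixes r :: real
  assumes "0 < r" "0 \<le> x" shows "exp (- (x * (1 / r - 1))) \<le> r powr x"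
proof -
  have "1 / r \<le> exp (1 / r - 1)" using exp_ge_add_one_self[of "1 / r - 1"] by simp
  then have "exp (- (1 / r - 1)) \<le> r" using assms by (simp add: exp_minus field_simps)
  then have "exp (- (1 / r - 1)) powr x \<le> r powr x" using assms by (intro powr_mono2) auto
  also have "exp (- (1 / r - 1)) powr x = exp (- (x * (1 / r - 1)))" by (simp only: exp_powr_real) (simp add: algebra_simps)
  finally show ?thesis .
qed

text \<open>Each of k doublings costs a factor A, whereas the exponent itself doubles each time. For
  k = 2 m the exponent is at least m * (m / 2), by (1 + m)^2 \<le> 2^(2 m), so the product is at
  most the m-th power of A^2 * exp(- m / 2), and m > 4 A^2 makes that base at most 1 / 2. Both
  directions between tails and moments rest on this.\<close>

lemma ex_power_mult_exp_small:
  fixes A :: real assumes "0 < A"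
  obtains k :: nat where "1 \<le> k" "A ^ k * exp (- ((2 ^ k - 1) / 2)) \<le> 1 / 2"
proof -
  obtain m0 :: nat where m0: "4 * A\<^sup>2 < real m0" using reals_Archimedean2 by blast
  define m where "m = Suc m0"
  have m: "1 \<le> m" "4 * A\<^sup>2 < real m" using m0 by (auto simp: m_def)
  define q where "q = A\<^sup>2 * exp (- (real m / 2))"
  have "2 * A\<^sup>2 \<le> exp (real m / 2)" using exp_ge_add_one_self[of "real m / 2"] m by linarith
  then have q: "0 \<le> q" "q \<le> 1 / 2" using assms by (auto simp: q_def exp_minus field_simps)
  have "1 + real m \<le> 2 ^ m" using Bernoulli_inequality[of 1 m] by simp
  then have "(1 + real m)\<^sup>2 \<le> (2 ^ m)\<^sup>2" by (intro power_mono) auto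
  then have "(1 + real m)\<^sup>2 \<le> 2 ^ (2 * m)" by (simp add: power_mult mult.commute flip: power_mult)
  then have "real m * (real m / 2) \<le> (2 ^ (2 * m) - 1) / 2"
    by (simp add: power2_eq_square algebra_simps)
  then have "A ^ (2 * m) * exp (- ((2 ^ (2 * m) - 1) / 2)) \<le> A ^ (2 * m) * exp (real m * (- (real m / 2)))"
    using assms by (intro mult_left_mono) auto
  also have "\<dots> = q ^ m" by (simp only: q_def power_mult power_mult_distrib exp_of_nat_mult)
  also have "\<dots> \<le> q ^ 1" using q m by (intro power_decreasing) auto
  also have "\<dots> \<le> 1 / 2" using q by simp
  finally show ?thesis using that[of "2 * m"] m by simp
qed

context weight
begin

text \<open>The coefficients of the Bergman kernel.\<close>

definition cf :: "nat \<Rightarrow> real" where "cf n = 1 / (2 * mu (2 * n + 1))"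

lemma cf_pos: "0 < cf n"
  using mu_pos[of "2 * n + 1"] by (simp add: cf_def del: of_nat_add of_nat_mult)

lemma disc_conv_cf: "disc_conv (\<lambda>n. of_real (cf n))"
  using disc_conv_inverse_moment by (simp add: cf_def del: of_nat_add of_nat_mult)

lemma tail_iterate:
  assumes C: "\<And>r. 0 \<le> r \<Longrightarrow> r < 1 \<Longrightarrow> tail r \<le> C * tail ((1 + r) / 2)" and "0 \<le> C" "0 \<le> r" "r < 1"
  shows "tail r \<le> C ^ j * tail (1 - (1 - r) / 2 ^ j)"
proof (induction j)
  case (Suc j)
  let ?s = "1 - (1 - r) / 2 ^ j"
  have "(1 - r) / 2 ^ j \<le> 1" using assms one_le_power[of "2::real" j] by (subst pos_divide_le_eq) (simp, linarith)
  then have s: "0 \<le> ?s" "?s < 1" using assms by (auto simp: diff_le_eq)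
  have "C ^ j * tail ?s \<le> C ^ j * (C * tail ((1 + ?s) / 2))"
    using C[OF s] assms by (intro mult_left_mono) auto
  also have "(1 + ?s) / 2 = 1 - (1 - r) / 2 ^ Suc j" by (simp add: field_simps)
  finally show ?case using Suc by (simp add: mult_ac)
qed simp

text \<open>Induction along \<open>x \<mapsto> N x\<close> with \<open>N = 2 ^ j\<close>: each step costs the factor \<open>C ^ j\<close> but gains
  \<open>exp (1 - N)\<close>, which wins for large \<open>j\<close>.\<close>

lemma D_hat_moment_le_tail:
  assumes C: "\<And>r. 0 \<le> r \<Longrightarrow> r < 1 \<Longrightarrow> tail r \<le> C * tail ((1 + r) / 2)" and C1: "1 \<le> C"
  obtains B where "0 < B" "\<And>x. 1 \<le> x \<Longrightarrow> moment \<omega> x \<le> B * tail (1 - 1 / x)"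
proof -
  obtain j :: nat where j: "1 \<le> j" "C ^ j * exp (- ((2 ^ j - 1) / 2)) \<le> 1 / 2"
    using ex_power_mult_exp_small[of C] C1 by auto
  define N :: real where "N = 2 ^ j"
  have N: "2 \<le> N" unfolding N_def using power_increasing[OF j(1), of "2::real"] by simp
  have tN: "0 < tail (1 - 1 / N)" using N by (intro tail_pos) auto
  have t0: "0 < tail 0" by (intro tail_pos) auto
  \<comment> \<open>The second term settles x \<le> N outright; the first makes
    \<open>C ^ j + 1 / 2 * B \<le> B\<close>, which closes the induction.\<close>
  define B where "B = 2 * C ^ j + tail 0 / tail (1 - 1 / N)"
  have Cj: "1 \<le> C ^ j" using C1 by (rule one_le_power)
  have B: "2 * C ^ j \<le> B" "tail 0 / tail (1 - 1 / N) \<le> B" "0 < B"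
    using tN t0 Cj by (auto simp: B_def intro!: add_pos_pos)
  have "\<forall>x. 1 \<le> x \<and> x \<le> N ^ k \<longrightarrow> moment \<omega> x \<le> B * tail (1 - 1 / x)" for k
  proof (induction k)
    case 0
    show ?case
    proof (intro allI impI)
      fix x :: real assume "1 \<le> x \<and> x \<le> N ^ 0"
      then have x: "x = 1" by simp
      have "moment \<omega> 1 \<le> tail 0" by (rule moment_le_tail_0) simp
      also have "\<dots> \<le> B * tail 0" using B Cj t0 by simp
      finally show "moment \<omega> x \<le> B * tail (1 - 1 / x)" by (simp add: x)
    qed
  next
    case (Suc k)
    show ?case
    proof (intro allI impI)
      fix x :: real assume x: "1 \<le> x \<and> x \<le> N ^ Suc k"
      have tx: "0 < tail (1 - 1 / x)" using x by (intro tail_pos) auto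
      show "moment \<omega> x \<le> B * tail (1 - 1 / x)"
      proof (cases "x \<le> N")
        case True
        have "moment \<omega> x \<le> tail 0 / tail (1 - 1 / N) * tail (1 - 1 / N)"
          using moment_le_tail_0[of x] x tN by simp
        also have "\<dots> \<le> B * tail (1 - 1 / x)"
          using B tN t0 x True by (intro mult_mono tail_antimono) (auto simp: field_simps)
        finally show ?thesis .
      next
        case False
        define y where "y = x / N"
        have y: "1 < y" "y \<le> N ^ k" "x = N * y" using False x N by (auto simp: y_def field_simps)
        have r: "0 \<le> 1 - 1 / y" "1 - 1 / y < 1" using y by auto
        have t: "tail (1 - 1 / y) \<le> C ^ j * tail (1 - 1 / x)"
          using tail_iterate[OF C _ r, of j] C1 y(1) by (simp add: y(3) N_def mult.commute)
        have yx: "y \<le> x" using y N mult_right_mono[of 1 N y] by simp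
        have "moment \<omega> x \<le> tail (1 - 1 / y) + (1 - 1 / y) powr (x - y) * moment \<omega> y"
          using r y yx by (intro moment_upper) auto
        also have "(1 - 1 / y) powr (x - y) \<le> exp (- ((x - y) * (1 - (1 - 1 / y))))"
          using r yx by (intro powr_le_exp) auto
        also have "(x - y) * (1 - (1 - 1 / y)) = N - 1" using y by (simp add: field_simps)
        also have "exp (- (N - 1)) \<le> exp (- ((2 ^ j - 1) / 2))" 
        proof -
          have "(N - 1) / 2 \<le> N - 1" using N by simp
          then show ?thesis by (simp only: N_def exp_le_cancel_iff neg_le_iff_le)
        qed
        finally have "moment \<omega> x \<le> tail (1 - 1 / y) + exp (- ((2 ^ j - 1) / 2)) * moment \<omega> y"
          using moment_pos[of y] y by (simp add: mult_right_mono)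
        also have "moment \<omega> y \<le> B * tail (1 - 1 / y)" using Suc y by simp
        finally have "moment \<omega> x \<le> tail (1 - 1 / y) + exp (- ((2 ^ j - 1) / 2)) * (B * tail (1 - 1 / y))"
          by (simp add: mult_left_mono)
        also have "\<dots> = (1 + exp (- ((2 ^ j - 1) / 2)) * B) * tail (1 - 1 / y)" by (simp add: algebra_simps)
        also have "\<dots> \<le> (1 + exp (- ((2 ^ j - 1) / 2)) * B) * (C ^ j * tail (1 - 1 / x))"
          using t B by (intro mult_left_mono) (auto intro: add_nonneg_nonneg)
        also have "\<dots> = (C ^ j + (C ^ j * exp (- ((2 ^ j - 1) / 2))) * B) * tail (1 - 1 / x)" by (simp add: algebra_simps)
        also have "\<dots> \<le> (C ^ j + 1 / 2 * B) * tail (1 - 1 / x)"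
          using j(2) B tx by (intro mult_right_mono add_left_mono) auto
        also have "\<dots> \<le> B * tail (1 - 1 / x)" using B tx by (intro mult_right_mono) auto
        finally show ?thesis .
      qed
    qed
  qed
  moreover have "\<exists>k. x \<le> N ^ k" for x
    using real_arch_pow[of N x] N by (auto intro: less_imp_le)
  ultimately have "\<And>x. 1 \<le> x \<Longrightarrow> moment \<omega> x \<le> B * tail (1 - 1 / x)" by blast
  then show ?thesis using that B(3) by blast
qed

text \<open>\<open>D_hat_moment_le_tail\<close> stops at the radius 1 - 1 / (n + 1). One doubling of
  the tail halves the distance to 1 and reaches \<rho> with (2 n + 1) (1 / \<rho> - 1) = 1, where
  the power 2 n + 1 is still at least 1 / e, so that \<open>moment_lower\<close> returns to a
  moment.\<close>

lemma D_hat_moment_doubling: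
  assumes C: "\<And>r. 0 \<le> r \<Longrightarrow> r < 1 \<Longrightarrow> tail r \<le> C * tail ((1 + r) / 2)" and C1: "1 \<le> C"
  obtains E where "0 < E" "\<And>n. mu (n + 1) \<le> E * mu (2 * n + 1)"
proof -
  obtain B where B: "0 < B" "\<And>x. 1 \<le> x \<Longrightarrow> moment \<omega> x \<le> B * tail (1 - 1 / x)"
    using D_hat_moment_le_tail[OF C C1] by blast
  have "mu (n + 1) \<le> B * C * exp 1 * mu (2 * n + 1)" for n
  proof -
    define \<rho> where "\<rho> = 1 - 1 / (2 * real n + 2)"
    have \<rho>: "0 < \<rho>" "\<rho> < 1" by (auto simp: \<rho>_def field_simps)
    have "real (2 * n + 1) * (1 / \<rho> - 1) = 1" by (simp add: \<rho>_def field_simps)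
    then have "exp (- 1) \<le> \<rho> powr real (2 * n + 1)" using exp_le_powr[OF \<rho>(1), of "real (2 * n + 1)"] by simp
    then have "exp (- 1) * tail \<rho> \<le> \<rho> powr real (2 * n + 1) * tail \<rho>"
      using tail_pos[of \<rho>] \<rho> by (intro mult_right_mono) auto
    also have "\<dots> \<le> mu (2 * n + 1)" using \<rho> by (intro moment_lower) auto
    finally have 1: "tail \<rho> \<le> exp 1 * mu (2 * n + 1)" by (simp add: exp_minus field_simps)
    have "mu (n + 1) \<le> B * tail (1 - 1 / real (n + 1))" by (rule B(2)) simp
    also have "\<dots> \<le> B * (C * tail ((1 + (1 - 1 / real (n + 1))) / 2))"
      using B(1) by (intro mult_left_mono C) (auto simp: field_simps)
    also have "(1 + (1 - 1 / real (n + 1))) / 2 = \<rho>" by (simp add: \<rho>_def field_simps)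
    also have "B * (C * tail \<rho>) \<le> B * (C * (exp 1 * mu (2 * n + 1)))"
      using B C1 1 by (intro mult_left_mono) auto
    finally show ?thesis by (simp add: mult.assoc)
  qed
  then show ?thesis using that[of "B * C * exp 1"] B(1) C1 by simp
qed

lemma
  assumes "0 < n"
  shows mu_eq: "mu n = (LINT s|lebesgue. indicator {0..<1} s * (s ^ n * \<omega> s))"
    and integrable_mu: "integrable lebesgue (\<lambda>s. indicator {0..<1} s * (s ^ n * \<omega> s))"
proof -
  have eq: "indicator {0..<1} s * (s powr real n * \<omega> s) = indicator {0..<1} s * (s ^ n * \<omega> s)" for s :: real
    using assms by (auto simp: indicator_def powr_realpow')
  show "mu n = (LINT s|lebesgue. indicator {0..<1} s * (s ^ n * \<omega> s))"
    unfolding LINT_indicator_moment eq ..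
  show "integrable lebesgue (\<lambda>s. indicator {0..<1} s * (s ^ n * \<omega> s))"
    using integrable_indicator_moment[of "real n"] by (simp add: eq)
qed

text \<open>Pointwise, n s^n (1 - s) \<le> 1 and 1 + s \<le> 2; this is integrated against s^(n+1)
  \<omega>(s). It controls the increments of the kernel coefficients in
  \<open>kd_bound\<close>.\<close>

lemma mult_moment_diff_le: "real n * (mu (2 * n + 1) - mu (2 * n + 3)) \<le> 2 * mu (n + 1)"
proof -
  let ?f = "\<lambda>k s. indicator {0..<1} s * (s ^ k * \<omega> s)"
  have i: "integrable lebesgue (?f (2 * n + 1))" "integrable lebesgue (?f (2 * n + 3))" "integrable lebesgue (?f (n + 1))"
    by (rule integrable_mu, simp)+
  have e: "mu (2 * n + 1) = integral\<^sup>L lebesgue (?f (2 * n + 1))" "mu (2 * n + 3) = integral\<^sup>L lebesgue (?f (2 * n + 3))"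
    "mu (n + 1) = integral\<^sup>L lebesgue (?f (n + 1))"
    by (rule mu_eq, simp)+
  have "real n * (mu (2 * n + 1) - mu (2 * n + 3)) = (LINT s|lebesgue. real n * (?f (2 * n + 1) s - ?f (2 * n + 3) s))"
    unfolding e integral_mult_right_zero Bochner_Integration.integral_diff[OF i(1,2)] ..
  also have "\<dots> \<le> (LINT s|lebesgue. 2 * (indicator {0..<1} s * (s ^ (n + 1) * \<omega> s)))"
  proof (rule integral_mono)
    fix s :: real
    show "real n * (indicator {0..<1} s * (s ^ (2 * n + 1) * \<omega> s) - indicator {0..<1} s * (s ^ (2 * n + 3) * \<omega> s))
       \<le> 2 * (indicator {0..<1} s * (s ^ (n + 1) * \<omega> s))"
    proof (cases "s \<in> {0..<1}")
      case True
      then have s: "0 \<le> s" "s < 1" and w: "0 \<le> \<omega> s" using weight_nonneg by auto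
      have "real n * s ^ n \<le> real (Suc n) * s ^ n" using s by (intro mult_right_mono) auto
      also have "\<dots> \<le> 1 / (1 - s)" by (rule Suc_mult_power_le[OF s])
      finally have "real n * s ^ n * (1 - s) \<le> 1" using s by (simp add: pos_le_divide_eq)
      moreover have "1 - s\<^sup>2 = (1 - s) * (1 + s)" by (simp add: power2_eq_square algebra_simps)
      moreover have "(real n * s ^ n * (1 - s)) * (1 + s) \<le> 1 * 2"
        using calculation(1) s by (intro mult_mono) auto
      ultimately have "real n * s ^ n * (1 - s\<^sup>2) \<le> 2" by (simp add: mult.assoc)
      then have "(real n * s ^ n * (1 - s\<^sup>2)) * (s ^ (n + 1) * \<omega> s) \<le> 2 * (s ^ (n + 1) * \<omega> s)"
        using s w by (intro mult_right_mono) auto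
      moreover have "(real n * s ^ n * (1 - s\<^sup>2)) * (s ^ (n + 1) * \<omega> s) =
        real n * (s ^ (2 * n + 1) * \<omega> s - s ^ (2 * n + 3) * \<omega> s)"
      proof -
        have "s ^ (2 * n + 1) = s ^ n * s ^ (n + 1)" "s ^ (2 * n + 3) = s ^ n * s ^ (n + 1) * s\<^sup>2"
          by (simp_all add: power2_eq_square numeral_3_eq_3 mult_2 flip: power_add)
        then show ?thesis by (simp only:) (simp add: algebra_simps)
      qed
      ultimately have "real n * (s ^ (2 * n + 1) * \<omega> s - s ^ (2 * n + 3) * \<omega> s) \<le> 2 * (s ^ (n + 1) * \<omega> s)"
        by (simp only:)
      then show ?thesis using True by (simp only: indicator_simps mult_1_left)
    qed simp
  next
    show "integrable lebesgue (\<lambda>s. real n * (?f (2 * n + 1) s - ?f (2 * n + 3) s))"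
      by (intro integrable_mult_right Bochner_Integration.integrable_diff i)
    show "integrable lebesgue (\<lambda>s. 2 * ?f (n + 1) s)"
      by (intro integrable_mult_right i)
  qed
  also have "\<dots> = 2 * mu (n + 1)" unfolding e integral_mult_right_zero ..
  finally show ?thesis .
qed

end

lemma fast_bound:
  assumes "fast \<alpha>" "\<And>n. norm (\<beta> n) \<le> K * norm (\<alpha> n)" shows "fast \<beta>"
  unfolding fast_def
proof (rule summable_comparison_test'[where N = 0])
  show "summable (\<lambda>n. K * (real (Suc n) * norm (\<alpha> n)))"
    using assms(1) unfolding fast_def by (rule summable_mult)
  fix n
  show "norm (real (Suc n) * norm (\<beta> n)) \<le> K * (real (Suc n) * norm (\<alpha> n))"
    using mult_left_mono[OF assms(2)[of n], of "real (Suc n)"] by (simp add: mult_ac del: of_nat_Suc)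
qed

lemma ex_dyadic:
  fixes s :: real
  assumes "0 \<le> s" "s < 1 - 1 / 2 ^ K"
  obtains k where "k < K" "1 - 1 / 2 ^ k \<le> s" "s < 1 - 1 / 2 ^ Suc k"
proof -
  have "\<exists>k<K. 1 - 1 / 2 ^ k \<le> s \<and> s < 1 - 1 / 2 ^ Suc k"
    using assms(2)
  proof (induction K)
    case 0
    then show ?case using assms(1) by simp
  next
    case (Suc K)
    then show ?case by (cases "s < 1 - 1 / 2 ^ K") (auto intro: less_SucI)
  qed
  then show ?thesis using that by blast
qed

context weight
begin

text \<open>The coefficients of \<open>z \<mapsto> \<partial> B\<^sub>a(z) / \<partial> (cnj a)\<close>, where \<open>B\<close> is the Bergman kernel: a function \<open>g\<close>
  representing a functional \<open>L\<close> satisfies \<open>cnj (deriv g a) = L (pser (ker a))\<close>.\<close>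

definition ker :: "complex \<Rightarrow> nat \<Rightarrow> complex"
  where "ker a n = of_nat n * cnj a ^ (n - 1) * of_real (cf n)"

lemma fast_ker:
  assumes "norm a < 1" shows "fast (ker a)"
proof -
  \<comment> \<open>The maximum keeps s positive, since the exponent n - 1 in \<open>ker\<close> is
    raised to n at the cost of 1 / s.\<close>
  define s where "s = max (norm a) (1 / 2)"
  have s: "0 < s" "s < 1" "norm a \<le> s" using assms by (auto simp: s_def)
  show ?thesis
  proof (rule fast_bound)
    show "fast (\<lambda>n. (of_nat (Suc n) * of_real (cf n)) * of_real s ^ n)"
      using s by (intro disc_conv_fast disc_conv_mult_Suc disc_conv_cf) auto
    fix n
    show "norm (ker a n) \<le> (1 / s) * norm (of_nat (Suc n) * complex_of_real (cf n) * of_real s ^ n)"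
    proof (cases n)
      case (Suc k)
      have "norm (ker a n) = real n * norm a ^ k * cf n"
        using cf_pos[of n] by (simp add: ker_def norm_mult norm_power Suc del: of_nat_Suc)
      also have "\<dots> \<le> real (Suc n) * s ^ k * cf n"
        using s cf_pos[of n] by (intro mult_right_mono mult_mono power_mono) auto
      also have "\<dots> = (1 / s) * (real (Suc n) * cf n * s ^ n)" using s by (simp add: Suc)
      also have "real (Suc n) * cf n * s ^ n = norm (of_nat (Suc n) * complex_of_real (cf n) * of_real s ^ n)"
        using s cf_pos[of n] by (simp add: norm_mult norm_power del: of_nat_Suc)
      finally show ?thesis .
    qed (use s in \<open>simp add: ker_def\<close>)
  qed
qed

text \<open>Monotone functions are Borel. The \<open>max 0 s\<close> keeps the argument nonnegative,
  where \<open>tail\<close> is known to be decreasing; at negative arguments it would involve values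
  of \<omega> off \<open>[0,1)\<close>.\<close>

lemma tail_measurable: "(\<lambda>s. tail (A * max 0 s)) \<in> borel_measurable borel" if "0 \<le> A"
proof -
  have "(\<lambda>s. - tail (A * max 0 s)) \<in> borel_measurable borel"
    using that by (intro borel_measurable_mono monoI le_imp_neg_le tail_antimono) (auto intro!: mult_left_mono)
  then have "(\<lambda>s. - (- tail (A * max 0 s))) \<in> borel_measurable borel"
    by (rule borel_measurable_uminus)
  then show ?thesis by simp
qed

lemma norm_square_tail_bound:
  assumes C: "\<And>r. 0 \<le> r \<Longrightarrow> r < 1 \<Longrightarrow> tail r \<le> C * tail ((1 + r) / 2)" and C1: "1 \<le> C"
    and d: "\<And>n. \<bar>d n\<bar> \<le> B * cf (Suc n)" "0 \<le> B" and r: "0 \<le> r" "r < 1"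
  shows "(\<Sum>n. (d n)\<^sup>2 * r ^ (2 * n)) \<le> (B * C\<^sup>2)\<^sup>2 * (4 / 3) ^ 6 / ((1 - r) * (tail r)\<^sup>2)"
proof -
  txt \<open>Two doublings compare the tails at \<open>r\<close> and \<open>\<rho>\<close>, while \<open>\<rho> ^ 4 \<ge> r\<close>, so the lower bound
    \<open>\<rho> ^ (2 n + 3) * tail \<rho>\<close> for the moments leaves a geometric series in \<open>r\<close>.\<close>
  define \<rho> where "\<rho> = (3 + r) / 4"
  have \<rho>: "3 / 4 \<le> \<rho>" "\<rho> < 1" "0 < \<rho>" using r by (auto simp: \<rho>_def)
  have T: "0 < tail \<rho>" "0 < tail r" using \<rho> r by (auto intro: tail_pos)
  have "tail r \<le> C\<^sup>2 * tail (1 - (1 - r) / 2\<^sup>2)" using C1 by (intro tail_iterate[OF C] r) auto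
  also have "1 - (1 - r) / 2\<^sup>2 = \<rho>" by (simp add: \<rho>_def field_simps)
  finally have TT: "tail r \<le> C\<^sup>2 * tail \<rho>" .
  have "1 + real 4 * (- ((1 - r) / 4)) \<le> (1 + (- ((1 - r) / 4))) ^ 4"
    using r by (intro Bernoulli_inequality) simp
  also have "1 + (- ((1 - r) / 4)) = \<rho>" by (simp add: \<rho>_def field_simps)
  finally have \<rho>4: "r \<le> \<rho> ^ 4" by (simp add: diff_divide_distrib)
  have tm: "(d n)\<^sup>2 * r ^ (2 * n) \<le> (B * C\<^sup>2)\<^sup>2 * (4 / 3) ^ 6 / (tail r)\<^sup>2 * r ^ n" for n
  proof -
    have "\<rho> powr real (2 * Suc n + 1) * tail \<rho> \<le> mu (2 * Suc n + 1)" using \<rho> by (intro moment_lower) auto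
    then have "\<rho> ^ (2 * Suc n + 1) * tail \<rho> \<le> mu (2 * Suc n + 1)" using \<rho>(3) by (simp only: powr_realpow)
    moreover have "0 < \<rho> ^ (2 * Suc n + 1) * tail \<rho>" using \<rho> T by simp
    ultimately have "cf (Suc n) \<le> 1 / (\<rho> ^ (2 * Suc n + 1) * tail \<rho>)"
      unfolding cf_def by (intro frac_le) linarith+
    also have "\<dots> = (1 / \<rho> ^ (2 * n + 3)) * (1 / tail \<rho>)" by (simp add: eval_nat_numeral)
    also have "\<dots> \<le> (1 / \<rho> ^ (2 * n + 3)) * (C\<^sup>2 / tail r)"
    proof (rule mult_left_mono)
      show "1 / tail \<rho> \<le> C\<^sup>2 / tail r" using TT T by (simp add: field_simps)
    qed (use \<rho> in simp)
    finally have "cf (Suc n) \<le> (1 / \<rho> ^ (2 * n + 3)) * (C\<^sup>2 / tail r)" .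
    then have "\<bar>d n\<bar> \<le> B * ((1 / \<rho> ^ (2 * n + 3)) * (C\<^sup>2 / tail r))"
      using d(1)[of n] mult_left_mono[OF _ d(2)] by fastforce
    then have "\<bar>d n\<bar>\<^sup>2 \<le> (B * ((1 / \<rho> ^ (2 * n + 3)) * (C\<^sup>2 / tail r)))\<^sup>2" by (intro power_mono) auto
    also have "\<dots> = (B * C\<^sup>2)\<^sup>2 / (tail r)\<^sup>2 * (1 / (\<rho> ^ (2 * n + 3))\<^sup>2)"
      by (simp add: power_mult_distrib power_divide)
    \<comment> \<open>The power \<rho>^(4n) is matched with r^n by \<open>\<rho>4\<close>; the six
      remaining factors are bounded through \<rho> \<ge> 3 / 4, hence
      \<open>(4 / 3) ^ 6\<close>.\<close>
    also have "(\<rho> ^ (2 * n + 3))\<^sup>2 = (\<rho> ^ 4) ^ n * \<rho> ^ 6"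
      by (simp flip: power_mult power_add)
    finally have "(d n)\<^sup>2 * r ^ (2 * n) \<le> (B * C\<^sup>2)\<^sup>2 / (tail r)\<^sup>2 * (1 / ((\<rho> ^ 4) ^ n * \<rho> ^ 6)) * r ^ (2 * n)"
      using r by (intro mult_right_mono) auto
    also have "\<dots> = (B * C\<^sup>2)\<^sup>2 / (tail r)\<^sup>2 * ((1 / \<rho>) ^ 6 * ((r * r) / \<rho> ^ 4) ^ n)"
      by (simp add: power_divide power_mult power_mult_distrib mult_2 power_add)
    also have "\<dots> \<le> (B * C\<^sup>2)\<^sup>2 / (tail r)\<^sup>2 * ((4 / 3) ^ 6 * r ^ n)"
    proof (intro mult_left_mono mult_mono power_mono)
      show "1 / \<rho> \<le> 4 / 3" using \<rho> by (simp add: field_simps)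
      have "r * r \<le> r * \<rho> ^ 4" using \<rho>4 r by (intro mult_left_mono) auto
      then show "r * r / \<rho> ^ 4 \<le> r" using \<rho> by (simp add: pos_divide_le_eq)
    qed (use r \<rho> in auto)
    finally show ?thesis by (simp add: mult_ac)
  qed
  have s: "summable (\<lambda>n. (B * C\<^sup>2)\<^sup>2 * (4 / 3) ^ 6 / (tail r)\<^sup>2 * r ^ n)"
    using r by (intro summable_mult summable_geometric) auto
  have nn: "norm ((d n)\<^sup>2 * r ^ (2 * n)) = (d n)\<^sup>2 * r ^ (2 * n)" for n using r by simp
  have "(\<Sum>n. (d n)\<^sup>2 * r ^ (2 * n)) \<le> (\<Sum>n. (B * C\<^sup>2)\<^sup>2 * (4 / 3) ^ 6 / (tail r)\<^sup>2 * r ^ n)"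
    by (intro suminf_le tm s summable_comparison_test'[OF s, of 0]) (simp only: nn tm)
  also have "\<dots> = (B * C\<^sup>2)\<^sup>2 * (4 / 3) ^ 6 / (tail r)\<^sup>2 * (1 / (1 - r))"
    using r by (subst suminf_mult) (auto simp: suminf_geometric intro: summable_geometric)
  finally show ?thesis by (simp add: mult.commute)
qed

text \<open>Below A the interval is cut at r_k = 1 - 2^(-k). Since A * s \<le> s, the denominator on
  the ring from r_k to r_(k+1) is at least 2^(-k-1) times the tail at r_(k+1), and doubling bounds
  the contribution by 4 C 2^k. These add up to at most 4 C 2^K, where 2^K \<le> 2 / (1 - A). Above A
  the denominator is at least (1 - A) times the tail at A, which contributes the remaining 2 / (1 -
  A).\<close>

lemma
  assumes C: "\<And>r. 0 \<le> r \<Longrightarrow> r < 1 \<Longrightarrow> tail r \<le> C * tail ((1 + r) / 2)" and C1: "1 \<le> C"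
    and A: "0 \<le> A" "A < 1"
  shows integrable_weight_over_tail: "integrable dA (\<lambda>z. \<omega> (norm z) / ((1 - A * norm z) * tail (A * norm z)))"
    and integral_weight_over_tail: "(LINT z|dA. \<omega> (norm z) / ((1 - A * norm z) * tail (A * norm z))) \<le> (8 * C + 2) / (1 - A)"
proof -
  define h where "h s = 1 / ((1 - A * max 0 s) * tail (A * max 0 s))" for s
  have TA: "0 < tail A" using A by (rule tail_pos)
  have As: "0 \<le> A * s" "A * s \<le> A" "A * s \<le> s" "A * s < 1" if "0 \<le> s" "s < 1" for s
    using A that mult_left_le[of s A] mult_left_le_one_le[of s A] by (auto simp: mult.commute)
  have hA: "h s \<le> 1 / ((1 - A) * tail A)" "0 \<le> h s" if s: "0 \<le> s" "s < 1" for s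
    using s As[OF s] A TA tail_pos[of "A * s"] tail_antimono[of "A * s" A]
    by (auto simp: h_def intro!: divide_left_mono mult_mono mult_pos_pos)
  have hm: "h \<in> borel_measurable borel"
    unfolding h_def using tail_measurable[OF A(1)]
    by (intro borel_measurable_divide borel_measurable_times borel_measurable_const) auto
  have hi: "set_integrable lebesgue {0..<1} (\<lambda>s. h s * \<omega> s)"
    by (rule set_integrable_mult_weight[OF hm, of "1 / ((1 - A) * tail A)"]) (use hA in auto)
  have eq: "h (norm z) * \<omega> (norm z) = \<omega> (norm z) / ((1 - A * norm z) * tail (A * norm z))" for z :: complex
    by (simp add: h_def)
  show "integrable dA (\<lambda>z. \<omega> (norm z) / ((1 - A * norm z) * tail (A * norm z)))"
    using integrable_dA_radial[OF hi] unfolding eq .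
  define r where "r k = 1 - 1 / (2::real) ^ k" for k
  have r: "0 \<le> r k" "r k < 1" for k using one_le_power[of "2::real" k] by (auto simp: r_def)
  have Tr: "0 < tail (r k)" for k by (intro tail_pos r)
  have TT: "tail (r k) \<le> C * tail (r (Suc k))" for k
    using C[OF r, of k] by (simp add: r_def field_simps)
  obtain k0 where k0: "r k0 \<le> A" "A < r (Suc k0)"
  proof -
    obtain K where "1 / (1 - A) < 2 ^ K" using real_arch_pow[of 2 "1 / (1 - A)"] by auto
    then have "A < 1 - 1 / 2 ^ K" using A by (simp add: field_simps)
    from ex_dyadic[OF A(1) this] show ?thesis using that unfolding r_def by blast
  qed
  define K where "K = Suc k0"
  have K: "A < r K" "2 ^ K \<le> 2 / (1 - A)" using k0 A by (auto simp: K_def r_def field_simps)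
  \<comment> \<open>The majorant uses \<open>{r k..<1}\<close> in place of the ring itself, because
    the integral of \<omega> over it is exactly \<open>tail (r k)\<close>.\<close>
  let ?G = "\<lambda>s. (\<Sum>k<K. (4 * 2 ^ k / tail (r (Suc k))) * (indicator {r k..<1} s * \<omega> s)) +
    (2 / ((1 - A) * tail A)) * (indicator {A..<1} s * \<omega> s)"
  have Gi: "integrable lebesgue ?G"
    by (intro Bochner_Integration.integrable_add Bochner_Integration.integrable_sum integrable_mult_right
      integrable_indicator_tail r A)
  have le: "indicator {0..<1} s * (2 * s * (h s * \<omega> s)) \<le> ?G s" for s
  proof (cases "s \<in> {0..<1}")
    case True
    then have s: "0 \<le> s" "s < 1" by auto
    have w: "0 \<le> \<omega> s" using s by (rule weight_nonneg)
    have sh: "2 * s * (h s * \<omega> s) \<le> 2 * (h s * \<omega> s)"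
      using s w hA(2)[OF s] by (intro mult_right_mono mult_nonneg_nonneg) auto
    have nn: "0 \<le> (4 * 2 ^ k / tail (r (Suc k))) * (indicator {r k..<1} s * \<omega> s)" for k
      using w Tr[of "Suc k"] by simp
    have nn': "0 \<le> (2 / ((1 - A) * tail A)) * (indicator {A..<1} s * \<omega> s)" using w TA A by simp
    show ?thesis
    proof (cases "A \<le> s")
      case As: True
      have "2 * (h s * \<omega> s) \<le> 2 * (1 / ((1 - A) * tail A) * \<omega> s)"
        using hA(1)[OF s] w by (intro mult_left_mono mult_right_mono) auto
      also have "\<dots> = (2 / ((1 - A) * tail A)) * (indicator {A..<1} s * \<omega> s)" using As s by simp
      also have "\<dots> \<le> ?G s" using nn by (simp add: sum_nonneg)
      finally show ?thesis using sh True by simp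
    next
      case False
      then have "s < 1 - 1 / 2 ^ K" using K by (simp add: r_def)
      from ex_dyadic[OF s(1) this] obtain k where k: "k < K" "r k \<le> s" "s < r (Suc k)"
        unfolding r_def by blast
      have "tail (r (Suc k)) \<le> tail (A * s)" using As[OF s] k by (intro tail_antimono) auto
      moreover have "1 / 2 ^ Suc k \<le> 1 - A * s" using As[OF s] k by (simp add: r_def)
      ultimately have "(1 / 2 ^ Suc k) * tail (r (Suc k)) \<le> (1 - A * s) * tail (A * s)"
        using As[OF s] Tr[of "Suc k"] by (intro mult_mono) auto
      moreover have "0 < (1 / 2 ^ Suc k) * tail (r (Suc k))" using Tr[of "Suc k"] by simp
      ultimately have "1 / ((1 - A * s) * tail (A * s)) \<le> 1 / ((1 / 2 ^ Suc k) * tail (r (Suc k)))"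
        by (intro frac_le) auto
      then have "h s \<le> 1 / ((1 / 2 ^ Suc k) * tail (r (Suc k)))" using s by (simp only: h_def max_absorb2)
      then have "2 * (h s * \<omega> s) \<le> 2 * (1 / ((1 / 2 ^ Suc k) * tail (r (Suc k))) * \<omega> s)"
        using w by (intro mult_left_mono mult_right_mono) auto
      also have "\<dots> = (4 * 2 ^ k / tail (r (Suc k))) * (indicator {r k..<1} s * \<omega> s)" using k s by simp
      also have "\<dots> \<le> (\<Sum>k<K. (4 * 2 ^ k / tail (r (Suc k))) * (indicator {r k..<1} s * \<omega> s))"
        using k by (intro member_le_sum nn) auto
      also have "\<dots> \<le> ?G s" using nn' by simp
      finally show ?thesis using sh True by simp
    qed
  next
    case False
    then have "indicator {r k..<1} s = (0::real)" "indicator {A..<1} s = (0::real)" for k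
      using r[of k] A by (auto simp: indicator_def)
    then show ?thesis using False by simp
  qed
  have "(LINT z|dA. \<omega> (norm z) / ((1 - A * norm z) * tail (A * norm z))) = (LINT s:{0..<1}|lebesgue. 2 * s * (h s * \<omega> s))"
    using integral_dA_radial[OF hi] unfolding eq .
  also have "\<dots> = (LINT s|lebesgue. indicator {0..<1} s * (2 * s * (h s * \<omega> s)))"
    by (simp add: set_lebesgue_integral_def)
  also have "\<dots> \<le> (LINT s|lebesgue. ?G s)"
  proof (rule integral_mono'[OF Gi le])
    fix s show "0 \<le> ?G s"
    proof (rule order_trans[OF _ le])
      show "0 \<le> indicator {0..<1} s * (2 * s * (h s * \<omega> s))"
        using hA(2)[of s] weight_nonneg[of s] by (auto simp: indicator_def)
    qed
  qed
  also have "\<dots> = (\<Sum>k<K. (4 * 2 ^ k / tail (r (Suc k))) * tail (r k)) + (2 / ((1 - A) * tail A)) * tail A"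
  proof -
    have i: "integrable lebesgue (\<lambda>s. c * (indicator {r k..<1} s * \<omega> s))"
      "integrable lebesgue (\<lambda>s. c * (indicator {A..<1} s * \<omega> s))" for c k
      by (intro integrable_mult_right integrable_indicator_tail r A)+
    show ?thesis
      by (simp only: Bochner_Integration.integral_add[OF Bochner_Integration.integrable_sum[OF i(1)] i(2)]
        Bochner_Integration.integral_sum[OF i(1)] integral_mult_right_zero LINT_indicator_tail)
  qed
  also have "\<dots> \<le> (\<Sum>k<K. 4 * C * 2 ^ k) + 2 / (1 - A)"
  proof (rule add_mono)
    show "(\<Sum>k<K. (4 * 2 ^ k / tail (r (Suc k))) * tail (r k)) \<le> (\<Sum>k<K. 4 * C * 2 ^ k)"
    proof (rule sum_mono)
      fix k
      have "(4 * 2 ^ k / tail (r (Suc k))) * tail (r k) \<le> (4 * 2 ^ k / tail (r (Suc k))) * (C * tail (r (Suc k)))"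
        using Tr[of "Suc k"] by (intro mult_left_mono TT) auto
      also have "\<dots> = 4 * C * 2 ^ k" using Tr[of "Suc k"] by simp
      finally show "(4 * 2 ^ k / tail (r (Suc k))) * tail (r k) \<le> 4 * C * 2 ^ k" .
    qed
  qed (use TA in simp)
  also have "(\<Sum>k<K. 4 * C * 2 ^ k) \<le> 4 * C * 2 ^ K"
  proof -
    have "(\<Sum>k<K. (2::real) ^ k) \<le> 2 ^ K" by (simp add: sum_gp_strict)
    then have "4 * C * (\<Sum>k<K. 2 ^ k) \<le> 4 * C * 2 ^ K" using C1 by (intro mult_left_mono) auto
    then show ?thesis by (simp add: sum_distrib_left)
  qed
  also have "4 * C * 2 ^ K \<le> 4 * C * (2 / (1 - A))" using C1 K by (intro mult_left_mono) auto
  finally show "(LINT z|dA. \<omega> (norm z) / ((1 - A * norm z) * tail (A * norm z))) \<le> (8 * C + 2) / (1 - A)"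
    by (simp add: add_divide_distrib)
qed

text \<open>With \<open>w = cnj a * z\<close>, these are the coefficients of \<open>(1 - w) * pser (ker a) z / z\<close> in powers of \<open>w\<close>.\<close>

definition kd :: "nat \<Rightarrow> real" where "kd n = real (Suc n) * cf (Suc n) - real n * cf n"

text \<open>Write \<open>kd n\<close> as \<open>cf (Suc n)\<close> plus n times the increment of
  \<open>cf\<close>. With x and y the two moments, the increment is (x - y) / (2 x y), and moment
  doubling turns \<open>mult_moment_diff_le\<close> into n (x - y) \<le> 2 E x, so x
  cancels.\<close>

lemma kd_bound:
  assumes E: "\<And>n. mu (n + 1) \<le> E * mu (2 * n + 1)"
  shows "\<bar>kd n\<bar> \<le> (1 + 2 * E) * cf (Suc n)"
proof -
  define x y where "x = mu (2 * n + 1)" and "y = mu (2 * n + 3)"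
  have xy: "0 < y" "y \<le> x"
    using mu_pos[of "2 * n + 3"] by (simp_all add: x_def y_def moment_antimono del: of_nat_add of_nat_mult)
  have c: "cf (Suc n) = 1 / (2 * y)" "cf n = 1 / (2 * x)" by (simp_all add: cf_def x_def y_def numeral_3_eq_3)
  have "real n * (x - y) \<le> 2 * E * x"
    using mult_moment_diff_le[of n] E[of n] by (simp add: x_def y_def)
  then have "real n * (x - y) / (2 * x * y) \<le> 2 * E * x / (2 * x * y)"
    using xy by (intro divide_right_mono) auto
  moreover have "real n * (1 / (2 * y) - 1 / (2 * x)) = real n * (x - y) / (2 * x * y)"
    using xy by (simp add: field_simps)
  moreover have "2 * E * x / (2 * x * y) = 2 * E * (1 / (2 * y))" using xy by simp
  moreover have "0 \<le> real n * (x - y) / (2 * x * y)" using xy by simp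
  moreover have "kd n = 1 / (2 * y) + real n * (1 / (2 * y) - 1 / (2 * x))"
    by (simp add: kd_def c algebra_simps add_divide_distrib)
  moreover have "0 < 1 / (2 * y)" using xy by simp
  ultimately have "\<bar>kd n\<bar> \<le> 1 / (2 * y) + 2 * E * (1 / (2 * y))" by linarith
  then show ?thesis by (simp add: c(1) algebra_simps add_divide_distrib)
qed

lemma norm_pser_ker_le:
  assumes a: "norm a < 1" and z: "norm z < 1"
    and D: "disc_conv (\<lambda>n. of_real (kd n) * cnj a ^ n)"
  shows "norm (pser (ker a) z) \<le> norm (pser (\<lambda>n. cnj a ^ n) z) * norm (pser (\<lambda>n. of_real (kd n) * cnj a ^ n) z)"
proof -
  define w where "w = cnj a * z"
  have w: "norm w < 1" using a z norm_mult_less_1[of "cnj a" z] by (simp add: w_def)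
  define S where "S = (\<Sum>n. of_real (real (Suc n) * cf (Suc n)) * w ^ n)"
  have "(\<lambda>n. ker a n * z ^ n) sums pser (ker a) z"
    by (rule pser_sums[OF fast_imp_disc_conv[OF fast_ker[OF a]] z])
  have "summable (\<lambda>n. of_nat (Suc n) * complex_of_real (cf (Suc n)) * w ^ n)"
    by (rule disc_conv_summable[OF disc_conv_deriv[OF disc_conv_cf] w])
  then have S: "(\<lambda>n. of_real (real (Suc n) * cf (Suc n)) * w ^ n) sums S"
    unfolding S_def by (intro summable_sums) (simp del: of_nat_Suc)
  have "(\<lambda>n. z * (of_real (real (Suc n) * cf (Suc n)) * w ^ n)) sums (z * S)" using S by (rule sums_mult)
  then have "(\<lambda>n. ker a (Suc n) * z ^ Suc n) sums (z * S)"
    by (simp add: ker_def w_def power_mult_distrib mult_ac del: of_nat_Suc)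
  then have "(\<lambda>n. ker a n * z ^ n) sums (z * S)"
    by (subst (asm) sums_Suc_iff) (simp add: ker_def)
  then have k: "pser (ker a) z = z * S" using z by (simp add: pser_def sums_iff)
  have "(\<lambda>n. w * (of_real (real (Suc n) * cf (Suc n)) * w ^ n)) sums (w * S)" using S by (rule sums_mult)
  then have "(\<lambda>n. of_real (real (Suc n) * cf (Suc n)) * w ^ Suc n) sums (w * S)" by (simp add: mult_ac del: of_nat_Suc)
  then have "(\<lambda>n. of_real (real n * cf n) * w ^ n) sums (w * S)"
    by (subst (asm) sums_Suc_iff[of "\<lambda>n. of_real (real n * cf n) * w ^ n"]) simp
  from sums_diff[OF S this]
  have "(\<lambda>n. of_real (kd n) * cnj a ^ n * z ^ n) sums (S - w * S)"
    by (simp add: kd_def w_def power_mult_distrib algebra_simps)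
  then have d: "pser (\<lambda>n. of_real (kd n) * cnj a ^ n) z = (1 - w) * S"
    using z by (simp add: pser_def sums_iff algebra_simps)
  have e: "pser (\<lambda>n. cnj a ^ n) z = 1 / (1 - w)"
    using z suminf_geometric[OF w] by (simp add: pser_def w_def power_mult_distrib)
  have "1 - w \<noteq> 0" using w by auto
  then have "pser (\<lambda>n. cnj a ^ n) z * pser (\<lambda>n. of_real (kd n) * cnj a ^ n) z = S"
    by (simp add: d e)
  then have "norm S = norm (pser (\<lambda>n. cnj a ^ n) z) * norm (pser (\<lambda>n. of_real (kd n) * cnj a ^ n) z)"
    by (metis norm_mult)
  moreover have "norm (pser (ker a) z) \<le> norm S"
    unfolding k norm_mult using z by (intro mult_left_le_one_le) auto
  ultimately show ?thesis by simp
qed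

lemma D_hat_kernel_estimate:
  assumes "\<omega> \<in> D_hat"
  obtains M where "0 < M" "\<And>a. norm a < 1 \<Longrightarrow> nrm1 (pser (ker a)) \<le> M / (1 - norm a)"
proof -
  obtain C where C1: "1 \<le> C" and C: "\<And>r. 0 \<le> r \<Longrightarrow> r < 1 \<Longrightarrow> tail r \<le> C * tail ((1 + r) / 2)"
    using assms unfolding D_hat_def by blast
  obtain E where E: "0 < E" "\<And>n. mu (n + 1) \<le> E * mu (2 * n + 1)"
    using D_hat_moment_doubling[OF C C1] by blast
  define B where "B = 1 + 2 * E"
  have B: "0 \<le> B" "\<bar>kd n\<bar> \<le> B * cf (Suc n)" for n using E kd_bound[OF E(2)] by (auto simp: B_def)
  define B' where "B' = (B * C\<^sup>2)\<^sup>2 * (4 / 3) ^ 6"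
  have B': "0 \<le> B'" by (simp add: B'_def)
  have main: "nrm1 (pser (ker a)) \<le> (1 + B') * (8 * C + 2) / (1 - norm a)" if a: "norm a < 1" for a
  proof -
    define A where "A = norm a"
    have A: "0 \<le> A" "A < 1" using a by (auto simp: A_def)
    let ?e = "\<lambda>n. cnj a ^ n" and ?D = "\<lambda>n. of_real (kd n) * cnj a ^ n"
    define h where "h s = tail (A * max 0 s)" for s
    have hm: "h \<in> borel_measurable borel" unfolding h_def by (rule tail_measurable[OF A(1)])
    have As: "0 \<le> A * s" "A * s \<le> A" "A * s < 1" if "0 \<le> s" "s < 1" for s
      using A that mult_left_le[of s A] by (auto simp: mult.commute)
    have h: "tail A \<le> h s" "h s \<le> tail 0" "0 < h s" if "0 \<le> s" "s < 1" for s
      using As[OF that] that by (auto simp: h_def intro!: tail_antimono tail_pos)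
    have V1: "integrable dA (\<lambda>z. 1 / h (norm z) * \<omega> (norm z))"
    proof (rule integrable_dA_radial[OF set_integrable_mult_weight[where B = "1 / tail A"]])
      show "(\<lambda>s. 1 / h s) \<in> borel_measurable borel" using hm by simp
      show "\<bar>1 / h s\<bar> \<le> 1 / tail A" if "0 \<le> s" "s < 1" for s
        using h[OF that] tail_pos[OF A] by (simp add: divide_left_mono)
    qed
    have V2: "integrable dA (\<lambda>z. h (norm z) * \<omega> (norm z))"
    proof (rule integrable_dA_radial[OF set_integrable_mult_weight[OF hm, where B = "tail 0"]])
      show "\<bar>h s\<bar> \<le> tail 0" if "0 \<le> s" "s < 1" for s using h[OF that] by simp
    qed
    have se: "summable (\<lambda>n. norm (?e n))" using a by (simp add: norm_power summable_geometric)
    have sD: "summable (\<lambda>n. norm (?D n))"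
    proof (rule summable_comparison_test'[where N = 0])
      show "summable (\<lambda>n. B * (norm (complex_of_real (cf (Suc n))) * A ^ n))"
        by (intro summable_mult disc_convD[OF disc_conv_Suc[OF disc_conv_cf]] A)
      show "norm (norm (?D n)) \<le> B * (norm (complex_of_real (cf (Suc n))) * A ^ n)" for n
        using mult_right_mono[OF B(2)[of n], of "A ^ n"] A cf_pos[of "Suc n"]
        by (simp add: norm_mult norm_power A_def mult_ac)
    qed
    have dcD: "disc_conv ?D"
    proof (rule disc_convI)
      fix z :: complex assume z: "norm z < 1"
      show "summable (\<lambda>n. ?D n * z ^ n)"
        by (rule summable_norm_cancel, rule summable_comparison_test'[where N = 0, OF sD])
          (use z in \<open>auto simp: norm_mult norm_power power_le_one intro!: mult_left_le\<close>)
    qed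
    \<comment> \<open>Both weighted squares end up below multiples of \<open>?J\<close>: the
      geometric sum 1 / (1 - |w|) is divided by the tail at |w|, and the bound of
      \<open>norm_square_tail_bound\<close> is multiplied by it.\<close>
    let ?J = "\<lambda>z::complex. \<omega> (norm z) / ((1 - A * norm z) * tail (A * norm z))"
    note J = integrable_weight_over_tail[OF C C1 A] integral_weight_over_tail[OF C C1 A]
    have J0: "0 \<le> ?J z" if "z \<in> \<bbbD>" for z
      using that As[of "norm z"] weight_nonneg[of "norm z"] tail_pos[of "A * norm z"] by simp
    have I1: "(LINT z|dA. (norm (pser ?e z))\<^sup>2 * (1 / h (norm z) * \<omega> (norm z))) \<le> (LINT z|dA. ?J z)"
      unfolding parseval_dA(1)[OF V1 se]
    proof (rule integral_mono'[OF J(1)])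
      fix z assume z': "z \<in> space dA"
      then have z: "norm z < 1" by simp
      have "(\<Sum>n. (norm (?e n))\<^sup>2 * norm z ^ (2 * n)) = (\<Sum>n. ((A * norm z)\<^sup>2) ^ n)"
        by (simp add: A_def norm_power power_mult power_mult_distrib mult.commute flip: power_mult)
      also have "\<dots> = 1 / (1 - (A * norm z)\<^sup>2)"
        using As[of "norm z"] z by (intro suminf_geometric) (simp add: abs_square_less_1 del: power_mult_distrib)
      also have "\<dots> \<le> 1 / (1 - A * norm z)"
        using As[of "norm z"] z power_decreasing[of 1 2 "A * norm z"]
        by (intro divide_left_mono mult_pos_pos) (auto simp: abs_square_less_1 simp del: power_mult_distrib)
      finally have "(\<Sum>n. (norm (?e n))\<^sup>2 * norm z ^ (2 * n)) * (1 / h (norm z) * \<omega> (norm z)) \<le>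
         1 / (1 - A * norm z) * (1 / h (norm z) * \<omega> (norm z))"
        using h[of "norm z"] z weight_nonneg[of "norm z"] by (intro mult_right_mono) auto
      also have "\<dots> = ?J z" by (simp add: h_def)
      finally show "(\<Sum>n. (norm (?e n))\<^sup>2 * norm z ^ (2 * n)) * (1 / h (norm z) * \<omega> (norm z)) \<le> ?J z" .
      show "0 \<le> ?J z" using J0 z by simp
    qed
    have I2: "(LINT z|dA. (norm (pser ?D z))\<^sup>2 * (h (norm z) * \<omega> (norm z))) \<le> (LINT z|dA. B' * ?J z)"
      unfolding parseval_dA(1)[OF V2 sD]
    proof (rule integral_mono'[OF integrable_mult_right[OF J(1)]])
      fix z assume z': "z \<in> space dA"
      then have z: "norm z < 1" by simp
      have t: "0 < tail (A * norm z)" using As[of "norm z"] z by (intro tail_pos) auto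
      have "(\<Sum>n. (norm (?D n))\<^sup>2 * norm z ^ (2 * n)) = (\<Sum>n. (kd n)\<^sup>2 * (A * norm z) ^ (2 * n))"
        by (simp add: A_def norm_mult norm_power power_mult_distrib mult_ac flip: power_mult)
      also have "\<dots> \<le> B' / ((1 - A * norm z) * (tail (A * norm z))\<^sup>2)"
        unfolding B'_def using As[of "norm z"] z by (intro norm_square_tail_bound[OF C C1 B(2) B(1)]) auto
      finally have "(\<Sum>n. (norm (?D n))\<^sup>2 * norm z ^ (2 * n)) * (h (norm z) * \<omega> (norm z)) \<le>
         B' / ((1 - A * norm z) * (tail (A * norm z))\<^sup>2) * (h (norm z) * \<omega> (norm z))"
        using h[of "norm z"] z weight_nonneg[of "norm z"] by (intro mult_right_mono) auto
      also have "\<dots> = B' * ?J z" using t by (simp add: h_def power2_eq_square)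
      finally show "(\<Sum>n. (norm (?D n))\<^sup>2 * norm z ^ (2 * n)) * (h (norm z) * \<omega> (norm z)) \<le> B' * ?J z" .
      show "0 \<le> B' * ?J z" using J0[of z] z B' by (intro mult_nonneg_nonneg) auto
    qed
    txt \<open>AM-GM on the product in \<open>norm_pser_ker_le\<close>, with the two factors balanced by the tail.\<close>
    have "nrm1 (pser (ker a)) \<le> (LINT z|dA. (norm (pser ?e z))\<^sup>2 * (1 / h (norm z) * \<omega> (norm z))
       + (norm (pser ?D z))\<^sup>2 * (h (norm z) * \<omega> (norm z)))"
      unfolding nrm1_def
    proof (rule integral_mono'[OF Bochner_Integration.integrable_add[OF parseval_dA(2)[OF V1 se] parseval_dA(2)[OF V2 sD]]])
      fix z assume "z \<in> space dA"
      then have z: "norm z < 1" by simp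
      let ?x = "norm (pser ?e z)" and ?y = "norm (pser ?D z)" and ?t = "h (norm z)"
      have t: "0 < ?t" using h[of "norm z"] z by simp
      have w: "0 \<le> \<omega> (norm z)" using z by (intro weight_nonneg) auto
      have "norm (pser (ker a) z) \<le> ?x * ?y" by (rule norm_pser_ker_le[OF a z dcD])
      also have "?x * ?y \<le> ?x\<^sup>2 * (1 / ?t) + ?y\<^sup>2 * ?t"
      proof -
        have "0 \<le> (?x - ?y * ?t)\<^sup>2 + ?x\<^sup>2 + (?y * ?t)\<^sup>2" by simp
        then have "?x * ?y * ?t \<le> ?x\<^sup>2 + (?y * ?t)\<^sup>2" by (simp add: power2_eq_square algebra_simps)
        then have "?x * ?y * ?t / ?t \<le> (?x\<^sup>2 + (?y * ?t)\<^sup>2) / ?t" using t by (intro divide_right_mono) auto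
        then show ?thesis using t by (simp add: add_divide_distrib power2_eq_square)
      qed
      finally have "norm (pser (ker a) z) * \<omega> (norm z) \<le> (?x\<^sup>2 * (1 / ?t) + ?y\<^sup>2 * ?t) * \<omega> (norm z)"
        using w by (rule mult_right_mono)
      then show "norm (pser (ker a) z) * \<omega> (norm z) \<le> ?x\<^sup>2 * (1 / ?t * \<omega> (norm z)) + ?y\<^sup>2 * (?t * \<omega> (norm z))"
        by (simp add: algebra_simps)
      show "0 \<le> ?x\<^sup>2 * (1 / ?t * \<omega> (norm z)) + ?y\<^sup>2 * (?t * \<omega> (norm z))"
        using t w by (intro add_nonneg_nonneg mult_nonneg_nonneg) auto
    qed
    also have "\<dots> \<le> (LINT z|dA. ?J z) + (LINT z|dA. B' * ?J z)"
      unfolding Bochner_Integration.integral_add[OF parseval_dA(2)[OF V1 se] parseval_dA(2)[OF V2 sD]]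
      by (rule add_mono[OF I1 I2])
    also have "\<dots> = (1 + B') * (LINT z|dA. ?J z)" by (simp only: integral_mult_right_zero) (simp add: algebra_simps)
    also have "\<dots> \<le> (1 + B') * ((8 * C + 2) / (1 - A))" using B' J(2) by (intro mult_left_mono) auto
    finally show ?thesis by (simp add: A_def)
  qed
  show ?thesis by (rule that[OF _ main]) (use B' C1 in auto)
qed

section \<open>The space A^1 and functions given by the coefficients of a functional\<close>

abbreviation A1 :: "(complex \<Rightarrow> complex) set" where "A1 \<equiv> bergman_space 1 \<omega>"

lemma A1_iff: "f \<in> A1 \<longleftrightarrow> f \<in> hol_disc \<and> integrable dA (\<lambda>z. norm (f z) * \<omega> (norm z))"
  by (simp add: bergman_space_1)

lemma
  assumes f: "f \<in> A1" and g: "g \<in> A1"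
  shows A1_linear: "(\<lambda>z. a * f z + b * g z) \<in> A1"
    and nrm1_linear_le: "nrm1 (\<lambda>z. a * f z + b * g z) \<le> norm a * nrm1 f + norm b * nrm1 g"
proof -
  have h: "f \<in> hol_disc" "g \<in> hol_disc" and i: "integrable dA (\<lambda>z. norm (f z) * \<omega> (norm z))"
    "integrable dA (\<lambda>z. norm (g z) * \<omega> (norm z))"
    using f g by (auto simp: A1_iff)
  note hl = hol_disc_linear[OF h, of a b]
  let ?R = "\<lambda>z. norm a * (norm (f z) * \<omega> (norm z)) + norm b * (norm (g z) * \<omega> (norm z))"
  have Ri: "integrable dA ?R" using i by (intro Bochner_Integration.integrable_add integrable_mult_right)
  have le: "norm (a * f z + b * g z) * \<omega> (norm z) \<le> ?R z" if "z \<in> space dA" for z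
  proof -
    have "norm (a * f z + b * g z) \<le> norm a * norm (f z) + norm b * norm (g z)"
      using norm_triangle_ineq[of "a * f z" "b * g z"] by (simp add: norm_mult)
    from mult_right_mono[OF this weight_nonneg[of "norm z"]] that
    show ?thesis by (simp add: algebra_simps)
  qed
  have wm: "(\<lambda>z. \<omega> (norm z)) \<in> borel_measurable dA" using integrable_weight by (rule borel_measurable_integrable)
  have "integrable dA (\<lambda>z. norm (a * f z + b * g z) * \<omega> (norm z))"
  proof (rule Bochner_Integration.integrable_bound[OF Ri])
    show "(\<lambda>z. norm (a * f z + b * g z) * \<omega> (norm z)) \<in> borel_measurable dA"
      using borel_measurable_dA_hol_disc[OF hl] wm by (intro borel_measurable_times) auto
    show "AE z in dA. norm (norm (a * f z + b * g z) * \<omega> (norm z)) \<le> norm (?R z)"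
    proof (rule AE_I2)
      fix z assume z: "z \<in> space dA"
      then have "0 \<le> norm (a * f z + b * g z) * \<omega> (norm z)" using weight_nonneg[of "norm z"] by simp
      then show "norm (norm (a * f z + b * g z) * \<omega> (norm z)) \<le> norm (?R z)" using le[OF z] by simp
    qed
  qed
  then show "(\<lambda>z. a * f z + b * g z) \<in> A1" using hl by (simp add: A1_iff)
  have "nrm1 (\<lambda>z. a * f z + b * g z) \<le> (LINT z|dA. ?R z)"
    unfolding nrm1_def
    by (rule integral_mono'[OF Ri le]) (auto intro!: add_nonneg_nonneg mult_nonneg_nonneg weight_nonneg)
  also have "\<dots> = norm a * nrm1 f + norm b * nrm1 g"
    using i by (simp add: nrm1_def)
  finally show "nrm1 (\<lambda>z. a * f z + b * g z) \<le> norm a * nrm1 f + norm b * nrm1 g" .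
qed

lemma
  assumes "f \<in> hol_disc" "\<And>z. norm z < 1 \<Longrightarrow> norm (f z) \<le> B"
  shows bounded_imp_A1: "f \<in> A1" and nrm1_le_bound: "nrm1 f \<le> B * (2 * mu 1)"
proof -
  have m: "(\<lambda>z. norm (f z)) \<in> borel_measurable dA" using borel_measurable_dA_hol_disc[OF assms(1)] by simp
  have i: "integrable dA (\<lambda>z. norm (f z) * \<omega> (norm z))"
    by (rule integrable_dA_bounded_mult[OF integrable_weight m, of B]) (simp add: assms(2))
  then show "f \<in> A1" using assms(1) by (simp add: A1_iff)
  have "nrm1 f \<le> (LINT z|dA. B * \<omega> (norm z))"
    unfolding nrm1_def using i integrable_weight assms(2) weight_nonneg
    by (intro integral_mono mult_right_mono) auto
  then show "nrm1 f \<le> B * (2 * mu 1)" by (simp add: integral_weight)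
qed

lemma
  assumes "fast \<alpha>"
  shows fast_imp_A1: "pser \<alpha> \<in> A1"
    and nrm1_pser_le: "nrm1 (pser \<alpha>) \<le> 2 * mu 1 * (\<Sum>n. real (Suc n) * norm (\<alpha> n))"
proof -
  have b: "norm (pser \<alpha> z) \<le> (\<Sum>n. real (Suc n) * norm (\<alpha> n))" for z
  proof -
    have "norm (pser \<alpha> z) \<le> (\<Sum>n. norm (\<alpha> n))" by (intro norm_pser_le fast_imp_summable assms)
    also have "\<dots> \<le> (\<Sum>n. real (Suc n) * norm (\<alpha> n))"
      using assms by (intro suminf_le fast_imp_summable) (auto simp: fast_def mult_le_cancel_right1)
    finally show ?thesis .
  qed
  note h = pser_in_hol_disc[OF fast_imp_disc_conv[OF assms]]
  show "pser \<alpha> \<in> A1" by (rule bounded_imp_A1[OF h b])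
  show "nrm1 (pser \<alpha>) \<le> 2 * mu 1 * (\<Sum>n. real (Suc n) * norm (\<alpha> n))"
    using nrm1_le_bound[OF h b] by (simp add: mult.commute)
qed

lemma zpow_A1: "zpow n \<in> A1"
  unfolding zpow_eq_pser by (intro fast_imp_A1 fast_single)

lemma nrm1_zpow_le: "nrm1 (zpow n) \<le> 2 * mu 1"
proof -
  have "zpow n \<in> hol_disc" using zpow_A1 by (simp add: A1_iff)
  from nrm1_le_bound[OF this, of 1] show ?thesis by (simp add: zpow_def norm_power power_le_one)
qed

lemma nrm1_zpow_0: "nrm1 (zpow 0) = 2 * mu 1"
proof -
  have "nrm1 (zpow 0) = (LINT z|dA. \<omega> (norm z))"
    unfolding nrm1_def by (rule Bochner_Integration.integral_cong) (auto simp: zpow_def)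
  then show ?thesis by (simp add: integral_weight)
qed

text \<open>The Cauchy-Schwarz inequality in its AM-GM form with a free parameter t;
  \<open>2 * mu 1\<close> is the total mass of the weight. The sum form allows a multiple of the A^2
  term to be absorbed.\<close>

lemma nrm1_le_L2:
  assumes "f \<in> borel_measurable dA" "integrable dA (\<lambda>z. (norm (f z))\<^sup>2 * \<omega> (norm z))" "0 < t"
  shows "nrm1 f \<le> (t * (LINT z|dA. (norm (f z))\<^sup>2 * \<omega> (norm z)) + 2 * mu 1 / t) / 2"
proof -
  let ?g = "\<lambda>z. t / 2 * ((norm (f z))\<^sup>2 * \<omega> (norm z)) + 1 / (2 * t) * \<omega> (norm z)"
  have gi: "integrable dA ?g"
    using assms integrable_weight by (intro Bochner_Integration.integrable_add integrable_mult_right)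
  have "nrm1 f \<le> (LINT z|dA. ?g z)"
    unfolding nrm1_def
  proof (rule integral_mono'[OF gi])
    fix z assume "z \<in> space dA"
    then have w: "0 \<le> \<omega> (norm z)" by (intro weight_nonneg) auto
    have "0 \<le> (t * norm (f z) - 1)\<^sup>2" by simp
    then have "norm (f z) * (2 * t) \<le> t\<^sup>2 * (norm (f z))\<^sup>2 + 1" by (simp add: power2_eq_square algebra_simps)
    then have "norm (f z) \<le> (t\<^sup>2 * (norm (f z))\<^sup>2 + 1) / (2 * t)" using assms(3) by (simp add: pos_le_divide_eq)
    also have "\<dots> = t / 2 * (norm (f z))\<^sup>2 + 1 / (2 * t)" using assms(3) by (simp add: power2_eq_square field_simps)
    finally have "norm (f z) * \<omega> (norm z) \<le> (t / 2 * (norm (f z))\<^sup>2 + 1 / (2 * t)) * \<omega> (norm z)"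
      using w by (rule mult_right_mono)
    then show "norm (f z) * \<omega> (norm z) \<le> ?g z" by (simp add: algebra_simps)
    show "0 \<le> ?g z" using w assms(3) by simp
  qed
  also have "\<dots> = t / 2 * (LINT z|dA. (norm (f z))\<^sup>2 * \<omega> (norm z)) + 1 / (2 * t) * (2 * mu 1)"
    using Bochner_Integration.integral_add[OF integrable_mult_right[OF assms(2), of "t / 2"]
      integrable_mult_right[OF integrable_weight, of "1 / (2 * t)"]]
    by (simp only: integral_mult_right_zero integral_weight)
  finally show ?thesis by (simp add: add_divide_distrib)
qed

text \<open>Fatou's lemma along radii increasing to 1.\<close>

lemma
  assumes \<beta>: "disc_conv \<beta>" and b: "\<And>r. 0 < r \<Longrightarrow> r < 1 \<Longrightarrow> nrm1 (dil r (pser \<beta>)) \<le> M"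
  shows dil_bounded_imp_A1: "pser \<beta> \<in> A1" and nrm1_le_of_dil: "nrm1 (pser \<beta>) \<le> M"
proof -
  define r where "r k = real (Suc k) / real (Suc (Suc k))" for k
  have r: "0 < r k" "r k < 1" for k by (auto simp: r_def)
  have lim: "r \<longlonglongrightarrow> 1" unfolding r_def using LIMSEQ_Suc[OF LIMSEQ_n_over_Suc_n] by simp
  let ?g = "\<lambda>z. norm (pser \<beta> z) * \<omega> (norm z)"
  let ?u = "\<lambda>k z. norm (dil (r k) (pser \<beta>) z) * \<omega> (norm z)"
  have wm: "(\<lambda>z. \<omega> (norm z)) \<in> borel_measurable dA" using integrable_weight by (rule borel_measurable_integrable)
  have dA1: "dil (r k) (pser \<beta>) \<in> A1" for k
    unfolding dil_pser[OF less_imp_le[OF r(1)] less_imp_le[OF r(2)]]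
    by (intro fast_imp_A1 disc_conv_fast \<beta> less_imp_le[OF r(1)] r(2))
  have ui: "integrable dA (?u k)" for k using dA1 by (simp add: A1_iff)
  have gm: "?g \<in> borel_measurable dA"
    using borel_measurable_dA_pser[OF \<beta>] wm by (intro borel_measurable_times) auto
  have M: "0 \<le> M" using b[OF r, of 0] nrm1_nonneg order_trans by blast
  have "(\<integral>\<^sup>+z. ennreal (?g z) \<partial>dA) = (\<integral>\<^sup>+z. liminf (\<lambda>k. ennreal (?u k z)) \<partial>dA)"
  proof (rule nn_integral_cong)
    fix z assume "z \<in> space dA"
    then have z: "norm z < 1" by simp
    have "isCont (pser \<beta>) z" using has_field_derivative_pser[OF \<beta> z] by (rule DERIV_isCont)
    moreover have "(\<lambda>k. of_real (r k) * z) \<longlonglongrightarrow> of_real 1 * z" by (intro tendsto_intros lim)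
    ultimately have "(\<lambda>k. pser \<beta> (of_real (r k) * z)) \<longlonglongrightarrow> pser \<beta> z"
      by (intro isCont_tendsto_compose[of z "pser \<beta>"]) auto
    then have "(\<lambda>k. norm (pser \<beta> (of_real (r k) * z)) * \<omega> (norm z)) \<longlonglongrightarrow> ?g z" by (intro tendsto_intros)
    then have "(\<lambda>k. ?u k z) \<longlonglongrightarrow> ?g z" using z by (simp add: dil_def)
    then have "(\<lambda>k. ennreal (?u k z)) \<longlonglongrightarrow> ennreal (?g z)" by (rule tendsto_ennrealI)
    then show "ennreal (?g z) = liminf (\<lambda>k. ennreal (?u k z))"
      by (intro lim_imp_Liminf[symmetric]) auto
  qed
  also have "\<dots> \<le> liminf (\<lambda>k. \<integral>\<^sup>+z. ennreal (?u k z) \<partial>dA)"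
    by (rule nn_integral_liminf) (use ui in \<open>auto intro!: borel_measurable_integrable\<close>)
  also have "\<dots> \<le> ennreal M"
  proof -
    have "(\<integral>\<^sup>+z. ennreal (?u k z) \<partial>dA) \<le> ennreal M" for k
    proof -
      have "(\<integral>\<^sup>+z. ennreal (?u k z) \<partial>dA) = ennreal (LINT z|dA. ?u k z)"
        by (rule nn_integral_eq_integral[OF ui]) (auto intro!: AE_I2 mult_nonneg_nonneg weight_nonneg)
      also have "\<dots> \<le> ennreal M" using b[OF r, of k] unfolding nrm1_def by (rule ennreal_leI)
      finally show ?thesis .
    qed
    then show ?thesis by (intro Liminf_le) auto
  qed
  finally have fin: "(\<integral>\<^sup>+z. ennreal (?g z) \<partial>dA) \<le> ennreal M" .
  have g0: "AE z in dA. 0 \<le> ?g z" by (auto intro!: AE_I2 mult_nonneg_nonneg weight_nonneg)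
  have gi: "integrable dA ?g"
    using gm fin g0 by (intro integrableI_nonneg) (auto intro: le_less_trans)
  then show "pser \<beta> \<in> A1" using pser_in_hol_disc[OF \<beta>] by (simp add: A1_iff)
  have "ennreal (nrm1 (pser \<beta>)) \<le> ennreal M"
    using fin nn_integral_eq_integral[OF gi g0] by (simp add: nrm1_def)
  then show "nrm1 (pser \<beta>) \<le> M" using M by (simp add: ennreal_le_iff)
qed

text \<open>The pairing integral at radius r and the value of L at the dilation are sums of the same
  series. The pairing therefore converges to \<open>L (pser \<alpha>)\<close> as soon as L is
  continuous along dilations, which is the hypothesis \<open>lim\<close>; each of the two spaces
  supplies it in its own way.\<close>

lemma has_pairing_of_coeffs:
  assumes lin: "\<And>f g a b. f \<in> X \<Longrightarrow> g \<in> X \<Longrightarrow> L (\<lambda>z. a * f z + b * g z) = a * L f + b * L g"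
    and X: "\<And>\<alpha>. fast \<alpha> \<Longrightarrow> pser \<alpha> \<in> X"
    and bd: "\<And>\<alpha>. fast \<alpha> \<Longrightarrow> norm (L (pser \<alpha>)) \<le> K * (\<Sum>n. real (Suc n) * norm (\<alpha> n))"
    and \<beta>: "\<And>n. \<beta> n = cnj (L (zpow n)) * of_real (cf n)" "disc_conv \<beta>" and g: "pser \<beta> \<in> A1"
    and \<alpha>: "disc_conv \<alpha>" and lim: "((\<lambda>r. L (dil r (pser \<alpha>))) \<longlongrightarrow> L (pser \<alpha>)) (at_left 1)"
  shows "has_pairing \<omega> (pser \<alpha>) (pser \<beta>) (L (pser \<alpha>))"
proof -
  have gi: "integrable dA (\<lambda>z. norm (pser \<beta> z) * \<omega> (norm z))" using g by (simp add: A1_iff)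
  have ev: "eventually (\<lambda>r::real. 0 < r \<and> r < 1) (at_left 1)"
    using eventually_at_left_real[of 0 1] by simp
  have c: "of_real (2 * mu (2 * n + 1)) * cnj (\<beta> n) = L (zpow n)" for n
  proof -
    have "of_real (2 * mu (2 * n + 1)) * (of_real (cf n) :: complex) = 1"
      using mu_pos[of "2 * n + 1"] by (simp add: cf_def del: of_nat_add of_nat_mult flip: of_real_mult)
    then show ?thesis by (simp add: \<beta>(1) mult_ac del: of_real_mult)
  qed
  have eq: "(LINT z|dA. pser \<alpha> (of_real r * z) * cnj (pser \<beta> z) * of_real (\<omega> (norm z))) = L (dil r (pser \<alpha>))"
    if r: "0 < r" "r < 1" for r
  proof -
    have "(\<lambda>n. \<alpha> n * of_real r ^ n * L (zpow n))
      sums (LINT z|dA. pser \<alpha> (of_real r * z) * cnj (pser \<beta> z) * of_real (\<omega> (norm z)))"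
      using pairing_sums[OF \<beta>(2) gi \<alpha> less_imp_le[OF r(1)] r(2)] by (simp only: c)
    moreover have "(\<lambda>n. \<alpha> n * of_real r ^ n * L (zpow n)) sums L (pser (\<lambda>n. \<alpha> n * of_real r ^ n))"
      using r by (intro functional_sums[OF lin X bd] disc_conv_fast \<alpha>) auto
    ultimately show ?thesis using r by (simp add: sums_unique2 dil_pser)
  qed
  show ?thesis
    unfolding has_pairing_def
  proof
    show "eventually (\<lambda>r. integrable dA (\<lambda>z. pser \<alpha> (of_real r * z) * cnj (pser \<beta> z) * of_real (\<omega> (norm z)))) (at_left 1)"
      using ev by eventually_elim (rule pairing_integrable[OF \<beta>(2) gi \<alpha>], auto)
    have "eventually (\<lambda>r. L (dil r (pser \<alpha>)) =
       (LINT z|dA. pser \<alpha> (of_real r * z) * cnj (pser \<beta> z) * of_real (\<omega> (norm z)))) (at_left 1)"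
      using ev by eventually_elim (rule eq[symmetric], auto)
    from Lim_transform_eventually[OF lim this]
    show "((\<lambda>r. LINT z|dA. pser \<alpha> (of_real r * z) * cnj (pser \<beta> z) * of_real (\<omega> (norm z))) \<longlongrightarrow> L (pser \<alpha>)) (at_left 1)" .
  qed
qed

lemma pairing_unique:
  assumes "g1 \<in> hol_disc" "g2 \<in> hol_disc"
    and p: "\<And>n. has_pairing \<omega> (zpow n) g1 (l n)" "\<And>n. has_pairing \<omega> (zpow n) g2 (l n)"
  shows "g1 = g2"
proof -
  obtain \<beta>1 \<beta>2 where \<beta>: "disc_conv \<beta>1" "g1 = pser \<beta>1" "disc_conv \<beta>2" "g2 = pser \<beta>2"
    using assms(1,2) hol_disc_imp_pser by metis
  have "\<beta>1 n = \<beta>2 n" for n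
    using has_pairing_zpow[OF \<beta>(1), of "l 0" n "l n"] has_pairing_zpow[OF \<beta>(3), of "l 0" n "l n"] p
    by (simp add: \<beta>(2,4))
  then have "\<beta>1 = \<beta>2" by (rule ext)
  then show ?thesis by (simp add: \<beta>(2,4))
qed

text \<open>One representing function with a norm bound is enough: pairing with monomials forces
  uniqueness, and the bound demanded of every representing function then concerns this one
  only.\<close>

lemma dual_embedsI:
  assumes C: "0 < C" and Y: "Y \<subseteq> hol_disc" and X: "\<And>n. zpow n \<in> X"
    and ex: "\<And>L. L \<in> dual_space X NX \<Longrightarrow> \<exists>g\<in>Y. (\<forall>f\<in>X. has_pairing \<omega> f g (L f)) \<and> NY g \<le> C * dual_norm X NX L"
  shows "dual_embeds \<omega> X NX Y NY"
  unfolding dual_embeds_def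
proof (intro exI[of _ C] conjI ballI C)
  fix L assume L: "L \<in> dual_space X NX"
  then obtain g where g: "g \<in> Y" "\<forall>f\<in>X. has_pairing \<omega> f g (L f)" "NY g \<le> C * dual_norm X NX L"
    using ex by blast
  have u: "h = g" if "h \<in> Y" "\<forall>f\<in>X. has_pairing \<omega> f h (L f)" for h
    using that g X Y by (intro pairing_unique[of h g "\<lambda>n. L (zpow n)"]) auto
  show "\<exists>!g. g \<in> Y \<and> (\<forall>f\<in>X. has_pairing \<omega> f g (L f))" using g u by blast
  fix h assume "h \<in> Y" 
  show "(\<forall>f\<in>X. has_pairing \<omega> f h (L f)) \<longrightarrow> NY h \<le> C * dual_norm X NX L"
    using u[OF \<open>h \<in> Y\<close>] g by blast
qed

end

subsection \<open>The projection on bounded functions\<close>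

lemma Linf_AE_bound:
  assumes "f \<in> Linf"
  shows "AE z in dA. norm (f z) \<le> Linf_norm f" and "0 \<le> Linf_norm f"
proof -
  let ?e = "esssup dA (\<lambda>z. ereal (norm (f z)))"
  have fm: "f \<in> borel_measurable dA" and fin: "?e < \<infinity>" using assms by (auto simp: Linf_def)
  \<comment> \<open>Positive total mass is what makes the essential supremum of a nonnegative
    function nonnegative; otherwise it would be minus infinity.\<close>
  have "emeasure dA (space dA) \<noteq> 0"
    by (simp add: emeasure_dA emeasure_ball unit_ball_vol_2 ennreal_mult[symmetric])
  then have "0 = esssup dA (\<lambda>z. 0::ereal)" by (rule esssup_const[symmetric])
  also have "\<dots> \<le> ?e" by (rule esssup_mono) auto
  finally have e0: "0 \<le> ?e" .
  then have e: "?e = ereal (Linf_norm f)" using fin by (cases ?e) (auto simp: Linf_norm_def)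
  then show "0 \<le> Linf_norm f" using e0 by simp
  have "AE z in dA. ereal (norm (f z)) \<le> ?e" by (rule esssup_AE)
  then show "AE z in dA. norm (f z) \<le> Linf_norm f" by (simp add: e)
qed

lemma
  assumes "f \<in> borel_measurable dA" "\<And>z. norm (f z) \<le> 1"
  shows LinfI: "f \<in> Linf" and Linf_norm_le: "Linf_norm f \<le> 1"
proof -
  have "(\<lambda>z. ereal (norm (f z))) \<in> borel_measurable dA" using assms(1) by simp
  then have e: "esssup dA (\<lambda>z. ereal (norm (f z))) \<le> 1"
    using assms(2) by (intro esssup_I) auto
  also have "(1::ereal) < \<infinity>" by simp
  finally show L: "f \<in> Linf" using assms(1) by (simp add: Linf_def)
  show "Linf_norm f \<le> 1" using e by (cases "esssup dA (\<lambda>z. ereal (norm (f z)))") (auto simp: Linf_norm_def)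
qed

context weight
begin

lemma Lp_weight_norm_1': "Lp_weight_norm 1 \<omega> = nrm1"
  by (rule ext) (rule Lp_weight_norm_1)

lemma
  assumes \<phi>: "\<phi> \<in> Linf" and f: "f \<in> A1"
  shows integrable_Linf_mult: "integrable dA (\<lambda>z. f z * (cnj (\<phi> z) * of_real (\<omega> (norm z))))"
    and norm_integral_Linf_mult_le: "norm (LINT z|dA. f z * (cnj (\<phi> z) * of_real (\<omega> (norm z)))) \<le> Linf_norm \<phi> * nrm1 f"
proof -
  let ?K = "Linf_norm \<phi>"
  have fi: "integrable dA (\<lambda>z. norm (f z) * \<omega> (norm z))" and fm: "f \<in> borel_measurable dA"
    using f by (auto simp: A1_iff borel_measurable_dA_hol_disc)
  have \<phi>m: "\<phi> \<in> borel_measurable dA" using \<phi> by (simp add: Linf_def)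
  have wm: "(\<lambda>z. complex_of_real (\<omega> (norm z))) \<in> borel_measurable dA"
    using integrable_weight_complex by (rule borel_measurable_integrable)
  have "cnj \<in> borel_measurable borel" by (intro borel_measurable_continuous_onI continuous_intros)
  then have cm: "(\<lambda>z. cnj (\<phi> z)) \<in> borel_measurable dA" using \<phi>m by (rule measurable_compose[rotated])
  have Ki: "integrable dA (\<lambda>z. ?K * (norm (f z) * \<omega> (norm z)))" using fi by simp
  have ae: "AE z in dA. norm (f z * (cnj (\<phi> z) * of_real (\<omega> (norm z)))) \<le> ?K * (norm (f z) * \<omega> (norm z))"
    using Linf_AE_bound(1)[OF \<phi>] AE_space[of dA]
  proof eventually_elim
    case (elim z)
    have w: "0 \<le> \<omega> (norm z)" using elim by (intro weight_nonneg) auto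
    have "norm (f z * (cnj (\<phi> z) * of_real (\<omega> (norm z)))) = norm (\<phi> z) * (norm (f z) * \<omega> (norm z))"
      using w by (simp add: norm_mult)
    also have "\<dots> \<le> ?K * (norm (f z) * \<omega> (norm z))" using elim w by (intro mult_right_mono) auto
    finally show ?case .
  qed
  show i: "integrable dA (\<lambda>z. f z * (cnj (\<phi> z) * of_real (\<omega> (norm z))))"
  proof (rule Bochner_Integration.integrable_bound[OF Ki])
    show "(\<lambda>z. f z * (cnj (\<phi> z) * of_real (\<omega> (norm z)))) \<in> borel_measurable dA"
      by (intro borel_measurable_times fm cm wm)
    show "AE z in dA. norm (f z * (cnj (\<phi> z) * of_real (\<omega> (norm z)))) \<le> norm (?K * (norm (f z) * \<omega> (norm z)))"
      using ae by eventually_elim simp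
  qed
  have "norm (LINT z|dA. f z * (cnj (\<phi> z) * of_real (\<omega> (norm z)))) \<le>
    (LINT z|dA. norm (f z * (cnj (\<phi> z) * of_real (\<omega> (norm z)))))" by (rule integral_norm_bound)
  also have "\<dots> \<le> (LINT z|dA. ?K * (norm (f z) * \<omega> (norm z)))"
    by (intro integral_mono_AE integrable_norm i Ki ae)
  finally show "norm (LINT z|dA. f z * (cnj (\<phi> z) * of_real (\<omega> (norm z)))) \<le> Linf_norm \<phi> * nrm1 f"
    by (simp add: nrm1_def)
qed

text \<open>The Taylor coefficients of the projection of \<phi>. The integral appears conjugated, so
  that inside it stands the value at z^n of the functional given by pairing with \<phi>.\<close>

definition proj_coeff :: "(complex \<Rightarrow> complex) \<Rightarrow> nat \<Rightarrow> complex"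
  where "proj_coeff \<phi> n = of_real (cf n) * cnj (LINT z|dA. z ^ n * (cnj (\<phi> z) * of_real (\<omega> (norm z))))"

lemma LINT_zpow_eq: "(LINT z|dA. zpow n z * v z) = (LINT z|dA. z ^ n * v z)" for v :: "complex \<Rightarrow> complex"
  by (rule Bochner_Integration.integral_cong) (auto simp: zpow_def)

lemma integrable_Linf_weight:
  assumes "\<phi> \<in> Linf" shows "integrable dA (\<lambda>z. cnj (\<phi> z) * of_real (\<omega> (norm z)))"
  using integrable_Linf_mult[OF assms zpow_A1, of 0]
  by (rule Bochner_Integration.integrable_cong[THEN iffD1, rotated 2]) (auto simp: zpow_def)

text \<open>For fixed z in the disc the kernel series converges absolutely up to the boundary in the
  other variable, so it may be integrated termwise. Boundedness of \<phi> keeps the coefficients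
  below a multiple of \<open>cf n\<close>.\<close>

lemma
  assumes \<phi>: "\<phi> \<in> Linf"
  shows disc_conv_proj_coeff: "disc_conv (proj_coeff \<phi>)"
    and bergman_proj_eq: "bergman_proj \<omega> \<phi> = pser (proj_coeff \<phi>)"
proof -
  let ?v = "\<lambda>z. cnj (\<phi> z) * of_real (\<omega> (norm z))"
  have "norm (proj_coeff \<phi> n) \<le> (Linf_norm \<phi> * (2 * mu 1)) * norm (complex_of_real (cf n))" for n
  proof -
    have "norm (LINT z|dA. z ^ n * ?v z) \<le> Linf_norm \<phi> * nrm1 (zpow n)"
      using norm_integral_Linf_mult_le[OF \<phi> zpow_A1, of n] by (simp only: LINT_zpow_eq)
    also have "\<dots> \<le> Linf_norm \<phi> * (2 * mu 1)"
      using Linf_AE_bound(2)[OF \<phi>] by (intro mult_left_mono nrm1_zpow_le)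
    finally show ?thesis
      by (simp only: proj_coeff_def norm_mult complex_mod_cnj mult.commute[of "norm (complex_of_real (cf n))"])
        (rule mult_right_mono, auto)
  qed
  then show dc: "disc_conv (proj_coeff \<phi>)" by (rule disc_conv_bound[OF disc_conv_cf])
  show "bergman_proj \<omega> \<phi> = pser (proj_coeff \<phi>)"
  proof
    fix z
    show "bergman_proj \<omega> \<phi> z = pser (proj_coeff \<phi>) z"
    proof (cases "z \<in> \<bbbD>")
      case True
      then have z: "norm z < 1" by simp
      let ?b = "\<lambda>n. of_real (cf n) * cnj z ^ n"
      have sb: "summable (\<lambda>n. norm (?b n))"
        using disc_conv_summable_norm[OF disc_conv_cf, of "cnj z"] z by simp
      have k: "bergman_kernel \<omega> z \<zeta> = pser ?b \<zeta>" if "\<zeta> \<in> \<bbbD>" for \<zeta>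
        using that by (simp add: bergman_kernel_def pser_def cf_def power_mult_distrib mult_ac)
      have "bergman_proj \<omega> \<phi> z = (LINT \<zeta>|dA. cnj (pser ?b \<zeta> * ?v \<zeta>))"
        using True unfolding bergman_proj_def
        by (simp, intro Bochner_Integration.integral_cong) (auto simp: k mult_ac)
      also have "\<dots> = cnj (LINT \<zeta>|dA. pser ?b \<zeta> * ?v \<zeta>)" by (rule Bochner_Integration.integral_cnj)
      finally have eq: "bergman_proj \<omega> \<phi> z = cnj (LINT \<zeta>|dA. pser ?b \<zeta> * ?v \<zeta>)" .
      have "(\<lambda>n. ?b n * (LINT \<zeta>|dA. \<zeta> ^ n * ?v \<zeta>)) sums (LINT \<zeta>|dA. pser ?b \<zeta> * ?v \<zeta>)"
        by (rule integral_pser(1)[OF integrable_Linf_weight[OF \<phi>] sb])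
      then have "(\<lambda>n. cnj (?b n * (LINT \<zeta>|dA. \<zeta> ^ n * ?v \<zeta>))) sums bergman_proj \<omega> \<phi> z"
        unfolding eq by (simp only: sums_cnj)
      moreover have "cnj (?b n * (LINT \<zeta>|dA. \<zeta> ^ n * ?v \<zeta>)) = proj_coeff \<phi> n * z ^ n" for n
        by (simp only: proj_coeff_def complex_cnj_mult complex_cnj_power complex_cnj_complex_of_real complex_cnj_cnj mult_ac)
      ultimately have "(\<lambda>n. proj_coeff \<phi> n * z ^ n) sums bergman_proj \<omega> \<phi> z" by (simp only:)
      then show ?thesis using z by (simp add: pser_def sums_iff)
    qed (simp add: bergman_proj_def pser_def)
  qed
qed

subsection \<open>The implications\<close>

lemma dual_embedsE:
  assumes "dual_embeds \<omega> X NX Y NY"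
  obtains C where "0 < C" "\<And>L. L \<in> dual_space X NX \<Longrightarrow>
    \<exists>g\<in>Y. (\<forall>f\<in>X. has_pairing \<omega> f g (L f)) \<and> NY g \<le> C * dual_norm X NX L"
proof -
  obtain C where C: "0 < C" and *: "\<forall>L\<in>dual_space X NX.
      (\<exists>!g. g \<in> Y \<and> (\<forall>f\<in>X. has_pairing \<omega> f g (L f))) \<and>
      (\<forall>g\<in>Y. (\<forall>f\<in>X. has_pairing \<omega> f g (L f)) \<longrightarrow> NY g \<le> C * dual_norm X NX L)"
    using assms unfolding dual_embeds_def by (elim exE conjE)
  show ?thesis
  proof (rule that[OF C])
    fix L assume "L \<in> dual_space X NX"
    note L = bspec[OF * this]
    from conjunct1[OF L] obtain g where g: "g \<in> Y" "\<forall>f\<in>X. has_pairing \<omega> f g (L f)"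
      by (elim ex1E conjE)
    with conjunct2[OF L]
    show "\<exists>g\<in>Y. (\<forall>f\<in>X. has_pairing \<omega> f g (L f)) \<and> NY g \<le> C * dual_norm X NX L" by blast
  qed
qed

lemma dual_norm_A1:
  assumes L: "L \<in> dual_space A1 nrm1"
  shows "f \<in> A1 \<Longrightarrow> norm (L f) \<le> dual_norm A1 nrm1 L * nrm1 f" and "0 \<le> dual_norm A1 nrm1 L"
proof -
  show b: "norm (L f) \<le> dual_norm A1 nrm1 L * nrm1 f" if f: "f \<in> A1" for f
  proof (rule norm_le_dual_norm[OF L f])
    show "(\<lambda>z. a * f z) \<in> A1" "nrm1 (\<lambda>z. a * f z) \<le> norm a * nrm1 f" for a
      using A1_linear[OF f f, of a 0] nrm1_linear_le[OF f f, of a 0] by simp_all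
  qed (rule nrm1_nonneg)
  have "0 \<le> dual_norm A1 nrm1 L * (2 * mu 1)"
    using order_trans[OF norm_ge_zero b[OF zpow_A1, of 0]] by (simp only: nrm1_zpow_0)
  then show "0 \<le> dual_norm A1 nrm1 L" using mu_pos[of 1] by (simp add: zero_le_mult_iff)
qed

lemma kernel_estimate_imp_dual_A1:
  assumes M: "0 < M" and KE: "\<And>a. norm a < 1 \<Longrightarrow> nrm1 (pser (ker a)) \<le> M / (1 - norm a)"
  shows "dual_embeds \<omega> A1 nrm1 bloch bloch_norm"
proof (rule dual_embedsI)
  show "0 < 2 * M + 1" using M by simp
  show "bloch \<subseteq> hol_disc" by (auto simp: bloch_def)
  show "zpow n \<in> A1" for n by (rule zpow_A1)
  fix L assume L: "L \<in> dual_space A1 nrm1"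
  define N where "N = dual_norm A1 nrm1 L"
  define W where "W = 2 * mu 1"
  have N0: "0 \<le> N" and LN: "\<And>f. f \<in> A1 \<Longrightarrow> norm (L f) \<le> N * nrm1 f"
    using dual_norm_A1[OF L] by (auto simp: N_def)
  have lin: "\<And>f g a b. f \<in> A1 \<Longrightarrow> g \<in> A1 \<Longrightarrow> L (\<lambda>z. a * f z + b * g z) = a * L f + b * L g"
    using L by (simp add: dual_space_def)
  have bd: "norm (L (pser \<alpha>)) \<le> (N * W) * (\<Sum>n. real (Suc n) * norm (\<alpha> n))" if "fast \<alpha>" for \<alpha>
    using order_trans[OF LN[OF fast_imp_A1[OF that]] mult_left_mono[OF nrm1_pser_le[OF that] N0]]
    by (simp only: W_def mult.assoc)
  have fs: "(\<lambda>n. \<alpha> n * L (zpow n)) sums L (pser \<alpha>)" if "fast \<alpha>" for \<alpha>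
    by (rule functional_sums[where X = A1 and K = "N * W"], rule lin, assumption+, rule fast_imp_A1, assumption,
      rule bd, assumption, rule that)
  define \<beta> where "\<beta> n = cnj (L (zpow n)) * of_real (cf n)" for n
  have Lm: "norm (L (zpow n)) \<le> N * W" for n
    unfolding W_def by (rule order_trans[OF LN[OF zpow_A1] mult_left_mono[OF nrm1_zpow_le N0]])
  have \<beta>: "disc_conv \<beta>"
  proof (rule disc_conv_bound[OF disc_conv_cf])
    show "norm (\<beta> n) \<le> (N * W) * norm (complex_of_real (cf n))" for n
      unfolding \<beta>_def norm_mult complex_mod_cnj by (intro mult_right_mono Lm) auto
  qed
  \<comment> \<open>By this identity the squared A^2 norm of a partial sum of
    \<open>pser \<beta>\<close> and the value of L at it are the same number, called S
    below.\<close>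
  have sq: "(norm (\<beta> n))\<^sup>2 * (2 * mu (2 * n + 1)) = cf n * (norm (L (zpow n)))\<^sup>2" for n
  proof -
    have "cf n * (2 * mu (2 * n + 1)) = 1"
      using mu_pos[of "2 * n + 1"] by (simp add: cf_def del: of_nat_add of_nat_mult)
    moreover have "norm (\<beta> n) = norm (L (zpow n)) * cf n" using cf_pos[of n] by (simp add: \<beta>_def norm_mult)
    moreover have "(x * c)\<^sup>2 * t = c * x\<^sup>2 * (c * t)" for x c t :: real by (simp add: power2_eq_square)
    ultimately show ?thesis by (simp only: mult_1_right)
  qed
  have iw: "integrable dA (\<lambda>z. \<omega> (norm z))" by (rule integrable_weight)
  have pars: "integrable dA (\<lambda>z. (norm (pser b z))\<^sup>2 * \<omega> (norm z))"
    "(\<lambda>n. (norm (b n))\<^sup>2 * (2 * mu (2 * n + 1))) sums (LINT z|dA. (norm (pser b z))\<^sup>2 * \<omega> (norm z))"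
    if "summable (\<lambda>n. norm (b n))" for b
    using parseval_dA(2,3)[OF iw that] by (simp_all only: integral_norm_power_weight Suc_eq_plus1)
  txt \<open>Testing \<open>L\<close> on the partial sums of \<open>pser \<beta>\<close> bounds them in \<open>A\<^sup>2\<close>; this is what makes the
    pairing with the Bloch function \<open>pser \<beta>\<close> converge.\<close>
  have S: "(\<Sum>n<m. cf n * (norm (L (zpow n)))\<^sup>2) \<le> N\<^sup>2 * W" for m
  proof -
    define S where "S = (\<Sum>n<m. cf n * (norm (L (zpow n)))\<^sup>2)"
    let ?b = "\<lambda>n. if n < m then \<beta> n else 0"
    note sb = fast_imp_summable[OF fast_finite[of m \<beta>]]
    have "(\<lambda>n. ?b n * L (zpow n)) sums L (pser ?b)" by (rule fs[OF fast_finite])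
    moreover have "(\<lambda>n. if n \<in> {..<m} then \<beta> n * L (zpow n) else 0) sums (\<Sum>n<m. \<beta> n * L (zpow n))"
      by (rule sums_If_finite_set) simp
    moreover have "(\<lambda>n. if n \<in> {..<m} then \<beta> n * L (zpow n) else 0) = (\<lambda>n. ?b n * L (zpow n))" by auto
    ultimately have "L (pser ?b) = (\<Sum>n<m. \<beta> n * L (zpow n))" by (metis sums_unique2)
    also have "\<dots> = of_real S"
      unfolding S_def of_real_sum
    proof (rule sum.cong[OF refl])
      fix n
      have "\<beta> n * L (zpow n) = of_real (cf n) * (L (zpow n) * cnj (L (zpow n)))" by (simp add: \<beta>_def mult_ac)
      also have "\<dots> = of_real (cf n * (norm (L (zpow n)))\<^sup>2)" by (simp only: complex_norm_square[symmetric] of_real_mult)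
      finally show "\<beta> n * L (zpow n) = of_real (cf n * (norm (L (zpow n)))\<^sup>2)" .
    qed
    finally have Lp: "L (pser ?b) = of_real S" .
    have S0: "0 \<le> S" unfolding S_def by (intro sum_nonneg mult_nonneg_nonneg) (auto intro: less_imp_le cf_pos)
    have "(\<lambda>n. (norm (?b n))\<^sup>2 * (2 * mu (2 * n + 1))) = (\<lambda>n. if n \<in> {..<m} then cf n * (norm (L (zpow n)))\<^sup>2 else 0)"
    proof
      fix n
      show "(norm (?b n))\<^sup>2 * (2 * mu (2 * n + 1)) = (if n \<in> {..<m} then cf n * (norm (L (zpow n)))\<^sup>2 else 0)"
        using sq[of n] by (cases "n < m") simp_all
    qed
    moreover have "(\<lambda>n. if n \<in> {..<m} then cf n * (norm (L (zpow n)))\<^sup>2 else 0) sums S"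
      unfolding S_def by (rule sums_If_finite_set) simp
    ultimately have I: "(LINT z|dA. (norm (pser ?b z))\<^sup>2 * \<omega> (norm z)) = S"
      using pars(2)[OF sb] by (simp only: sums_unique2)
    have SN: "S \<le> N * nrm1 (pser ?b)"
      using LN[OF fast_imp_A1[OF fast_finite[of m \<beta>]]] S0 unfolding Lp by simp
    show ?thesis
    proof (cases "N = 0")
      case True
      from SN show ?thesis using True by (simp add: S_def)
    next
      case False
      then have N: "0 < N" using N0 by simp
      \<comment> \<open>With t = 1 / N the A^2 term comes back as S / 2 after multiplication by N,
        and S absorbs it.\<close>
      have "nrm1 (pser ?b) \<le> ((1 / N) * S + W / (1 / N)) / 2"
        unfolding I[symmetric] W_def
        by (rule nrm1_le_L2[OF borel_measurable_dA_pser[OF fast_imp_disc_conv[OF fast_finite]] pars(1)[OF sb]]) (use N in simp)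
      then have "N * nrm1 (pser ?b) \<le> N * (((1 / N) * S + W / (1 / N)) / 2)" using N by (intro mult_left_mono) auto
      moreover note SN
      moreover have "N * (((1 / N) * S + W / (1 / N)) / 2) = (S + N\<^sup>2 * W) / 2"
        using N by (simp add: power2_eq_square field_simps)
      ultimately show ?thesis by (simp add: S_def)
    qed
  qed
  \<comment> \<open>Any bound independent of r will do, since the norm inequality to be proved is
    for the Bloch norm; hence t = 1.\<close>
  have dil_le: "nrm1 (dil r (pser \<beta>)) \<le> (N\<^sup>2 * W + W) / 2" if r: "0 < r" "r < 1" for r
  proof -
    let ?b = "\<lambda>n. \<beta> n * of_real r ^ n"
    have fb: "fast ?b" using r by (intro disc_conv_fast \<beta>) auto
    note sb = fast_imp_summable[OF fb]
    have "(LINT z|dA. (norm (pser ?b z))\<^sup>2 * \<omega> (norm z)) \<le> N\<^sup>2 * W"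
    proof (rule LIMSEQ_le_const2)
      show "(\<lambda>m. \<Sum>n<m. (norm (?b n))\<^sup>2 * (2 * mu (2 * n + 1))) \<longlonglongrightarrow> (LINT z|dA. (norm (pser ?b z))\<^sup>2 * \<omega> (norm z))"
        using pars(2)[OF sb] by (simp only: sums_def)
      have "(\<Sum>n<m. (norm (?b n))\<^sup>2 * (2 * mu (2 * n + 1))) \<le> N\<^sup>2 * W" for m
      proof -
        have "(norm (?b n))\<^sup>2 * (2 * mu (2 * n + 1)) \<le> cf n * (norm (L (zpow n)))\<^sup>2" for n
        proof -
          have "norm (?b n) \<le> norm (\<beta> n)" using r by (simp add: norm_mult norm_power mult_left_le power_le_one)
          then have "(norm (?b n))\<^sup>2 * (2 * mu (2 * n + 1)) \<le> (norm (\<beta> n))\<^sup>2 * (2 * mu (2 * n + 1))"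
            using mu_pos[of "2 * n + 1"] by (intro mult_right_mono power_mono) auto
          then show ?thesis by (simp only: sq)
        qed
        then show ?thesis by (rule order_trans[OF sum_mono S])
      qed
      then show "\<exists>M. \<forall>m\<ge>M. (\<Sum>n<m. (norm (?b n))\<^sup>2 * (2 * mu (2 * n + 1))) \<le> N\<^sup>2 * W" by blast
    qed
    then show ?thesis
      using nrm1_le_L2[OF borel_measurable_dA_pser[OF fast_imp_disc_conv[OF fb]] pars(1)[OF sb], of 1] r
      by (simp add: dil_pser W_def)
  qed
  have gA: "pser \<beta> \<in> A1" by (rule dil_bounded_imp_A1[OF \<beta> dil_le])
  have gh: "pser \<beta> \<in> hol_disc" by (rule pser_in_hol_disc[OF \<beta>])
  have db: "norm (deriv (pser \<beta>) a) * (1 - (norm a)\<^sup>2) \<le> 2 * M * N" if a: "norm a < 1" for a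
  proof -
    have "(\<lambda>n. cnj (ker a n * L (zpow n))) sums cnj (L (pser (ker a)))"
      using fs[OF fast_ker[OF a]] by (simp only: sums_cnj)
    moreover have "cnj (ker a n * L (zpow n)) = of_nat n * \<beta> n * a ^ (n - 1)" for n
      by (simp add: ker_def \<beta>_def mult_ac)
    ultimately have "(\<lambda>n. of_nat n * \<beta> n * a ^ (n - 1)) sums cnj (L (pser (ker a)))" by simp
    then have "(\<lambda>n. of_nat (Suc n) * \<beta> (Suc n) * a ^ n) sums cnj (L (pser (ker a)))"
      using sums_Suc_iff[of "\<lambda>n. of_nat n * \<beta> n * a ^ (n - 1)" "cnj (L (pser (ker a)))"] by simp
    then have "deriv (pser \<beta>) a = cnj (L (pser (ker a)))"
      using a unfolding deriv_pser[OF \<beta> a] by (simp add: pser_def sums_iff)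
    then have "norm (deriv (pser \<beta>) a) \<le> N * nrm1 (pser (ker a))"
      using LN[OF fast_imp_A1[OF fast_ker[OF a]]] by simp
    also have "\<dots> \<le> N * (M / (1 - norm a))" using N0 KE[OF a] by (intro mult_left_mono)
    finally have "norm (deriv (pser \<beta>) a) * (1 - (norm a)\<^sup>2) \<le> N * (M / (1 - norm a)) * (1 - (norm a)\<^sup>2)"
      using one_minus_norm_square_nonneg[OF a] by (rule mult_right_mono)
    also have "\<dots> \<le> N * (M / (1 - norm a)) * (2 * (1 - norm a))"
      using N0 M a one_minus_square_le[of "norm a"] by (intro mult_left_mono) auto
    also have "\<dots> = 2 * M * N"
    proof -
      have eq: "N * (M / x) * (2 * x) = 2 * M * N" if "x \<noteq> 0" for x using that by simp
      show ?thesis by (rule eq) (use a in simp)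
    qed
    finally show ?thesis .
  qed
  show "\<exists>g\<in>bloch. (\<forall>f\<in>A1. has_pairing \<omega> f g (L f)) \<and> bloch_norm g \<le> (2 * M + 1) * dual_norm A1 nrm1 L"
  proof (intro bexI[of _ "pser \<beta>"] conjI ballI)
    show "pser \<beta> \<in> bloch" by (rule blochI[OF gh db])
    \<comment> \<open>The value at 0 costs exactly N, because \<open>cf 0\<close> is the reciprocal
      of the A^1 norm of the constant 1; this is the \<open>+ 1\<close> in
      \<open>2 * M + 1\<close>.\<close>
    have "norm (pser \<beta> 0) = norm (\<beta> 0)"
      unfolding pser_def using suminf_finite[of "{0}" "\<lambda>n. \<beta> n * 0 ^ n"] by (simp add: power_0_left)
    also have "\<dots> = norm (L (zpow 0)) * cf 0" using cf_pos[of 0] by (simp add: \<beta>_def norm_mult)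
    also have "\<dots> \<le> N * nrm1 (zpow 0) * cf 0" using cf_pos[of 0] by (intro mult_right_mono LN zpow_A1) auto
    also have "\<dots> = N" using mu_pos[of 1] by (simp add: nrm1_zpow_0 cf_def)
    finally show "bloch_norm (pser \<beta>) \<le> (2 * M + 1) * dual_norm A1 nrm1 L"
      using bloch_norm_le[OF gh db] by (simp add: N_def algebra_simps)
    fix f assume f: "f \<in> A1"
    then obtain \<alpha> where \<alpha>: "disc_conv \<alpha>" "f = pser \<alpha>" by (auto simp: A1_iff elim: hol_disc_imp_pser)
    have fi: "integrable dA (\<lambda>z. norm (pser \<alpha> z) * \<omega> (norm z))" using f by (simp add: A1_iff \<alpha>(2))
    have "((\<lambda>r. L (dil r (pser \<alpha>)) - L (pser \<alpha>)) \<longlongrightarrow> 0) (at_left 1)"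
    proof (rule Lim_null_comparison)
      have "eventually (\<lambda>r::real. 0 < r \<and> r < 1) (at_left 1)"
        using eventually_at_left_real[of 0 1] by simp
      then show "eventually (\<lambda>r. norm (L (dil r (pser \<alpha>)) - L (pser \<alpha>)) \<le>
         N * (LINT z|dA. norm (pser \<alpha> (of_real r * z) - pser \<alpha> z) * \<omega> (norm z))) (at_left 1)"
      proof eventually_elim
        case (elim r)
        have d: "dil r (pser \<alpha>) \<in> A1"
          using elim by (simp add: dil_pser, intro fast_imp_A1 disc_conv_fast \<alpha>) auto
        have f': "pser \<alpha> \<in> A1" using f \<alpha>(2) by simp
        have "L (dil r (pser \<alpha>)) - L (pser \<alpha>) = L (\<lambda>z. 1 * dil r (pser \<alpha>) z + (-1) * pser \<alpha> z)"
          by (subst lin[OF d f']) simp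
        also have "norm \<dots> \<le> N * nrm1 (\<lambda>z. 1 * dil r (pser \<alpha>) z + (-1) * pser \<alpha> z)"
          by (intro LN A1_linear d f')
        also have "nrm1 (\<lambda>z. 1 * dil r (pser \<alpha>) z + (-1) * pser \<alpha> z) =
          (LINT z|dA. norm (pser \<alpha> (of_real r * z) - pser \<alpha> z) * \<omega> (norm z))"
          unfolding nrm1_def by (rule Bochner_Integration.integral_cong) (auto simp: dil_def)
        finally show ?case .
      qed
      show "((\<lambda>r. N * (LINT z|dA. norm (pser \<alpha> (of_real r * z) - pser \<alpha> z) * \<omega> (norm z))) \<longlongrightarrow> 0) (at_left 1)"
        by (rule tendsto_mult_right_zero[OF dilation_tendsto[OF \<alpha>(1) iw weight_nonneg fi]])
    qed
    then have "((\<lambda>r. L (dil r (pser \<alpha>))) \<longlongrightarrow> L (pser \<alpha>)) (at_left 1)" by (rule Lim_null[THEN iffD2])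
    then show "has_pairing \<omega> f (pser \<beta>) (L f)" unfolding \<alpha>(2)
      by (intro has_pairing_of_coeffs[where X = A1 and K = "N * W" and L = L, OF _ _ _ \<beta>_def \<beta> gA \<alpha>(1)])
        (rule lin, assumption+, rule fast_imp_A1, assumption, rule bd, assumption)
  qed
qed

lemma dual_A1_imp_proj_bounded:
  assumes "dual_embeds \<omega> A1 nrm1 bloch bloch_norm"
  shows "proj_bounded_Linf_bloch \<omega>"
proof -
  from dual_embedsE[OF assms] obtain C where C: "0 < C"
    and ex: "\<And>L. L \<in> dual_space A1 nrm1 \<Longrightarrow>
      \<exists>g\<in>bloch. (\<forall>f\<in>A1. has_pairing \<omega> f g (L f)) \<and> bloch_norm g \<le> C * dual_norm A1 nrm1 L"
    by metis
  have "bergman_proj \<omega> \<phi> \<in> bloch \<and> bloch_norm (bergman_proj \<omega> \<phi>) \<le> C * Linf_norm \<phi>" if \<phi>: "\<phi> \<in> Linf" for \<phi>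
  proof -
    define L where "L f = (LINT z|dA. f z * (cnj (\<phi> z) * of_real (\<omega> (norm z))))" for f :: "complex \<Rightarrow> complex"
    have b: "norm (L f) \<le> Linf_norm \<phi> * nrm1 f" if "f \<in> A1" for f
      unfolding L_def by (rule norm_integral_Linf_mult_le[OF \<phi> that])
    have "L (\<lambda>z. a * f z + b * g z) = a * L f + b * L g" if "f \<in> A1" "g \<in> A1" for f g a b
    proof -
      note i = integrable_Linf_mult[OF \<phi> that(1)] integrable_Linf_mult[OF \<phi> that(2)]
      have "L (\<lambda>z. a * f z + b * g z) = (LINT z|dA. a * (f z * (cnj (\<phi> z) * of_real (\<omega> (norm z)))) +
          b * (g z * (cnj (\<phi> z) * of_real (\<omega> (norm z)))))"
        unfolding L_def by (rule Bochner_Integration.integral_cong) (auto simp: algebra_simps)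
      then show ?thesis
        unfolding L_def
          Bochner_Integration.integral_add[OF integrable_mult_right[OF i(1)] integrable_mult_right[OF i(2)]]
        by (simp only: integral_mult_right_zero)
    qed
    then have L: "L \<in> dual_space A1 nrm1" using b unfolding dual_space_def by blast
    have "dual_norm A1 nrm1 L \<le> Linf_norm \<phi>"
    proof (rule dual_norm_le[OF b Linf_AE_bound(2)[OF \<phi>] A1_linear[OF zpow_A1 zpow_A1, of 0 0 0 0]])
      show "nrm1 (\<lambda>z. 0 * zpow 0 z + 0 * zpow 0 z) \<le> 1"
        using nrm1_linear_le[OF zpow_A1 zpow_A1, of 0 0 0 0] by simp
    qed
    obtain g where g: "g \<in> bloch" "\<forall>f\<in>A1. has_pairing \<omega> f g (L f)" and "bloch_norm g \<le> C * dual_norm A1 nrm1 L"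
      using ex[OF L] by blast
    note this(3)
    also have "\<dots> \<le> C * Linf_norm \<phi>" using C \<open>dual_norm A1 nrm1 L \<le> Linf_norm \<phi>\<close> by simp
    finally have n: "bloch_norm g \<le> C * Linf_norm \<phi>" .
    obtain \<beta> where \<beta>: "disc_conv \<beta>" "g = pser \<beta>" using g(1) by (auto simp: bloch_def elim: hol_disc_imp_pser)
    have "\<beta> n = proj_coeff \<phi> n" for n
    proof -
      have "has_pairing \<omega> (zpow k) (pser \<beta>) (L (zpow k))" for k using g(2) zpow_A1 \<beta>(2) by blast
      from has_pairing_zpow[OF \<beta>(1) this this, of n]
      have "\<beta> n = cnj (L (zpow n)) / of_real (2 * mu (2 * n + 1))" .
      moreover have "L (zpow n) = (LINT z|dA. z ^ n * (cnj (\<phi> z) * of_real (\<omega> (norm z))))"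
        by (simp only: L_def LINT_zpow_eq)
      ultimately show ?thesis by (simp add: proj_coeff_def cf_def del: of_nat_add of_nat_mult)
    qed
    then have "g = bergman_proj \<omega> \<phi>" unfolding bergman_proj_eq[OF \<phi>] \<beta>(2) by presburger
    then show ?thesis using g(1) n by simp
  qed
  then show ?thesis unfolding proj_bounded_Linf_bloch_def by blast
qed

end

section \<open>Necessity of doubling, and the dual of the little Bloch space\<close>

lemma deriv_zpow:
  assumes "norm z < 1" shows "deriv (zpow n) z = of_nat n * z ^ (n - 1)"
proof -
  have "((\<lambda>z. z ^ n) has_field_derivative of_nat n * z ^ (n - 1)) (at z)"
    by (auto intro!: derivative_eq_intros)
  then have "(zpow n has_field_derivative of_nat n * z ^ (n - 1)) (at z)"
    by (rule has_field_derivative_transform_within_open[where S = \<bbbD>]) (use assms in \<open>auto simp: zpow_def\<close>)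
  then show ?thesis by (rule DERIV_imp_deriv)
qed

lemma zpow_hol_disc: "zpow n \<in> hol_disc"
  unfolding zpow_eq_pser by (intro pser_in_hol_disc fast_imp_disc_conv fast_single)

lemma zpow_little_bloch: "zpow n \<in> little_bloch"
  unfolding zpow_eq_pser by (intro fast_imp_little_bloch fast_single)

lemma bloch_norm_zpow_le: "bloch_norm (zpow n) \<le> 2 * real (Suc n)"
proof -
  have "(\<Sum>k. real (Suc k) * norm (if k = n then 1 else 0 :: complex)) = real (Suc n)"
    by (subst suminf_finite[of "{n}"]) auto
  with bloch_norm_pser_le[OF fast_single[of n 1]] show ?thesis unfolding zpow_eq_pser by simp
qed

context weight
begin

lemma proj_bounded_imp_moment_doubling:
  assumes "proj_bounded_Linf_bloch \<omega>"
  obtains A where "1 \<le> A" "\<And>n. mu (n + 1) \<le> A * mu (2 * n + 1)"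
proof -
  from assms obtain C where C: "\<And>f. f \<in> Linf \<Longrightarrow> bergman_proj \<omega> f \<in> bloch"
    "\<And>f. f \<in> Linf \<Longrightarrow> bloch_norm (bergman_proj \<omega> f) \<le> C * Linf_norm f"
    unfolding proj_bounded_Linf_bloch_def by blast
  \<comment> \<open>The 1 covers n = 0; the rest is |C| divided by the lower bound
    \<open>exp (- 1) * (1 / 2)\<close> found below for the weighted derivative of z^n.\<close>
  define A where "A = 1 + 2 * exp 1 * \<bar>C\<bar>"
  have A: "1 \<le> A" by (simp add: A_def)
  have "mu (n + 1) \<le> A * mu (2 * n + 1)" for n
  proof (cases n)
    case 0
    then show ?thesis using A mu_pos[of 1] by simp
  next
    case (Suc m)
    define q where "q = mu (n + 1) / mu (2 * n + 1)"
    have q: "0 < q" unfolding q_def by (intro divide_pos_pos mu_pos)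
    txt \<open>\<open>\<phi>\<close> has sup norm 1 and is projected to \<open>q z ^ n\<close>.\<close>
    define \<phi> where "\<phi> z = sgn z ^ n" for z :: complex
    have \<phi>m: "\<phi> \<in> borel_measurable dA"
      unfolding \<phi>_def by (intro borel_measurable_dA_borel borel_measurable_power borel_measurable_sgn)
    have \<phi>1: "norm (\<phi> z) \<le> 1" for z unfolding \<phi>_def norm_power by (intro power_le_one norm_sgn_le_1) simp
    note \<phi> = LinfI[OF \<phi>m \<phi>1] Linf_norm_le[OF \<phi>m \<phi>1]
    have coeff: "proj_coeff \<phi> k = (if k = n then of_real q else 0)" for k
    proof (cases "k = n")
      case True
      have "(LINT z|dA. z ^ n * (cnj (\<phi> z) * of_real (\<omega> (norm z)))) = (LINT z|dA. complex_of_real (norm z ^ n * \<omega> (norm z)))"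
      proof (rule Bochner_Integration.integral_cong)
        fix z :: complex
        have "z ^ n * cnj (\<phi> z) = (z * cnj (sgn z)) ^ n" by (simp add: \<phi>_def power_mult_distrib)
        also have "\<dots> = of_real (norm z ^ n)" by (simp add: sgn_cnj_mult)
        finally show "z ^ n * (cnj (\<phi> z) * of_real (\<omega> (norm z))) = complex_of_real (norm z ^ n * \<omega> (norm z))"
          by (simp flip: mult.assoc)
      qed simp
      also have "\<dots> = of_real (2 * mu (n + 1))"
        by (simp only: integral_complex_of_real integral_norm_power_weight Suc_eq_plus1)
      finally show ?thesis using True by (simp add: proj_coeff_def cf_def q_def)
    next
      case False
      have "(LINT z|dA. z ^ k * (cnj (\<phi> z) * of_real (\<omega> (norm z)))) = 0"
      proof (rule integral_dA_eq_0_by_rotation[of _ k n])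
        show "(\<lambda>z. z ^ k * (cnj (\<phi> z) * complex_of_real (\<omega> (norm z)))) \<in> borel_measurable dA"
          by (intro borel_measurable_times power_measurable_dA borel_measurable_integrable integrable_Linf_weight \<phi>(1))
        show "k \<noteq> n" by fact
        show "(c * z) ^ k * (cnj (\<phi> (c * z)) * complex_of_real (\<omega> (norm (c * z)))) =
          c ^ k * cnj c ^ n * (z ^ k * (cnj (\<phi> z) * complex_of_real (\<omega> (norm z))))" if "norm c = 1" for c z
        proof -
          have "sgn (c * z) = c * sgn z" using that by (simp add: sgn_div_norm norm_mult)
          then show ?thesis using that by (simp add: \<phi>_def norm_mult power_mult_distrib mult_ac)
        qed
      qed
      then show ?thesis using False by (simp add: proj_coeff_def)
    qed
    have "bergman_proj \<omega> \<phi> = pser (\<lambda>k. of_real q * (if k = n then 1 else 0) + 0 * (if k = n then 1 else 0))"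
      unfolding bergman_proj_eq[OF \<phi>(1)] by (rule arg_cong[of _ _ pser]) (simp add: fun_eq_iff coeff)
    then have P: "bergman_proj \<omega> \<phi> = (\<lambda>z. of_real q * zpow n z + 0 * zpow n z)"
      unfolding pser_linear[OF fast_imp_disc_conv[OF fast_single] fast_imp_disc_conv[OF fast_single]]
      by (simp only: zpow_eq_pser)
    \<comment> \<open>Close to the point where n \<rho>^(n-1) (1 - \<rho>^2) is largest; at this
      radius the expression is at least exp(-1) / 2, uniformly in n.\<close>
    define \<rho> where "\<rho> = real n / real (Suc n)"
    have \<rho>: "0 < \<rho>" "\<rho> < 1" by (auto simp: \<rho>_def Suc)
    have nz: "norm (complex_of_real \<rho>) = \<rho>" using \<rho> by simp
    have "deriv (bergman_proj \<omega> \<phi>) (of_real \<rho>) = of_real q * (of_nat n * of_real \<rho> ^ m)"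
      unfolding P using \<rho> by (subst deriv_linear[OF zpow_hol_disc zpow_hol_disc]) (simp_all add: deriv_zpow Suc)
    then have nd: "norm (deriv (bergman_proj \<omega> \<phi>) (of_real \<rho>)) = q * (real n * \<rho> ^ m)"
      using q \<rho> by (simp add: norm_mult norm_power)
    have "q * (real n * \<rho> ^ m) * (1 - \<rho>\<^sup>2) \<le> bloch_norm (bergman_proj \<omega> \<phi>)"
      using bloch_norm_ge[OF C(1)[OF \<phi>(1)], of "of_real \<rho>", unfolded nz nd, OF \<rho>(2)]
        norm_ge_zero[of "bergman_proj \<omega> \<phi> 0"] by linarith
    also have "\<dots> \<le> C * Linf_norm \<phi>" by (rule C(2)[OF \<phi>(1)])
    also have "\<dots> \<le> \<bar>C\<bar> * 1"
      using \<phi>(2) Linf_AE_bound(2)[OF \<phi>(1)] by (intro mult_mono) auto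
    finally have up: "q * (real n * \<rho> ^ m) * (1 - \<rho>\<^sup>2) \<le> \<bar>C\<bar>" by simp
    have "1 / 2 \<le> real n * (1 - \<rho>\<^sup>2)"
    proof -
      have "\<rho>\<^sup>2 \<le> \<rho>" using \<rho> power_decreasing[of 1 2 \<rho>] by simp
      then have "real n * (1 - \<rho>) \<le> real n * (1 - \<rho>\<^sup>2)" by (intro mult_left_mono) auto
      moreover have "1 / 2 \<le> real n * (1 - \<rho>)" by (simp add: \<rho>_def Suc field_simps)
      ultimately show ?thesis by linarith
    qed
    moreover have "exp (- 1) \<le> \<rho> ^ m"
    proof -
      have "real m * (1 / \<rho> - 1) \<le> 1" by (simp add: \<rho>_def Suc field_simps)
      then have "exp (- 1) \<le> exp (- (real m * (1 / \<rho> - 1)))" by simp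
      also have "\<dots> \<le> \<rho> powr real m" using \<rho> by (intro exp_le_powr) auto
      finally show ?thesis using \<rho> by (simp add: powr_realpow)
    qed
    ultimately have "exp (- 1) * (1 / 2) \<le> \<rho> ^ m * (real n * (1 - \<rho>\<^sup>2))" using \<rho> by (intro mult_mono) auto
    then have "q * (exp (- 1) * (1 / 2)) \<le> q * (\<rho> ^ m * (real n * (1 - \<rho>\<^sup>2)))" using q by (intro mult_left_mono) auto
    also have "\<dots> \<le> \<bar>C\<bar>" using up by (simp add: mult_ac)
    finally have "q \<le> 2 * exp 1 * \<bar>C\<bar>" by (simp add: exp_minus field_simps)
    also have "\<dots> \<le> A" by (simp add: A_def)
    finally show ?thesis using mu_pos[of "2 * n + 1"] by (simp add: q_def pos_divide_le_eq del: of_nat_add of_nat_mult)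
  qed
  then show ?thesis using that A by blast
qed

text \<open>After k doublings \<open>mu (n + 1)\<close> is bounded by A^k times a much higher
  moment, and \<open>moment_upper\<close> at s = (1 + r) / 2 splits this one into the tail at s and
  a multiple of \<open>mu (n + 1)\<close>. The choice of k makes the latter at most half of the left
  side. For n of order 1 / (1 - r) the left side dominates the tail at r, and the two tails are
  compared.\<close>

lemma moment_doubling_imp_D_hat:
  assumes A: "1 \<le> A" and d: "\<And>n. mu (n + 1) \<le> A * mu (2 * n + 1)"
  shows "\<omega> \<in> D_hat"
proof -
  obtain k :: nat where k: "1 \<le> k" "A ^ k * exp (- ((2 ^ k - 1) / 2)) \<le> 1 / 2"
    using ex_power_mult_exp_small[of A] A by auto
  have iter: "mu (n + 1) \<le> A ^ j * mu (2 ^ j * n + 1)" for n j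
  proof (induction j)
    case (Suc j)
    have "A ^ j * mu (2 ^ j * n + 1) \<le> A ^ j * (A * mu (2 * (2 ^ j * n) + 1))"
      using A by (intro mult_left_mono d) auto
    then show ?case using Suc by (simp add: mult_ac)
  qed simp
  have A0: "1 \<le> A ^ k" using A by (rule one_le_power)
  have T: "0 < tail 0" "0 < tail (3 / 4)" by (intro tail_pos; simp)+
  \<comment> \<open>The first term serves r \<ge> 1 / 2. For smaller r the tail at r is at most
    \<open>tail 0\<close>, and the tail at (1 + r) / 2 is at least
    \<open>tail (3 / 4)\<close>.\<close>
  define C where "C = exp 4 * (2 * A ^ k) + tail 0 / tail (3 / 4)"
  have big: "tail r \<le> exp 4 * (2 * A ^ k) * tail ((1 + r) / 2)" if r: "1 / 2 \<le> r" "r < 1" for r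
  proof -
    define \<delta> where "\<delta> = 1 - r"
    have \<delta>: "0 < \<delta>" "\<delta> \<le> 1 / 2" using r by (auto simp: \<delta>_def)
    \<comment> \<open>Large enough that \<open>s powr ((2 ^ k - 1) * real n)\<close> is at most
      \<open>e\<close>, and small enough that \<open>r powr real (n + 1)\<close> stays above
      \<open>exp (- 4)\<close>.\<close>
    define n where "n = nat \<lceil>1 / \<delta>\<rceil>"
    have n: "1 / \<delta> \<le> real n" "real n \<le> 1 / \<delta> + 1"
      using \<delta> of_int_ceiling_le_add_one[of "1 / \<delta>"] le_of_int_ceiling[of "1 / \<delta>"]
      by (simp_all add: n_def)
    define s where "s = (1 + r) / 2"
    have s: "0 \<le> s" "s < 1" "1 - s = \<delta> / 2" using r by (auto simp: s_def \<delta>_def field_simps)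
    define e where "e = exp (- ((2 ^ k - 1) / 2) :: real)"
    have "real (n + 1) \<le> real (2 ^ k * n + 1)" by (subst of_nat_le_iff) simp
    then have "mu (2 ^ k * n + 1) \<le> tail s + s powr (real (2 ^ k * n + 1) - real (n + 1)) * mu (n + 1)"
      using s by (intro moment_upper) auto
    also have "real (2 ^ k * n + 1) - real (n + 1) = (2 ^ k - 1) * real n" by (simp add: algebra_simps)
    also have "s powr ((2 ^ k - 1) * real n) \<le> exp (- ((2 ^ k - 1) * real n * (1 - s)))"
      using s by (intro powr_le_exp) auto
    also have "\<dots> \<le> e"
    proof -
      have "1 \<le> real n * \<delta>" using n(1) \<delta> by (simp add: pos_divide_le_eq)
      then have "(2 ^ k - 1) / 2 * 1 \<le> (2 ^ k - 1) / 2 * (real n * \<delta>)" by (intro mult_left_mono) auto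
      then have "(2 ^ k - 1) / 2 \<le> (2 ^ k - 1) * real n * (1 - s)" by (simp add: s mult_ac)
      then show ?thesis by (simp only: e_def exp_le_cancel_iff neg_le_iff_le)
    qed
    finally have u: "mu (2 ^ k * n + 1) \<le> tail s + e * mu (n + 1)"
      using mu_pos[of "n + 1"] by (simp add: mult_right_mono)
    have "mu (n + 1) \<le> A ^ k * mu (2 ^ k * n + 1)" by (rule iter)
    also have "\<dots> \<le> A ^ k * (tail s + e * mu (n + 1))" using A0 by (intro mult_left_mono u) auto
    also have "\<dots> = A ^ k * tail s + (A ^ k * e) * mu (n + 1)" by (simp add: algebra_simps)
    also have "(A ^ k * e) * mu (n + 1) \<le> 1 / 2 * mu (n + 1)"
      using k(2) mu_pos[of "n + 1"] by (intro mult_right_mono) (auto simp: e_def)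
    finally have m: "mu (n + 1) \<le> 2 * A ^ k * tail s" by simp
    have "real (n + 1) * (1 / r - 1) \<le> 4"
    proof -
      have "1 / r - 1 = \<delta> / r" using r by (simp add: \<delta>_def field_simps)
      also have "\<dots> \<le> \<delta> / (1 / 2)" using \<delta> r by (intro divide_left_mono) auto
      finally have "real (n + 1) * (1 / r - 1) \<le> (1 / \<delta> + 2) * (2 * \<delta>)" using n \<delta> r by (intro mult_mono) auto
      also have "\<dots> = 2 + 4 * \<delta>" using \<delta> by (simp add: field_simps)
      finally show ?thesis using \<delta> by linarith
    qed
    then have "exp (- 4) \<le> exp (- (real (n + 1) * (1 / r - 1)))" by simp
    also have "\<dots> \<le> r powr real (n + 1)" using r by (intro exp_le_powr) auto
    finally have "exp (- 4) * tail r \<le> r powr real (n + 1) * tail r"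
      using tail_pos[of r] r by (intro mult_right_mono) auto
    also have "\<dots> \<le> mu (n + 1)" using r by (intro moment_lower) auto
    also note m
    finally have "tail r \<le> exp 4 * (2 * A ^ k * tail s)" by (simp add: exp_minus field_simps)
    then show ?thesis by (simp add: s_def mult.assoc)
  qed
  have "tail r \<le> C * tail ((1 + r) / 2)" if r: "0 \<le> r" "r < 1" for r
  proof -
    have t: "0 < tail ((1 + r) / 2)" using r by (intro tail_pos) auto
    show ?thesis
    proof (cases "1 / 2 \<le> r")
      case True
      have "exp 4 * (2 * A ^ k) * tail ((1 + r) / 2) \<le> C * tail ((1 + r) / 2)"
        using T t by (intro mult_right_mono) (auto simp: C_def)
      then show ?thesis using big[OF True r(2)] by linarith
    next
      case False
      have "tail r \<le> tail 0" using r by (intro tail_antimono) auto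
      also have "\<dots> = tail 0 / tail (3 / 4) * tail (3 / 4)" using T by simp
      also have "\<dots> \<le> C * tail ((1 + r) / 2)"
        using False r T A0 by (intro mult_mono tail_antimono) (auto simp: C_def)
      finally show ?thesis .
    qed
  qed
  moreover have "1 \<le> C"
  proof -
    have "1 * 1 \<le> exp 4 * (2 * A ^ k)" using A0 by (intro mult_mono) auto
    then show ?thesis using T by (simp add: C_def add_increasing2)
  qed
  ultimately show ?thesis unfolding D_hat_def by blast
qed

lemma dual_little_bloch_imp_kernel_estimate:
  assumes "dual_embeds \<omega> little_bloch bloch_norm A1 nrm1"
  obtains M where "0 < M" "\<And>a. norm a < 1 \<Longrightarrow> nrm1 (pser (ker a)) \<le> M / (1 - norm a)"
proof -
  from dual_embedsE[OF assms] obtain C where C: "0 < C"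
    and ex: "\<And>L. L \<in> dual_space little_bloch bloch_norm \<Longrightarrow>
      \<exists>g\<in>A1. (\<forall>f\<in>little_bloch. has_pairing \<omega> f g (L f)) \<and> nrm1 g \<le> C * dual_norm little_bloch bloch_norm L"
    by metis
  have "nrm1 (pser (ker a)) \<le> C / (1 - norm a)" if a: "norm a < 1" for a
  proof -
    define t where "t = 1 - (norm a)\<^sup>2"
    have t: "0 < t" "1 - norm a \<le> t"
      using a power_decreasing[of 1 2 "norm a"] by (auto simp: t_def abs_square_less_1)
    define L where "L f = of_real t * deriv f a" for f
    have b: "norm (L f) \<le> 1 * bloch_norm f" if "f \<in> little_bloch" for f
    proof -
      have "norm (L f) = norm (deriv f a) * (1 - (norm a)\<^sup>2)"
        using t by (simp add: L_def norm_mult flip: t_def)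
      then show ?thesis
        using bloch_norm_ge[OF subsetD[OF little_bloch_subset_bloch that] a] norm_ge_zero[of "f 0"] by linarith
    qed
    have "L (\<lambda>z. c * f z + d * g z) = c * L f + d * L g" if "f \<in> little_bloch" "g \<in> little_bloch" for f g c d
      using that a unfolding L_def
      by (subst deriv_linear) (auto simp: little_bloch_imp_hol_disc algebra_simps)
    then have L: "L \<in> dual_space little_bloch bloch_norm" using b unfolding dual_space_def by blast
    have "dual_norm little_bloch bloch_norm L \<le> 1"
    proof (rule dual_norm_le[OF b])
      show "pser (\<lambda>n. if n = 0 then 0 else 0) \<in> little_bloch" by (intro fast_imp_little_bloch fast_single)
      show "bloch_norm (pser (\<lambda>n. if n = 0 then 0 else 0)) \<le> 1"
        using bloch_norm_pser_le[OF fast_single[of 0 0]] by simp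
    qed simp_all
    obtain g where g: "g \<in> A1" "\<forall>f\<in>little_bloch. has_pairing \<omega> f g (L f)"
      and n: "nrm1 g \<le> C * dual_norm little_bloch bloch_norm L"
      using ex[OF L] by blast
    note n
    also have "\<dots> \<le> C * 1" using C \<open>dual_norm little_bloch bloch_norm L \<le> 1\<close> by (intro mult_left_mono) auto
    finally have gC: "nrm1 g \<le> C" by simp
    obtain \<beta> where \<beta>: "disc_conv \<beta>" "g = pser \<beta>" using g(1) by (auto simp: A1_iff elim: hol_disc_imp_pser)
    \<comment> \<open>L maps z^n to t n a^(n-1), so g is t times the kernel; the two-term form is
      that of \<open>pser_linear\<close>.\<close>
    have "\<beta> n = of_real t * ker a n + 0 * ker a n" for n
    proof -
      have "has_pairing \<omega> (zpow k) (pser \<beta>) (L (zpow k))" for k using g(2) zpow_little_bloch \<beta>(2) by blast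
      from has_pairing_zpow[OF \<beta>(1) this this, of n]
      have "\<beta> n = cnj (L (zpow n)) / of_real (2 * mu (2 * n + 1))" .
      then show ?thesis
        by (simp add: L_def deriv_zpow[OF a] ker_def cf_def mult.assoc del: of_nat_add of_nat_mult)
    qed
    then have "g = pser (\<lambda>n. of_real t * ker a n + 0 * ker a n)" unfolding \<beta>(2) by presburger
    also have "\<dots> = (\<lambda>z. of_real t * pser (ker a) z + 0 * pser (ker a) z)"
      by (intro pser_linear fast_imp_disc_conv fast_ker a)
    finally have "nrm1 g = (LINT z|dA. t * (norm (pser (ker a) z) * \<omega> (norm z)))"
      unfolding nrm1_def using t by (simp add: norm_mult mult.assoc)
    then have "t * nrm1 (pser (ker a)) \<le> C" using gC by (simp add: nrm1_def)
    moreover have "(1 - norm a) * nrm1 (pser (ker a)) \<le> t * nrm1 (pser (ker a))"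
      using t nrm1_nonneg by (intro mult_right_mono) auto
    ultimately show ?thesis using a by (simp add: pos_le_divide_eq mult.commute)
  qed
  then show ?thesis using that C by blast
qed

lemma proj_bounded_imp_dual_little_bloch:
  assumes "proj_bounded_Linf_bloch \<omega>"
  shows "dual_embeds \<omega> little_bloch bloch_norm A1 nrm1"
proof -
  from assms obtain C0 where C0: "\<And>f. f \<in> Linf \<Longrightarrow> bergman_proj \<omega> f \<in> bloch"
    "\<And>f. f \<in> Linf \<Longrightarrow> bloch_norm (bergman_proj \<omega> f) \<le> C0 * Linf_norm f"
    unfolding proj_bounded_Linf_bloch_def by blast
  \<comment> \<open>The \<open>+ 1\<close> gives the strict positivity that
    \<open>dual_embeds\<close> demands.\<close>
  define C where "C = \<bar>C0\<bar> + 1"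
  show ?thesis
  proof (rule dual_embedsI)
    show "0 < C" by (simp add: C_def)
    show "A1 \<subseteq> hol_disc" by (auto simp: A1_iff)
    show "zpow n \<in> little_bloch" for n by (rule zpow_little_bloch)
    fix L assume L: "L \<in> dual_space little_bloch bloch_norm"
    define N where "N = dual_norm little_bloch bloch_norm L"
    have LN: "norm (L f) \<le> N * bloch_norm f" if f: "f \<in> little_bloch" for f
      unfolding N_def
    proof (rule norm_le_dual_norm[OF L f])
      show "(\<lambda>z. a * f z) \<in> little_bloch" for a using little_bloch_linear[OF f f, of a 0] by simp
      show "bloch_norm (\<lambda>z. a * f z) \<le> norm a * bloch_norm f" for a
        using f little_bloch_subset_bloch by (intro bloch_norm_scale) auto
      show "0 \<le> bloch_norm g" if "g \<in> little_bloch" for g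
        using that little_bloch_subset_bloch by (intro bloch_norm_nonneg) auto
    qed
    have N0: "0 \<le> N"
    proof -
      have "norm (zpow 0 0) \<le> bloch_norm (zpow 0)"
        using bloch_norm_ge[OF subsetD[OF little_bloch_subset_bloch zpow_little_bloch], of 0 0]
        by (simp add: deriv_zpow)
      then have "0 < bloch_norm (zpow 0)" by (simp add: zpow_def)
      moreover have "0 \<le> N * bloch_norm (zpow 0)"
        using order_trans[OF norm_ge_zero LN[OF zpow_little_bloch]] .
      ultimately show ?thesis by (simp add: zero_le_mult_iff)
    qed
    have lin: "\<And>f g a b. f \<in> little_bloch \<Longrightarrow> g \<in> little_bloch \<Longrightarrow> L (\<lambda>z. a * f z + b * g z) = a * L f + b * L g"
      using L by (simp add: dual_space_def)
    have bd: "norm (L (pser \<alpha>)) \<le> (N * 2) * (\<Sum>n. real (Suc n) * norm (\<alpha> n))" if "fast \<alpha>" for \<alpha>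
      using order_trans[OF LN[OF fast_imp_little_bloch[OF that]] mult_left_mono[OF bloch_norm_pser_le[OF that] N0]]
      by (simp only: mult.assoc)
    have fs: "(\<lambda>n. \<alpha> n * L (zpow n)) sums L (pser \<alpha>)" if "fast \<alpha>" for \<alpha>
      by (rule functional_sums[where X = little_bloch and K = "N * 2"], rule lin, assumption+,
        rule fast_imp_little_bloch, assumption, rule bd, assumption, rule that)
    define \<beta> where "\<beta> n = cnj (L (zpow n)) * of_real (cf n)" for n
    \<comment> \<open>Unlike the A^1 norm, the bound used for the Bloch norm of z^n grows with n, so
      comparison is with \<open>cf n\<close> multiplied by n + 1.\<close>
    have \<beta>: "disc_conv \<beta>"
    proof (rule disc_conv_bound[OF disc_conv_mult_Suc[OF disc_conv_cf]])
      fix n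
      have "norm (L (zpow n)) \<le> N * (2 * real (Suc n))"
        using LN[OF zpow_little_bloch, of n] mult_left_mono[OF bloch_norm_zpow_le[of n] N0] by linarith
      then have "norm (\<beta> n) \<le> N * (2 * real (Suc n)) * norm (complex_of_real (cf n))"
        unfolding \<beta>_def norm_mult complex_mod_cnj by (intro mult_right_mono) auto
      then show "norm (\<beta> n) \<le> (N * 2) * norm (of_nat (Suc n) * complex_of_real (cf n))"
        by (simp only: norm_mult norm_of_nat mult.assoc)
    qed
    txt \<open>With \<open>\<phi>\<close> the sign of the dilation \<open>g\<^sub>r\<close>, its norm is \<open>cnj (L f)\<close> for \<open>f\<close> the dilation of the
      projection of \<open>\<phi>\<close>.\<close>
    have dl: "nrm1 (dil r (pser \<beta>)) \<le> C * N" if r: "0 < r" "r < 1" for r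
    proof -
      let ?b = "\<lambda>n. \<beta> n * of_real r ^ n"
      have fb: "fast ?b" using r by (intro disc_conv_fast \<beta>) auto
      define \<phi> where "\<phi> z = sgn (pser ?b z)" for z
      have \<phi>m: "\<phi> \<in> borel_measurable dA"
        unfolding \<phi>_def
        by (rule measurable_compose[OF borel_measurable_dA_pser[OF fast_imp_disc_conv[OF fb]] borel_measurable_sgn])
      have \<phi>1: "norm (\<phi> z) \<le> 1" for z unfolding \<phi>_def by (rule norm_sgn_le_1)
      note \<phi> = LinfI[OF \<phi>m \<phi>1] Linf_norm_le[OF \<phi>m \<phi>1]
      let ?v = "\<lambda>z. cnj (\<phi> z) * of_real (\<omega> (norm z))"
      let ?p = "\<lambda>n. proj_coeff \<phi> n * of_real r ^ n"
      \<comment> \<open>The projection of \<phi> is only a Bloch function, where L need not be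
        bounded; its dilation is in the little Bloch space and has no larger norm.\<close>
      have fp: "fast ?p" using r by (intro disc_conv_fast disc_conv_proj_coeff \<phi>(1)) auto
      have "(\<lambda>n. ?b n * (LINT z|dA. z ^ n * ?v z)) sums (LINT z|dA. pser ?b z * ?v z)"
        by (rule integral_pser(1)[OF integrable_Linf_weight[OF \<phi>(1)] fast_imp_summable[OF fb]])
      moreover have "(LINT z|dA. pser ?b z * ?v z) = (LINT z|dA. complex_of_real (norm (pser ?b z) * \<omega> (norm z)))"
        by (rule Bochner_Integration.integral_cong) (simp_all add: \<phi>_def sgn_cnj_mult flip: mult.assoc)
      moreover have "\<dots> = of_real (nrm1 (pser ?b))" unfolding nrm1_def by (rule integral_complex_of_real)
      moreover have "?b n * (LINT z|dA. z ^ n * ?v z) = cnj (?p n * L (zpow n))" for n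
        by (simp add: \<beta>_def proj_coeff_def mult_ac)
      ultimately have "(\<lambda>n. cnj (?p n * L (zpow n))) sums of_real (nrm1 (pser ?b))" by (simp only:)
      moreover have "(\<lambda>n. cnj (?p n * L (zpow n))) sums cnj (L (pser ?p))"
        using fs[OF fp] by (simp only: sums_cnj)
      ultimately have "of_real (nrm1 (pser ?b)) = cnj (L (pser ?p))" by (rule sums_unique2)
      then have "norm (complex_of_real (nrm1 (pser ?b))) = norm (cnj (L (pser ?p)))" by (rule arg_cong)
      then have "nrm1 (pser ?b) = norm (L (pser ?p))" using nrm1_nonneg[of "pser ?b"] by simp
      also have "\<dots> \<le> N * bloch_norm (pser ?p)" by (rule LN[OF fast_imp_little_bloch[OF fp]])
      also have "pser ?p = dil r (bergman_proj \<omega> \<phi>)" unfolding bergman_proj_eq[OF \<phi>(1)] using r by (simp add: dil_pser)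
      also have "N * bloch_norm (dil r (bergman_proj \<omega> \<phi>)) \<le> N * bloch_norm (bergman_proj \<omega> \<phi>)"
        using r by (intro mult_left_mono bloch_norm_dil C0(1) \<phi>(1) N0) auto
      also have "\<dots> \<le> N * C"
      proof (rule mult_left_mono[OF _ N0])
        have "C0 * Linf_norm \<phi> \<le> \<bar>C0\<bar> * 1"
          using \<phi>(2) Linf_AE_bound(2)[OF \<phi>(1)] by (intro mult_mono) auto
        then show "bloch_norm (bergman_proj \<omega> \<phi>) \<le> C" using C0(2)[OF \<phi>(1)] by (simp add: C_def)
      qed
      finally show ?thesis using r by (simp add: dil_pser mult.commute)
    qed
    note gA = dil_bounded_imp_A1[OF \<beta> dl]
    show "\<exists>g\<in>A1. (\<forall>f\<in>little_bloch. has_pairing \<omega> f g (L f)) \<and> nrm1 g \<le> C * dual_norm little_bloch bloch_norm L"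
    proof (intro bexI[of _ "pser \<beta>"] conjI ballI gA)
      show "nrm1 (pser \<beta>) \<le> C * dual_norm little_bloch bloch_norm L"
        using nrm1_le_of_dil[OF \<beta> dl] by (simp add: N_def)
      fix f assume f: "f \<in> little_bloch"
      then obtain \<alpha> where \<alpha>: "disc_conv \<alpha>" "f = pser \<alpha>" by (auto dest: little_bloch_imp_hol_disc elim: hol_disc_imp_pser)
      \<comment> \<open>This is the point that requires f to be little Bloch: dilations of a general
        Bloch function need not converge in norm.\<close>
      have "((\<lambda>r. L (dil r f) - L f) \<longlongrightarrow> 0) (at_left 1)"
      proof (rule Lim_null_comparison)
        have "eventually (\<lambda>r::real. 0 < r \<and> r < 1) (at_left 1)"
          using eventually_at_left_real[of 0 1] by simp
        then show "eventually (\<lambda>r. norm (L (dil r f) - L f) \<le> N * bloch_norm (\<lambda>z. 1 * dil r f z + (-1) * f z)) (at_left 1)"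
        proof eventually_elim
          case (elim r)
          have d: "dil r f \<in> little_bloch"
            using elim by (simp add: dil_pser \<alpha>(2), intro fast_imp_little_bloch disc_conv_fast \<alpha>) auto
          have "L (dil r f) - L f = L (\<lambda>z. 1 * dil r f z + (-1) * f z)"
            by (subst lin[OF d f]) simp
          also have "norm \<dots> \<le> N * bloch_norm (\<lambda>z. 1 * dil r f z + (-1) * f z)"
            by (intro LN little_bloch_linear d f)
          finally show ?case .
        qed
        show "((\<lambda>r. N * bloch_norm (\<lambda>z. 1 * dil r f z + (-1) * f z)) \<longlongrightarrow> 0) (at_left 1)"
          by (rule tendsto_mult_right_zero[OF little_bloch_dil_tendsto[OF f]])
      qed
      then have "((\<lambda>r. L (dil r f)) \<longlongrightarrow> L f) (at_left 1)" by (rule Lim_null[THEN iffD2])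
      then show "has_pairing \<omega> f (pser \<beta>) (L f)" unfolding \<alpha>(2)
        by (intro has_pairing_of_coeffs[where X = little_bloch and K = "N * 2" and L = L, OF _ _ _ \<beta>_def \<beta> gA \<alpha>(1)])
          (rule lin, assumption+, rule fast_imp_little_bloch, assumption, rule bd, assumption)
    qed
  qed
qed

end

theorem theorem1:
  fixes \<omega> :: "real \<Rightarrow> real"
  assumes "radial_weight \<omega>"
  shows "(proj_bounded_Linf_bloch \<omega> \<longleftrightarrow>
            dual_embeds \<omega> (bergman_space 1 \<omega>) (Lp_weight_norm 1 \<omega>) bloch bloch_norm)
       \<and> (dual_embeds \<omega> (bergman_space 1 \<omega>) (Lp_weight_norm 1 \<omega>) bloch bloch_norm \<longleftrightarrow>
            dual_embeds \<omega> little_bloch bloch_norm (bergman_space 1 \<omega>) (Lp_weight_norm 1 \<omega>))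
       \<and> (dual_embeds \<omega> little_bloch bloch_norm (bergman_space 1 \<omega>) (Lp_weight_norm 1 \<omega>) \<longleftrightarrow>
            \<omega> \<in> D_hat)"
proof -
  interpret weight \<omega> by unfold_locales (rule assms)
  let ?i = "proj_bounded_Linf_bloch \<omega>"
  let ?ii = "dual_embeds \<omega> A1 nrm1 bloch bloch_norm"
  let ?iii = "dual_embeds \<omega> little_bloch bloch_norm A1 nrm1"
  \<comment> \<open>Two cycles: (i) to (iii) to (ii) to (i), and (i) to (iv) to (ii) to (i). Both
    (iii) and (iv) reach (ii) through the kernel estimate.\<close>
  have "?ii \<Longrightarrow> ?i" by (rule dual_A1_imp_proj_bounded)
  moreover have "?i \<Longrightarrow> \<omega> \<in> D_hat"
    by (elim proj_bounded_imp_moment_doubling moment_doubling_imp_D_hat)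
  moreover have "\<omega> \<in> D_hat \<Longrightarrow> ?ii"
    by (elim D_hat_kernel_estimate kernel_estimate_imp_dual_A1)
  moreover have "?i \<Longrightarrow> ?iii" by (rule proj_bounded_imp_dual_little_bloch)
  moreover have "?iii \<Longrightarrow> ?ii"
    by (elim dual_little_bloch_imp_kernel_estimate kernel_estimate_imp_dual_A1)
  ultimately show ?thesis unfolding Lp_weight_norm_1' by blast
qed

end
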